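(* Fix $k\in\mathbb{N}$, $k\ge1$, and let $q=\lfloor k/2\rfloor+1$. Let $\{a^{(1)}_{ij},a^{(2)}_{ij},\dots,a^{(q)}_{ij}:1\le i\le j\}$ be independent and identically distributed real random variables with variance one, and put $a^{(l)}_{ji}=a^{(l)}_{ij}$. Let $\mathbf{A}_{ij}=\mathbb{C}_k(a^{(1)}_{ij},\dots,a^{(q)}_{ij})$ for $i,j\ge1$ (so $\mathbf{A}_{ij}=\mathbf{A}_{ji}$ are $k\times k$ random symmetric circulant matrices), and let $\mathbb{K}_{n,k}$ be the $kn\times kn$ symmetric random matrix $$\mathbb{K}_{n,k}=\frac{1}{\sqrt n}\begin{bmatrix}\mathbf{A}_{11}&\mathbf{A}_{12}&\dots&\mathbf{A}_{1n}\\ \mathbf{A}_{12}&\mathbf{A}_{22}&\dots&\mathbf{A}_{2n}\\ \vdots&\vdots&\ddots&\vdots\\ \mathbf{A}_{1n}&\mathbf{A}_{2n}&\dots&\mathbf{A}_{nn}\end{bmatrix}.$$ Then, almost surely, the spectral measures $\mu_{\mathbb{K}_{n,k}}$ converge weakly as $n\to\infty$ to $$\nu_k=\begin{cases}\frac{k-1}{k}\,\gamma_{0,\frac{k-1}{k}}+\frac1k\,\gamma_{0,\frac{2k-1}{k}}, & k\text{ odd},\\[4pt] \frac{k-2}{k}\,\gamma_{0,\frac{k-2}{k}}+\frac2k\,\gamma_{0,\frac{2k-2}{k}}, & k\text{ even}.\end{cases}$$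
   Context: Spectral measure: for a Hermitian $N\times N$ matrix $\mathbf{A}$ with eigenvalues $\lambda_1\le\dots\le\lambda_N$ (with multiplicity), $\mu_{\mathbf{A}}=\frac1N\sum_{j=1}^N\delta_{\lambda_j}$. Symmetric circulant: $\mathbb{C}_k(a_1,\dots,a_k)$ is $\frac1{\sqrt k}$ times the $k\times k$ circulant matrix with first row $(a_1,a_2,\dots,a_k)$, each subsequent row being the cyclic shift of the previous one by one place to the right (second row $(a_k,a_1,\dots,a_{k-1})$, etc.), where $a_j=a_{k-j+2}$ for $j=2,\dots,k$. Hence it is determined by $a_1,\dots,a_{\lfloor k/2\rfloor+1}$ and is written $\mathbb{C}_k(a_1,\dots,a_{\lfloor k/2\rfloor+1})$. Semicircle law: $\gamma_{\alpha,\sigma^2}(dx)=\frac{1}{2\pi\sigma^2}\sqrt{4\sigma^2-(x-\alpha)^2}\,\mathbf{1}_{[\alpha-2\sigma,\alpha+2\sigma]}(x)\,dx$. For $k=1,2$ the first term of $\nu_k$ has weight zero and is omitted. *)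

theory Defs
  imports
    "HOL-Probability.Probability"
    "HOL-Computational_Algebra.Fundamental_Theorem_Algebra"
    "Jordan_Normal_Form.Char_Poly"
begin

definition measure_lincomb :: "(real \<times> real measure) list \<Rightarrow> real measure" where
  "measure_lincomb ws =
     measure_of UNIV (sets borel) (\<lambda>B. \<Sum>(w, \<mu>)\<leftarrow>ws. ennreal w * emeasure \<mu> B)"

text \<open>For a Hermitian matrix all roots of the characteristic polynomial are real, so that
  \<^term>\<open>Re\<close> is then only the passage from \<^typ>\<open>complex\<close> to \<^typ>\<open>real\<close>;
  see \<open>hermitian_proots_real\<close> below.\<close>

definition eigenvalue_list :: "complex mat \<Rightarrow> real list" where
  "eigenvalue_list A = sorted_list_of_multiset (image_mset Re (proots (char_poly A)))"

definition spectral_measure :: "complex mat \<Rightarrow> real measure" where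
  "spectral_measure A =
     measure_lincomb (map (\<lambda>x. (1 / real (dim_row A), return borel x)) (eigenvalue_list A))"

text \<open>The second parameter is the variance \<open>\<sigma>\<^sup>2\<close>. For \<open>\<sigma>\<^sup>2 = 0\<close> this is the zero measure.\<close>

definition semicircle :: "real \<Rightarrow> real \<Rightarrow> real measure" where
  "semicircle \<alpha> v = density lborel (\<lambda>x. ennreal
     (1 / (2 * pi * v) * sqrt (4 * v - (x - \<alpha>)\<^sup>2)
        * indicator {\<alpha> - 2 * sqrt v .. \<alpha> + 2 * sqrt v} x))"

text \<open>Sequences \<open>a\<close> are indexed from 1, matrix entries from 0.\<close>

definition circulant :: "nat \<Rightarrow> (nat \<Rightarrow> real) \<Rightarrow> real mat" where
  "circulant k a = Matrix.mat k k (\<lambda>(i, j). a ((j + k - i) mod k + 1))"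

definition sym_circulant :: "nat \<Rightarrow> (nat \<Rightarrow> real) \<Rightarrow> real mat" where
  "sym_circulant k a =
     (1 / sqrt (real k)) \<cdot>\<^sub>m circulant k (\<lambda>j. if j \<le> k div 2 + 1 then a j else a (k - j + 2))"

text \<open>The \<open>n \<times> n\<close> array of \<open>k \<times> k\<close> blocks \<open>B i j\<close> with \<open>1 \<le> i, j \<le> n\<close>.\<close>

definition block_matrix :: "nat \<Rightarrow> nat \<Rightarrow> (nat \<Rightarrow> nat \<Rightarrow> real mat) \<Rightarrow> real mat" where
  "block_matrix n k B = Matrix.mat (k * n) (k * n)
     (\<lambda>(r, s). B (r div k + 1) (s div k + 1) $$ (r mod k, s mod k))"

definition block_circulant :: "nat \<Rightarrow> nat \<Rightarrow> (nat \<Rightarrow> nat \<Rightarrow> nat \<Rightarrow> real) \<Rightarrow> real mat" where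
  "block_circulant n k a =
     (1 / sqrt (real n)) \<cdot>\<^sub>m block_matrix n k (\<lambda>i j. sym_circulant k (\<lambda>l. a l i j))"

text \<open>For \<open>k = 1\<close> and \<open>k = 2\<close> the first term has weight zero.\<close>

definition limit_law :: "nat \<Rightarrow> real measure" where
  "limit_law k =
     (if odd k then measure_lincomb
        [((real k - 1) / real k, semicircle 0 ((real k - 1) / real k)),
         (1 / real k, semicircle 0 ((2 * real k - 1) / real k))]
      else measure_lincomb
        [((real k - 2) / real k, semicircle 0 ((real k - 2) / real k)),
         (2 / real k, semicircle 0 ((2 * real k - 2) / real k))])"

lemma sets_measure_lincomb [simp, measurable_cong]: "sets (measure_lincomb ws) = sets borel"
  and space_measure_lincomb [simp]: "space (measure_lincomb ws) = UNIV"
  using sets.sigma_sets_eq[of "borel :: real measure"]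
  by (simp_all add: measure_lincomb_def space_measure_of_conv sets_measure_of_conv)

lemma emeasure_measure_lincomb:
  assumes ws: "\<And>w \<mu>. (w, \<mu>) \<in> set ws \<Longrightarrow> sets \<mu> = sets borel" and B: "B \<in> sets borel"
  shows "emeasure (measure_lincomb ws) B = (\<Sum>(w, \<mu>)\<leftarrow>ws. ennreal w * emeasure \<mu> B)"
proof (rule emeasure_measure_of[OF measure_lincomb_def])
  show "positive (sets (measure_lincomb ws)) (\<lambda>B. \<Sum>(w, \<mu>)\<leftarrow>ws. ennreal w * emeasure \<mu> B)"
    unfolding positive_def by (induction ws) auto
  show "countably_additive (sets (measure_lincomb ws))
      (\<lambda>B. \<Sum>(w, \<mu>)\<leftarrow>ws. ennreal w * emeasure \<mu> B)"
    unfolding countably_additive_def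
  proof (intro allI impI)
    fix A :: "nat \<Rightarrow> real set"
    assume A: "range A \<subseteq> sets (measure_lincomb ws)" "disjoint_family A"
    show "(\<Sum>i. \<Sum>(w, \<mu>)\<leftarrow>ws. ennreal w * emeasure \<mu> (A i)) =
        (\<Sum>(w, \<mu>)\<leftarrow>ws. ennreal w * emeasure \<mu> (\<Union> (range A)))"
      using ws
    proof (induction ws)
      case (Cons p ws)
      obtain w \<mu> where p: "p = (w, \<mu>)" by fastforce
      have "(\<Sum>i. emeasure \<mu> (A i)) = emeasure \<mu> (\<Union> (range A))"
        using A Cons.prems[of w \<mu>] p by (intro suminf_emeasure) auto
      moreover have "(\<Sum>i. \<Sum>(w, \<mu>)\<leftarrow>ws. ennreal w * emeasure \<mu> (A i)) =
          (\<Sum>(w, \<mu>)\<leftarrow>ws. ennreal w * emeasure \<mu> (\<Union> (range A)))"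
        using Cons by (metis list.set_intros(2))
      ultimately show ?case
        by (simp add: p suminf_add[symmetric] ennreal_suminf_cmult)
    qed simp
  qed
qed (use B in auto)

lemma mset_eigenvalue_list: "mset (eigenvalue_list A) = image_mset Re (proots (char_poly A))"
  by (simp add: eigenvalue_list_def)

lemma length_eigenvalue_list:
  assumes "A \<in> carrier_mat n n"
  shows "length (eigenvalue_list A) = n"
proof -
  have "length (eigenvalue_list A) = size (proots (char_poly A))"
    by (metis mset_eigenvalue_list size_image_mset size_mset)
  also have "\<dots> = n"
    using degree_monic_char_poly[OF assms] by (metis size_proots_complex)
  finally show ?thesis .
qed

lemma prob_space_spectral_measure:
  assumes A: "A \<in> carrier_mat n n" and n: "n > 0"
  shows "prob_space (spectral_measure A)"
proof
  have "emeasure (spectral_measure A) UNIV =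
      (\<Sum>x\<leftarrow>eigenvalue_list A. ennreal (1 / real n))"
    unfolding spectral_measure_def using A
    by (subst emeasure_measure_lincomb) (auto simp: o_def simp del: sum_list_ennreal)
  also have "\<dots> = of_nat n * ennreal (1 / real n)"
    by (simp only: sum_list_triv length_eigenvalue_list[OF A])
  also have "\<dots> = ennreal (real n * (1 / real n))"
    by (subst ennreal_mult) (auto simp: ennreal_of_nat_eq_real_of_nat)
  also have "\<dots> = 1" using n by simp
  finally show "emeasure (spectral_measure A) (space (spectral_measure A)) = 1"
    by (simp add: spectral_measure_def)
qed

lemma hermitian_proots_real:
  fixes A :: "complex mat"
  assumes A: "A \<in> carrier_mat n n"
    and herm: "\<And>i j. i < n \<Longrightarrow> j < n \<Longrightarrow> A $$ (j, i) = cnj (A $$ (i, j))"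
    and z: "z \<in># proots (char_poly A)"
  shows "z \<in> \<real>"
proof -
  have "char_poly A \<noteq> 0" using degree_monic_char_poly[OF A] by auto
  then have "eigenvalue A z" using z eigenvalue_root_char_poly[OF A] by simp
  then obtain v where v: "v \<in> carrier_vec n" "v \<noteq> 0\<^sub>v n" and Av: "A *\<^sub>v v = z \<cdot>\<^sub>v v"
    using A unfolding eigenvalue_def eigenvector_def by auto
  define q where "q = (\<Sum>i<n. \<Sum>j<n. cnj (vec_index v i) * A $$ (i, j) * vec_index v j)"
  define s where "s = (\<Sum>i<n. (cmod (vec_index v i))\<^sup>2)"
  have row: "(\<Sum>j<n. A $$ (i, j) * vec_index v j) = z * vec_index v i" if "i < n" for i
  proof -
    have "vec_index (A *\<^sub>v v) i = (\<Sum>j<n. A $$ (i, j) * vec_index v j)"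
      using A v that by (auto simp: scalar_prod_def atLeast0LessThan intro!: sum.cong)
    then show ?thesis using Av v that by simp
  qed
  have "q = (\<Sum>i<n. cnj (vec_index v i) * (\<Sum>j<n. A $$ (i, j) * vec_index v j))"
    by (simp add: q_def sum_distrib_left mult.assoc)
  also have "\<dots> = (\<Sum>i<n. z * complex_of_real ((cmod (vec_index v i))\<^sup>2))"
  proof (intro sum.cong refl)
    fix i assume "i \<in> {..<n}"
    then show "cnj (vec_index v i) * (\<Sum>j<n. A $$ (i, j) * vec_index v j) =
        z * complex_of_real ((cmod (vec_index v i))\<^sup>2)"
      by (simp only: row lessThan_iff complex_norm_square) (simp add: mult_ac)
  qed
  also have "\<dots> = z * of_real s"
    by (simp add: s_def sum_distrib_left)
  finally have q: "q = z * of_real s" .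
  have "cnj q = (\<Sum>i<n. \<Sum>j<n. vec_index v i * A $$ (j, i) * cnj (vec_index v j))"
    unfolding q_def cnj_sum
    by (intro sum.cong refl) (metis complex_cnj_cnj complex_cnj_mult herm lessThan_iff)
  also have "\<dots> = (\<Sum>j<n. \<Sum>i<n. vec_index v i * A $$ (j, i) * cnj (vec_index v j))"
    by (rule sum.swap)
  also have "\<dots> = q" by (simp add: q_def mult_ac)
  finally have "q \<in> \<real>" by (simp add: Reals_cnj_iff)
  moreover have "s \<noteq> 0"
  proof
    assume "s = 0"
    then have "\<forall>i<n. vec_index v i = 0" by (auto simp: s_def sum_nonneg_eq_0_iff)
    then show False using v by (auto intro: eq_vecI)
  qed
  ultimately show ?thesis
    using q by (metis Reals_divide Reals_of_real nonzero_mult_div_cancel_right of_real_eq_0_iff)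
qed

lemma sym_circulant_carrier [simp]: "sym_circulant k a \<in> carrier_mat k k"
  by (simp add: sym_circulant_def circulant_def)

lemma sym_circulant_sym:
  assumes "i < k" "j < k"
  shows "sym_circulant k a $$ (j, i) = sym_circulant k a $$ (i, j)"
proof -
  define d where "d = (j + k - i) mod k"
  define e where "e = (i + k - j) mod k"
  have "d = 0 \<and> e = 0 \<or> d + e = k"
  proof (cases i j rule: linorder_cases)
    case less
    then have *: "j + k - i = (j - i) + k" using assms by simp
    have "d = j - i" using assms unfolding d_def * mod_add_self2 by (intro mod_less) simp
    moreover have "e = i + k - j" using less assms unfolding e_def by (intro mod_less) simp
    ultimately show ?thesis using less assms by simp
  next
    case greater
    then have *: "i + k - j = (i - j) + k" using assms by simp
    have "e = i - j" using assms unfolding e_def * mod_add_self2 by (intro mod_less) simp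
    moreover have "d = j + k - i" using greater assms unfolding d_def by (intro mod_less) simp
    ultimately show ?thesis using greater assms by simp
  qed (simp add: d_def e_def)
  moreover have "d < k" "e < k" using assms by (auto simp: d_def e_def)
  ultimately consider "d = e" | "d \<le> k div 2" "\<not> e \<le> k div 2" "k - e = d" "k - (e + 1) + 2 = d + 1"
    | "e \<le> k div 2" "\<not> d \<le> k div 2" "k - d = e" "k - (d + 1) + 2 = e + 1"
    by linarith
  then show ?thesis
    using assms by cases (simp_all add: sym_circulant_def circulant_def flip: d_def e_def)
qed

lemma block_circulant_carrier [simp]: "block_circulant n k a \<in> carrier_mat (k * n) (k * n)"
  by (simp add: block_circulant_def block_matrix_def)

lemma block_circulant_sym:
  assumes sym: "\<And>l i j. a l j i = a l i j" and rs: "r < k * n" "s < k * n"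
  shows "block_circulant n k a $$ (s, r) = block_circulant n k a $$ (r, s)"
proof -
  have "k > 0" using rs by (cases k) auto
  then show ?thesis
    using rs by (simp add: block_circulant_def block_matrix_def
      sym_circulant_sym[of "r mod k" k "s mod k"]
      sym[of _ "Suc (s div k)" "Suc (r div k)"])
qed

end

theory Submission
  imports Defs "Jordan_Normal_Form.Schur_Decomposition"
begin

text \<open>A discrete Fourier transform in the block coordinate turns the block matrix into a direct sum
  of \<open>k\<close> Wigner matrices whose entries are the circulant eigenvalues of the blocks; these have variance
  \<open>circ_variance k m\<close>, which takes the two values occurring in the limit law. It therefore suffices to
  prove the semicircle law, almost surely and under a second moment assumption only, for the Stieltjes
  transform \<open>s\<close> of one Wigner matrix.

  Changing one row and column changes the trace of the resolvent by at most \<open>2 / Im z\<close>, so \<open>s\<close>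
  concentrates exponentially around its mean by the bounded differences inequality. A nonzero mean of the
  entries is a rank one perturbation and is removed for the same reason. Expanding the resolvent
  \<open>G\<close> to second order in a single entry inside \<open>tr (H G) = n + z tr G\<close> gives
  \<open>v E[s\<^sup>2] + z E[s] + 1 \<longrightarrow> 0\<close>, where the error is controlled by a truncated second moment; with the
  concentration this forces \<open>E[s]\<close> to the root \<open>m\<close> of \<open>v m\<^sup>2 + z m + 1 = 0\<close> in the upper half plane,
  the Stieltjes transform of the semicircle law. Finally, \<open>Im s\<close> is the Poisson integral of the spectral
  measure, and its convergence for all \<open>z\<close> implies weak convergence.\<close>

section \<open>Resolvents of real symmetric matrices\<close>

text \<open>Only a second moment is assumed, so moments of the spectral measure would require a
  truncation of the entries. Resolvent entries and normalised traces are instead bounded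
  deterministically by \<open>1 / Im z\<close>, and the unbounded entries enter the error through a
  single integral, \<open>truncated_moment\<close>. Concentration is taken over rows, not over
  single entries: each of n rows moves the normalised trace by O(1/n), whereas n^2 entries with the
  same bound would give no decay. The k Wigner matrices are functions of the same variables and are
  dependent (those at frequencies m and k - m even coincide). This is harmless: each limit is a
  constant, so convergence is proved for each frequency separately and the null sets are united.
  Almost sure statements are obtained for one z at a time; a countable dense set of z and a
  Lipschitz bound uniform in the measure give one null set for all z. Working with the Poisson
  kernel, which is nonnegative and bounded, makes Fubini and dominated convergence
  immediate.\<close>

definition shifted_mat :: "nat \<Rightarrow> (nat \<Rightarrow> nat \<Rightarrow> real) \<Rightarrow> complex \<Rightarrow> complex mat" where
  "shifted_mat n H z = Matrix.mat n n (\<lambda>(i, j). of_real (H i j) - (if i = j then z else 0))"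

text \<open>The inverse of \<open>H - z\<close> by Cramer's rule: each entry is a quotient of
  polynomials in the entries of \<open>H\<close>, which makes measurability immediate.\<close>

definition resolvent :: "nat \<Rightarrow> (nat \<Rightarrow> nat \<Rightarrow> real) \<Rightarrow> complex \<Rightarrow> nat \<Rightarrow> nat \<Rightarrow> complex" where
  "resolvent n H z i j =
     adj_mat (shifted_mat n H z) $$ (i, j) / Determinant.det (shifted_mat n H z)"

definition resolvent_trace :: "nat \<Rightarrow> (nat \<Rightarrow> nat \<Rightarrow> real) \<Rightarrow> complex \<Rightarrow> complex" where
  "resolvent_trace n H z = (\<Sum>i<n. resolvent n H z i i)"

definition sym_below :: "nat \<Rightarrow> (nat \<Rightarrow> nat \<Rightarrow> real) \<Rightarrow> bool" where
  "sym_below n H \<longleftrightarrow> (\<forall>i<n. \<forall>j<n. H i j = H j i)"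

lemma shifted_mat_carrier [simp]: "shifted_mat n H z \<in> carrier_mat n n"
  by (simp add: shifted_mat_def)

lemma dim_shifted_mat [simp]:
  "dim_row (shifted_mat n H z) = n" "dim_col (shifted_mat n H z) = n"
  by (simp_all add: shifted_mat_def)

lemma shifted_mat_index [simp]:
  "i < n \<Longrightarrow> j < n \<Longrightarrow> shifted_mat n H z $$ (i, j) = of_real (H i j) - (if i = j then z else 0)"
  by (simp add: shifted_mat_def)

lemma shifted_mat_cong:
  assumes "\<And>i j. i < n \<Longrightarrow> j < n \<Longrightarrow> H i j = H' i j"
  shows "shifted_mat n H z = shifted_mat n H' z"
  unfolding shifted_mat_def using assms by (intro cong_mat) auto

lemma resolvent_cong:
  assumes "\<And>i j. i < n \<Longrightarrow> j < n \<Longrightarrow> H i j = H' i j"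
  shows "resolvent n H z i j = resolvent n H' z i j"
  using shifted_mat_cong[of n H H', OF assms] unfolding resolvent_def by simp

lemma resolvent_trace_cong:
  assumes "\<And>i j. i < n \<Longrightarrow> j < n \<Longrightarrow> H i j = H' i j"
  shows "resolvent_trace n H z = resolvent_trace n H' z"
  unfolding resolvent_trace_def using resolvent_cong[of n H H', OF assms] by simp

text \<open>For symmetric \<open>H\<close> the form x* H x is real, so in x* (H - z) x only the
  shift has an imaginary part. The cases u = 0, u a unit vector and u the direction of a
  perturbation yield invertibility, the Ward identity and the denominator in the rank one
  formula.\<close>

lemma energy_identity:
  fixes x u :: "nat \<Rightarrow> complex"
  assumes sym: "sym_below n H"
    and eq: "\<And>i. i < n \<Longrightarrow> (\<Sum>j<n. of_real (H i j) * x j) - z * x i = u i"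
  shows "Im (\<Sum>i<n. cnj (x i) * u i) = - Im z * (\<Sum>i<n. (cmod (x i))\<^sup>2)"
proof -
  define q where "q = (\<Sum>i<n. \<Sum>j<n. cnj (x i) * of_real (H i j) * x j)"
  have "cnj q = (\<Sum>i<n. \<Sum>j<n. x i * of_real (H j i) * cnj (x j))"
    unfolding q_def cnj_sum using sym by (intro sum.cong refl) (auto simp: sym_below_def)
  also have "\<dots> = (\<Sum>j<n. \<Sum>i<n. x i * of_real (H j i) * cnj (x j))"
    by (rule sum.swap)
  also have "\<dots> = q" by (simp add: q_def mult_ac)
  finally have "Im q = 0" by (metis Reals_cnj_iff complex_is_Real_iff)
  have "(\<Sum>i<n. cnj (x i) * u i) =
      (\<Sum>i<n. cnj (x i) * ((\<Sum>j<n. of_real (H i j) * x j) - z * x i))"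
    using eq by (intro sum.cong refl) simp
  also have "\<dots> = q - (\<Sum>i<n. z * (x i * cnj (x i)))"
    by (simp add: q_def right_diff_distrib sum_subtractf sum_distrib_left mult_ac)
  also have "(\<Sum>i<n. z * (x i * cnj (x i))) = z * of_real (\<Sum>i<n. (cmod (x i))\<^sup>2)"
    by (simp add: sum_distrib_left complex_norm_square[symmetric])
  finally have *: "(\<Sum>i<n. cnj (x i) * u i) = q - z * of_real (\<Sum>i<n. (cmod (x i))\<^sup>2)" .
  show ?thesis unfolding * using \<open>Im q = 0\<close> by simp
qed

lemma det_shifted_mat_nonzero:
  assumes sym: "sym_below n H" and z: "Im z > 0"
  shows "Determinant.det (shifted_mat n H z) \<noteq> 0"
proof
  assume "Determinant.det (shifted_mat n H z) = 0"
  then obtain v where v: "v \<in> carrier_vec n" "v \<noteq> 0\<^sub>v n"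
    and Sv: "shifted_mat n H z *\<^sub>v v = 0\<^sub>v n"
    using det_0_iff_vec_prod_zero[OF shifted_mat_carrier] by blast
  have row: "(\<Sum>j<n. of_real (H i j) * vec_index v j) - z * vec_index v i = 0" if "i < n" for i
  proof -
    have "0 = vec_index (shifted_mat n H z *\<^sub>v v) i" using Sv that by simp
    also have "\<dots> = (\<Sum>j<n. (of_real (H i j) - (if i = j then z else 0)) * vec_index v j)"
      using v that by (auto simp: scalar_prod_def atLeast0LessThan shifted_mat_def intro!: sum.cong)
    also have "\<dots> = (\<Sum>j<n. of_real (H i j) * vec_index v j - (if j = i then z * vec_index v j else 0))"
      by (intro sum.cong refl) (simp add: algebra_simps)
    also have "\<dots> = (\<Sum>j<n. of_real (H i j) * vec_index v j) - z * vec_index v i"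
      using that by (simp add: sum_subtractf)
    finally show ?thesis by simp
  qed
  have "Im (\<Sum>i<n. cnj (vec_index v i) * 0) = - Im z * (\<Sum>i<n. (cmod (vec_index v i))\<^sup>2)"
    by (rule energy_identity[OF sym row])
  then have "(\<Sum>i<n. (cmod (vec_index v i))\<^sup>2) = 0" using z by simp
  then have "\<forall>i<n. vec_index v i = 0" by (auto simp: sum_nonneg_eq_0_iff)
  then show False using v by (auto intro: eq_vecI)
qed

lemma resolvent_right_inverse:
  assumes sym: "sym_below n H" and z: "Im z > 0" and ij: "i < n" "j < n"
  shows "(\<Sum>l<n. (of_real (H i l) - (if i = l then z else 0)) * resolvent n H z l j) =
    (if i = j then 1 else 0)"
proof -
  let ?S = "shifted_mat n H z"
  have adj: "adj_mat ?S \<in> carrier_mat n n" by (rule adj_mat[OF shifted_mat_carrier])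
  have "(?S * adj_mat ?S) $$ (i, j) = (Determinant.det ?S \<cdot>\<^sub>m 1\<^sub>m n) $$ (i, j)"
    by (simp only: adj_mat[OF shifted_mat_carrier])
  moreover have "(?S * adj_mat ?S) $$ (i, j) =
      (\<Sum>l<n. (of_real (H i l) - (if i = l then z else 0)) * adj_mat ?S $$ (l, j))"
    using adj ij by (auto simp: times_mat_def scalar_prod_def atLeast0LessThan shifted_mat_def
        intro!: sum.cong)
  ultimately have "(\<Sum>l<n. (of_real (H i l) - (if i = l then z else 0)) * adj_mat ?S $$ (l, j)) =
      (if i = j then Determinant.det ?S else 0)"
    using ij by simp
  then show ?thesis
    using det_shifted_mat_nonzero[OF sym z]
    by (simp add: resolvent_def sum_divide_distrib[symmetric])
qed

lemma resolvent_equation: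
  assumes "sym_below n H" "Im z > 0" "i < n" "j < n"
  shows "(\<Sum>l<n. of_real (H i l) * resolvent n H z l j) - z * resolvent n H z i j =
    (if i = j then 1 else 0)"
proof -
  have "(\<Sum>l<n. (of_real (H i l) - (if i = l then z else 0)) * resolvent n H z l j) =
     (\<Sum>l<n. of_real (H i l) * resolvent n H z l j - (if l = i then z * resolvent n H z l j else 0))"
    by (intro sum.cong refl) (simp add: algebra_simps)
  also have "\<dots> = (\<Sum>l<n. of_real (H i l) * resolvent n H z l j) - z * resolvent n H z i j"
    using assms by (simp add: sum_subtractf)
  finally show ?thesis using resolvent_right_inverse[OF assms] by simp
qed

text \<open>Both sides are an entry of G^T (H - z) G, bracketed in two ways. The symmetry is without
  conjugation, as z is complex.\<close>

lemma resolvent_sym: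
  assumes sym: "sym_below n H" and z: "Im z > 0" and ij: "i < n" "j < n"
  shows "resolvent n H z i j = resolvent n H z j i"
proof -
  let ?G = "resolvent n H z"
  let ?S = "\<lambda>i j. complex_of_real (H i j) - (if i = j then z else 0)"
  have S: "?S l m = ?S m l" if "l < n" "m < n" for l m
    using sym that by (simp add: sym_below_def)
  have "?G j i = (\<Sum>l<n. ?G l i * (if l = j then 1 else 0))"
    using ij by (simp add: if_distrib[of "(*) _"] cong: if_cong)
  also have "\<dots> = (\<Sum>l<n. ?G l i * (\<Sum>m<n. ?S l m * ?G m j))"
    using resolvent_right_inverse[OF sym z _ ij(2)] by (intro sum.cong refl) auto
  also have "\<dots> = (\<Sum>l<n. \<Sum>m<n. ?G l i * ?S l m * ?G m j)"
    by (simp add: sum_distrib_left mult.assoc)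
  also have "\<dots> = (\<Sum>m<n. \<Sum>l<n. ?G l i * ?S l m * ?G m j)"
    by (rule sum.swap)
  also have "\<dots> = (\<Sum>m<n. \<Sum>l<n. ?S m l * ?G l i * ?G m j)"
    using S by (intro sum.cong refl) (auto simp: mult_ac)
  also have "\<dots> = (\<Sum>m<n. (\<Sum>l<n. ?S m l * ?G l i) * ?G m j)"
    by (simp add: sum_distrib_right)
  also have "\<dots> = (\<Sum>m<n. (if m = i then 1 else 0) * ?G m j)"
    using resolvent_right_inverse[OF sym z _ ij(1)] by (intro sum.cong refl) auto
  also have "\<dots> = (\<Sum>m<n. if m = i then ?G m j else 0)"
    by (intro sum.cong refl) auto
  also have "\<dots> = ?G i j" using ij by simp
  finally show ?thesis by simp
qed

text \<open>The difference of G' (H - z) G and G' (H' - z) G, in which z cancels. That G' is also a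
  left inverse follows from symmetry.\<close>

lemma resolvent_identity:
  assumes sym: "sym_below n H" and sym': "sym_below n H'" and z: "Im z > 0"
    and ij: "i < n" "j < n"
  shows "resolvent n H' z i j - resolvent n H z i j =
    (\<Sum>a<n. \<Sum>b<n. resolvent n H' z i a * of_real (H a b - H' a b) * resolvent n H z b j)"
proof -
  let ?G = "resolvent n H z" and ?G' = "resolvent n H' z"
  let ?S = "\<lambda>i j. complex_of_real (H i j) - (if i = j then z else 0)"
  let ?S' = "\<lambda>i j. complex_of_real (H' i j) - (if i = j then z else 0)"
  have left: "(\<Sum>a<n. ?G' i a * ?S' a b) = (if b = i then 1 else 0)" if "b < n" for b
  proof -
    have "(\<Sum>a<n. ?G' i a * ?S' a b) = (\<Sum>a<n. ?S' b a * ?G' a i)"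
      using resolvent_sym[OF sym' z ij(1)] sym' that
      by (intro sum.cong refl) (auto simp: sym_below_def mult_ac)
    then show ?thesis using resolvent_right_inverse[OF sym' z that ij(1)] by simp
  qed
  have "?G' i j = (\<Sum>a<n. ?G' i a * (if a = j then 1 else 0))"
    using ij by (simp add: if_distrib[of "(*) _"] cong: if_cong)
  also have "\<dots> = (\<Sum>a<n. ?G' i a * (\<Sum>b<n. ?S a b * ?G b j))"
    using resolvent_right_inverse[OF sym z _ ij(2)] by (intro sum.cong refl) auto
  also have "\<dots> = (\<Sum>a<n. \<Sum>b<n. ?G' i a * ?S a b * ?G b j)"
    by (simp add: sum_distrib_left mult.assoc)
  finally have 1: "?G' i j = (\<Sum>a<n. \<Sum>b<n. ?G' i a * ?S a b * ?G b j)" .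
  have "?G i j = (\<Sum>b<n. if b = i then ?G b j else 0)" using ij by simp
  also have "\<dots> = (\<Sum>b<n. (if b = i then 1 else 0) * ?G b j)"
    by (intro sum.cong refl) auto
  also have "\<dots> = (\<Sum>b<n. (\<Sum>a<n. ?G' i a * ?S' a b) * ?G b j)"
    using left by (intro sum.cong refl) auto
  also have "\<dots> = (\<Sum>b<n. \<Sum>a<n. ?G' i a * ?S' a b * ?G b j)"
    by (simp add: sum_distrib_right)
  also have "\<dots> = (\<Sum>a<n. \<Sum>b<n. ?G' i a * ?S' a b * ?G b j)"
    by (rule sum.swap)
  finally have 2: "?G i j = (\<Sum>a<n. \<Sum>b<n. ?G' i a * ?S' a b * ?G b j)" .
  show ?thesis
    by (subst 1, subst 2) (simp add: sum_subtractf[symmetric] algebra_simps)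
qed

lemma resolvent_apply_equation:
  assumes "sym_below n H" "Im z > 0" "i < n"
  shows "(\<Sum>l<n. of_real (H i l) * (\<Sum>j<n. resolvent n H z l j * u j))
      - z * (\<Sum>j<n. resolvent n H z i j * u j) = u i"
proof -
  have "(\<Sum>l<n. of_real (H i l) * (\<Sum>j<n. resolvent n H z l j * u j))
      - z * (\<Sum>j<n. resolvent n H z i j * u j) =
      (\<Sum>l<n. \<Sum>j<n. of_real (H i l) * resolvent n H z l j * u j)
      - (\<Sum>j<n. z * resolvent n H z i j * u j)"
    by (simp add: sum_distrib_left mult.assoc)
  also have "(\<Sum>l<n. \<Sum>j<n. of_real (H i l) * resolvent n H z l j * u j) =
      (\<Sum>j<n. \<Sum>l<n. of_real (H i l) * resolvent n H z l j * u j)"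
    by (rule sum.swap)
  also have "\<dots> - (\<Sum>j<n. z * resolvent n H z i j * u j) =
      (\<Sum>j<n. ((\<Sum>l<n. of_real (H i l) * resolvent n H z l j) - z * resolvent n H z i j) * u j)"
    by (simp add: sum_subtractf left_diff_distrib sum_distrib_right)
  also have "\<dots> = (\<Sum>j<n. if j = i then u j else 0)"
    using resolvent_equation[OF assms] by (intro sum.cong refl) auto
  also have "\<dots> = u i" using assms by simp
  finally show ?thesis .
qed

text \<open>The energy identity for the j-th column, whose right-hand side is the j-th unit
  vector.\<close>

lemma ward_identity:
  assumes "sym_below n H" "Im z > 0" "j < n"
  shows "Im (resolvent n H z j j) = Im z * (\<Sum>i<n. (cmod (resolvent n H z i j))\<^sup>2)"
proof -
  have "Im (\<Sum>i<n. cnj (resolvent n H z i j) * (if i = j then 1 else 0)) =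
      - Im z * (\<Sum>i<n. (cmod (resolvent n H z i j))\<^sup>2)"
    using resolvent_equation[OF assms(1,2) _ assms(3)] by (intro energy_identity[OF assms(1)]) auto
  moreover have "(\<Sum>i<n. cnj (resolvent n H z i j) * (if i = j then 1 else 0)) =
      cnj (resolvent n H z j j)"
    using assms(3) by (simp add: if_distrib[of "(*) _"] cong: if_cong)
  ultimately show ?thesis by simp
qed

lemma resolvent_diag_Im_nonneg:
  assumes "sym_below n H" "Im z > 0" "j < n"
  shows "Im (resolvent n H z j j) \<ge> 0"
  unfolding ward_identity[OF assms] using assms by (intro mult_nonneg_nonneg sum_nonneg) auto

text \<open>A bootstrap: if N is the squared norm of the column, the Ward identity bounds
  \<open>Im z * N\<close> by |G_jj|, while |G_jj| is at most the square root of N.\<close>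

lemma resolvent_column_bound:
  assumes "sym_below n H" "Im z > 0" "j < n"
  shows "(\<Sum>i<n. (cmod (resolvent n H z i j))\<^sup>2) \<le> 1 / (Im z)\<^sup>2"
proof -
  define N where "N = (\<Sum>i<n. (cmod (resolvent n H z i j))\<^sup>2)"
  define g where "g = cmod (resolvent n H z j j)"
  have "g\<^sup>2 \<le> N" unfolding N_def g_def
    using assms(3) by (intro member_le_sum) auto
  moreover have N: "Im z * N \<le> g"
    using ward_identity[OF assms] abs_Im_le_cmod[of "resolvent n H z j j"]
    unfolding N_def g_def by simp
  ultimately have "Im z * g * g \<le> g"
    using assms(2) by (metis (no_types) mult.assoc mult_left_mono order.trans less_imp_le power2_eq_square)
  moreover have "g \<ge> 0" by (simp add: g_def)
  ultimately have "Im z * g \<le> 1"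
    by (cases "g = 0") (auto simp: mult_le_cancel_right1)
  then have "(Im z)\<^sup>2 * N \<le> 1"
    using mult_left_mono[OF N, of "Im z"] assms(2) unfolding power2_eq_square mult.assoc by linarith
  then show ?thesis using assms(2) unfolding N_def[symmetric] by (simp add: field_simps)
qed

lemma resolvent_entry_bound:
  assumes "sym_below n H" "Im z > 0" "i < n" "j < n"
  shows "cmod (resolvent n H z i j) \<le> 1 / Im z"
proof -
  have "(cmod (resolvent n H z i j))\<^sup>2 \<le> (\<Sum>i<n. (cmod (resolvent n H z i j))\<^sup>2)"
    using assms(3) by (intro member_le_sum) auto
  also have "\<dots> \<le> (1 / Im z)\<^sup>2"
    using resolvent_column_bound[OF assms(1,2,4)] by (simp add: power_divide)
  finally show ?thesis using assms(2) by (meson power2_le_imp_le divide_nonneg_pos zero_le_one)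
qed

lemma resolvent_trace_bound:
  assumes "sym_below n H" "Im z > 0"
  shows "cmod (resolvent_trace n H z) \<le> real n / Im z"
proof -
  have "cmod (resolvent_trace n H z) \<le> (\<Sum>i<n. 1 / Im z)"
    unfolding resolvent_trace_def using resolvent_entry_bound[OF assms] by (intro sum_norm_le) auto
  then show ?thesis by simp
qed

lemma resolvent_trace_Im_nonneg:
  assumes "sym_below n H" "Im z > 0"
  shows "Im (resolvent_trace n H z) \<ge> 0"
  unfolding resolvent_trace_def Im_sum
  using resolvent_diag_Im_nonneg[OF assms] by (intro sum_nonneg) auto

text \<open>By the Sherman--Morrison formula the difference of the traces is
  \<open>c x\<cdot>x / (1 + c u\<cdot>x)\<close> with \<open>x = G u\<close>, and \<open>Im (u\<cdot>x) = Im z * \<parallel>x\<parallel>\<^sup>2\<close>. This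
  cancels the size of the perturbation.\<close>

lemma resolvent_trace_rank_one:
  assumes sym: "sym_below n H" and z: "Im z > 0"
  shows "cmod (resolvent_trace n (\<lambda>i j. H i j + c * u i * u j) z - resolvent_trace n H z)
    \<le> 1 / Im z"
proof -
  define H' where "H' = (\<lambda>i j. H i j + c * u i * u j)"
  let ?G = "resolvent n H z" and ?G' = "resolvent n H' z"
  define x where "x = (\<lambda>i. \<Sum>j<n. ?G i j * of_real (u j))"
  define y where "y = (\<lambda>i. \<Sum>j<n. ?G' i j * of_real (u j))"
  define \<beta> where "\<beta> = (\<Sum>j<n. of_real (u j) * x j)"
  define N where "N = (\<Sum>i<n. (cmod (x i))\<^sup>2)"
  define t where "t = (\<Sum>i<n. y i * x i)"
  have sym': "sym_below n H'" using sym by (simp add: H'_def sym_below_def mult_ac)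
  have diff: "?G' i j - ?G i j = - of_real c * y i * x j" if ij: "i < n" "j < n" for i j
  proof -
    have xj: "x j = (\<Sum>b<n. of_real (u b) * ?G b j)"
      unfolding x_def using resolvent_sym[OF sym z ij(2)]
      by (intro sum.cong refl) (auto simp: mult_ac)
    have "?G' i j - ?G i j =
        (\<Sum>a<n. \<Sum>b<n. ?G' i a * of_real (H a b - H' a b) * ?G b j)"
      by (rule resolvent_identity[OF sym sym' z ij])
    also have "\<dots> = (\<Sum>a<n. \<Sum>b<n. - of_real c * ((?G' i a * of_real (u a)) * (of_real (u b) * ?G b j)))"
      by (intro sum.cong refl) (simp add: H'_def mult_ac)
    also have "\<dots> = - of_real c * (y i * (\<Sum>b<n. of_real (u b) * ?G b j))"
      unfolding y_def sum_product by (simp only: sum_distrib_left)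
    finally show ?thesis by (simp add: xj)
  qed
  have trdiff: "resolvent_trace n H' z - resolvent_trace n H z = - of_real c * t"
    unfolding resolvent_trace_def t_def sum_subtractf[symmetric] sum_distrib_left
    using diff by (intro sum.cong refl) (auto simp: mult.assoc)
  have xy: "x i = y i * (1 + of_real c * \<beta>)" if "i < n" for i
  proof -
    have "y i - x i = (\<Sum>j<n. (?G' i j - ?G i j) * of_real (u j))"
      by (simp add: x_def y_def sum_subtractf left_diff_distrib)
    also have "\<dots> = (\<Sum>j<n. - of_real c * y i * (of_real (u j) * x j))"
      using diff[OF that] by (intro sum.cong refl) (auto simp: mult_ac)
    also have "\<dots> = - of_real c * y i * \<beta>" by (simp only: \<beta>_def sum_distrib_left)
    finally show ?thesis by (simp add: algebra_simps)
  qed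
  \<comment> \<open>Multiplying by the Sherman-Morrison denominator avoids a division. The resulting
    sum is bilinear in x, and its modulus is at most \<open>N\<close>.\<close>
  have "(1 + of_real c * \<beta>) * t = (\<Sum>i<n. x i * x i)"
    unfolding t_def sum_distrib_left using xy by (intro sum.cong refl) (auto simp: mult_ac)
  also have "cmod \<dots> \<le> N"
    unfolding N_def by (intro sum_norm_le) (simp add: norm_mult power2_eq_square)
  finally have 1: "cmod (1 + of_real c * \<beta>) * cmod t \<le> N" by (simp add: norm_mult)
  have "Im (\<Sum>i<n. cnj (x i) * of_real (u i)) = - Im z * N"
    unfolding N_def x_def using resolvent_apply_equation[OF sym z]
    by (intro energy_identity[OF sym]) auto
  moreover have "cnj \<beta> = (\<Sum>i<n. cnj (x i) * of_real (u i))"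
    by (simp add: \<beta>_def mult_ac)
  ultimately have "Im (cnj \<beta>) = - Im z * N" by simp
  then have "Im \<beta> = Im z * N" by simp
  then have "\<bar>c\<bar> * (Im z * N) = \<bar>Im (1 + of_real c * \<beta>)\<bar>"
    using z by (simp add: abs_mult N_def sum_nonneg)
  also have "\<dots> \<le> cmod (1 + of_real c * \<beta>)" by (rule abs_Im_le_cmod)
  finally have 2: "\<bar>c\<bar> * (Im z * N) \<le> cmod (1 + of_real c * \<beta>)" .
  have "\<bar>c\<bar> * cmod t \<le> 1 / Im z"
  \<comment> \<open>If \<open>N\<close> = 0 then x and hence \<open>t\<close> vanish; otherwise
    \<open>N\<close> cancels between the two bounds, which leaves a bound free of \<open>c\<close>
    and \<open>u\<close>.\<close>
  proof (cases "N = 0")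
    case True
    then have "\<forall>i<n. x i = 0" by (auto simp: N_def sum_nonneg_eq_0_iff)
    then show ?thesis using z by (simp add: t_def)
  next
    case False
    then have N: "N > 0" by (simp add: N_def sum_nonneg order.not_eq_order_implies_strict)
    have "(\<bar>c\<bar> * (Im z * N)) * cmod t \<le> N"
      using mult_right_mono[OF 2, of "cmod t"] 1 by simp
    then have "(\<bar>c\<bar> * cmod t * Im z) * N \<le> 1 * N" by (simp add: mult_ac)
    then have "\<bar>c\<bar> * cmod t * Im z \<le> 1" using N by (simp only: mult_le_cancel_right_pos)
    then show ?thesis using z by (simp add: pos_le_divide_eq)
  qed
  then show ?thesis using trdiff by (simp add: H'_def norm_mult)
qed

text \<open>A change of one row and column is the rank two perturbation
  \<open>e d\<^sup>T + d e\<^sup>T = \<onehalf> (e + d)(e + d)\<^sup>T - \<onehalf> (e - d)(e - d)\<^sup>T\<close>.\<close>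

lemma resolvent_trace_row_change:
  assumes sym: "sym_below n H" and sym': "sym_below n H'" and z: "Im z > 0" and r: "r < n"
    and agree: "\<And>i j. i < n \<Longrightarrow> j < n \<Longrightarrow> i \<noteq> r \<Longrightarrow> j \<noteq> r \<Longrightarrow> H i j = H' i j"
  shows "cmod (resolvent_trace n H' z - resolvent_trace n H z) \<le> 2 / Im z"
proof -
  \<comment> \<open>The position (r, r) receives both e d^T and d e^T, so the diagonal difference
    enters halved.\<close>
  define d where "d = (\<lambda>j. if j = r then (H' r r - H r r) / 2 else H' r j - H r j)"
  define e where "e = (\<lambda>j. if j = r then 1 else 0 :: real)"
  define H1 where "H1 = (\<lambda>i j. H i j + 1/2 * (e i + d i) * (e j + d j))"
  define H2 where "H2 = (\<lambda>i j. H1 i j + - (1/2) * (e i - d i) * (e j - d j))"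
  have sym1: "sym_below n H1" using sym by (simp add: H1_def sym_below_def mult_ac)
  have "H2 i j = H' i j" if "i < n" "j < n" for i j
  proof -
    have *: "H2 i j = H i j + e i * d j + d i * e j"
      by (simp add: H2_def H1_def field_simps)
    have s: "H i r = H r i" "H' i r = H' r i" using sym sym' that r by (auto simp: sym_below_def)
    show ?thesis
      unfolding * using agree[OF that] s by (auto simp: e_def d_def)
  qed
  then have "resolvent_trace n H' z = resolvent_trace n H2 z"
    by (intro resolvent_trace_cong) simp
  moreover have "cmod (resolvent_trace n H2 z - resolvent_trace n H1 z) \<le> 1 / Im z"
    unfolding H2_def by (rule resolvent_trace_rank_one[OF sym1 z])
  moreover have "cmod (resolvent_trace n H1 z - resolvent_trace n H z) \<le> 1 / Im z"
    unfolding H1_def by (rule resolvent_trace_rank_one[OF sym z])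
  ultimately show ?thesis
    using norm_triangle_ineq[of "resolvent_trace n H2 z - resolvent_trace n H1 z"
        "resolvent_trace n H1 z - resolvent_trace n H z"] by simp
qed

text \<open>Two solutions of the same column equation differ by a solution with right-hand side 0,
  which the energy identity annihilates. This allows a resolvent to be guessed and then
  verified.\<close>

lemma resolvent_unique:
  fixes R :: "nat \<Rightarrow> nat \<Rightarrow> complex"
  assumes sym: "sym_below n H" and z: "Im z > 0"
    and R: "\<And>i j. i < n \<Longrightarrow> j < n \<Longrightarrow>
      (\<Sum>l<n. of_real (H i l) * R l j) - z * R i j = (if i = j then 1 else 0)"
    and ij: "i < n" "j < n"
  shows "resolvent n H z i j = R i j"
proof -
  define x where "x = (\<lambda>l. resolvent n H z l j - R l j)"
  have "(\<Sum>m<n. of_real (H l m) * x m) - z * x l = 0" if "l < n" for l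
    using R[OF that ij(2)] resolvent_equation[OF sym z that ij(2)]
    by (simp add: x_def right_diff_distrib sum_subtractf algebra_simps split: if_splits)
  then have "Im (\<Sum>i<n. cnj (x i) * 0) = - Im z * (\<Sum>i<n. (cmod (x i))\<^sup>2)"
    by (intro energy_identity[OF sym]) auto
  then have "(\<Sum>i<n. (cmod (x i))\<^sup>2) = 0" using z by simp
  then have "\<forall>i<n. x i = 0" by (auto simp: sum_nonneg_eq_0_iff)
  then show ?thesis using ij by (simp add: x_def)
qed

section \<open>Measurability, eigenvalues and Poisson integrals\<close>

lemma measurable_det:
  fixes A :: "'w \<Rightarrow> complex mat"
  assumes "\<And>\<omega>. A \<omega> \<in> carrier_mat n n"
    and "\<And>i j. i < n \<Longrightarrow> j < n \<Longrightarrow> (\<lambda>\<omega>. A \<omega> $$ (i, j)) \<in> borel_measurable M"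
  shows "(\<lambda>\<omega>. Determinant.det (A \<omega>)) \<in> borel_measurable M"
proof -
  have "(\<lambda>\<omega>. \<Sum>p\<in>{p. p permutes {0..<n}}. signof p * (\<Prod>i = 0..<n. A \<omega> $$ (i, p i)))
      \<in> borel_measurable M"
  proof (intro borel_measurable_sum borel_measurable_times borel_measurable_const
      borel_measurable_prod)
    fix p i assume "p \<in> {p. p permutes {0..<n}}" "i \<in> {0..<n}"
    then have "i < n" "p i < n" using permutes_in_image[of p "{0..<n}" i] by auto
    then show "(\<lambda>\<omega>. A \<omega> $$ (i, p i)) \<in> borel_measurable M" by (rule assms(2))
  qed
  moreover have "Determinant.det (A \<omega>) =
      (\<Sum>p\<in>{p. p permutes {0..<n}}. signof p * (\<Prod>i = 0..<n. A \<omega> $$ (i, p i)))" for \<omega>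
    by (rule det_def'[OF assms(1)])
  ultimately show ?thesis by simp
qed

lemma measurable_resolvent:
  assumes H: "\<And>i j. i < n \<Longrightarrow> j < n \<Longrightarrow> (\<lambda>\<omega>. H \<omega> i j) \<in> borel_measurable M"
    and ij: "i < n" "j < n"
  shows "(\<lambda>\<omega>. resolvent n (H \<omega>) z i j) \<in> borel_measurable M"
proof -
  have S: "(\<lambda>\<omega>. shifted_mat n (H \<omega>) z $$ (a, b)) \<in> borel_measurable M" if "a < n" "b < n" for a b
    using H[OF that] that by simp
  have "(\<lambda>\<omega>. Determinant.det (mat_delete (shifted_mat n (H \<omega>) z) j i)) \<in> borel_measurable M"
  proof (rule measurable_det[where n = "n - 1"])
    fix a b assume ab: "a < n - 1" "b < n - 1"
    \<comment> \<open>An entry of the minor is an entry of the full matrix, with the index shifted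
      past the deleted row \<open>j\<close> and column \<open>i\<close>.\<close>
    then have "(\<lambda>\<omega>. shifted_mat n (H \<omega>) z $$
        (if a < j then a else Suc a, if b < i then b else Suc b)) \<in> borel_measurable M"
      by (intro S) auto
    then show "(\<lambda>\<omega>. mat_delete (shifted_mat n (H \<omega>) z) j i $$ (a, b)) \<in> borel_measurable M"
      using ab unfolding mat_delete_def by simp
  qed (auto simp: mat_delete_def shifted_mat_def)
  moreover have "(\<lambda>\<omega>. Determinant.det (shifted_mat n (H \<omega>) z)) \<in> borel_measurable M"
    by (rule measurable_det[OF _ S]) auto
  moreover have "adj_mat (shifted_mat n (H \<omega>) z) $$ (i, j) =
      (- 1) ^ (j + i) * Determinant.det (mat_delete (shifted_mat n (H \<omega>) z) j i)" for \<omega>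
    using ij by (simp add: adj_mat_def cofactor_def shifted_mat_def)
  ultimately show ?thesis unfolding resolvent_def by simp
qed

lemma measurable_resolvent_trace:
  assumes "\<And>i j. i < n \<Longrightarrow> j < n \<Longrightarrow> (\<lambda>\<omega>. H \<omega> i j) \<in> borel_measurable M"
  shows "(\<lambda>\<omega>. resolvent_trace n (H \<omega>) z) \<in> borel_measurable M"
  unfolding resolvent_trace_def
  using measurable_resolvent[of n H M, OF assms] by (intro borel_measurable_sum) auto

section \<open>The trace of the resolvent as a sum over eigenvalues\<close>

lemma sum_diag_mult_comm:
  fixes X Y :: "'a :: comm_semiring_0 mat"
  assumes "X \<in> carrier_mat n n" "Y \<in> carrier_mat n n"
  shows "(\<Sum>i<n. (X * Y) $$ (i, i)) = (\<Sum>i<n. (Y * X) $$ (i, i))"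
proof -
  have "(\<Sum>i<n. (X * Y) $$ (i, i)) = (\<Sum>i<n. \<Sum>l<n. X $$ (i, l) * Y $$ (l, i))"
    using assms by (auto simp: times_mat_def scalar_prod_def atLeast0LessThan intro!: sum.cong)
  also have "\<dots> = (\<Sum>l<n. \<Sum>i<n. Y $$ (l, i) * X $$ (i, l))"
    by (subst sum.swap) (simp add: mult.commute)
  also have "\<dots> = (\<Sum>i<n. (Y * X) $$ (i, i))"
    using assms by (auto simp: times_mat_def scalar_prod_def atLeast0LessThan intro!: sum.cong)
  finally show ?thesis .
qed

text \<open>The i-th row of U T = 1 is solved from the left: column by column the entries before the
  diagonal vanish, and the diagonal column then reads U_ii T_ii = 1.\<close>

lemma diag_inverse_upper_triangular:
  fixes U T :: "'a :: field mat"
  assumes U: "U \<in> carrier_mat n n" and T: "T \<in> carrier_mat n n"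
    and ut: "upper_triangular T" and nz: "\<And>i. i < n \<Longrightarrow> T $$ (i, i) \<noteq> 0"
    and UT: "U * T = 1\<^sub>m n" and i: "i < n"
  shows "U $$ (i, i) = 1 / T $$ (i, i)"
proof -
  have sum: "(\<Sum>l<n. U $$ (i, l) * T $$ (l, j)) = (if i = j then 1 else 0)" if "j < n" for j
  proof -
    have "(U * T) $$ (i, j) = (\<Sum>l<n. U $$ (i, l) * T $$ (l, j))"
      using U T i that by (auto simp: times_mat_def scalar_prod_def atLeast0LessThan intro!: sum.cong)
    then show ?thesis using UT i that by simp
  qed
  have single: "(\<Sum>l<n. U $$ (i, l) * T $$ (l, j)) = U $$ (i, j) * T $$ (j, j)"
    if j: "j < n" and z: "\<And>l. l < j \<Longrightarrow> U $$ (i, l) = 0" for j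
  proof -
    have "(\<Sum>l<n. U $$ (i, l) * T $$ (l, j)) = (\<Sum>l\<in>{j}. U $$ (i, l) * T $$ (l, j))"
    proof (rule sum.mono_neutral_right)
      show "\<forall>l\<in>{..<n} - {j}. U $$ (i, l) * T $$ (l, j) = 0"
        using z ut T j unfolding upper_triangular_def by (auto simp: not_less) (metis nat_neq_iff)
    qed (use j in auto)
    then show ?thesis by simp
  qed
  have zero: "j < i \<Longrightarrow> U $$ (i, j) = 0" for j
  proof (induction j rule: less_induct)
    case (less j)
    then have "U $$ (i, j) * T $$ (j, j) = 0"
      using sum[of j] single[of j] i by simp
    then show ?case using nz[of j] less.prems i by simp
  qed
  have "U $$ (i, i) * T $$ (i, i) = 1"
    using single[OF i zero] sum[OF i] by simp
  then show ?thesis using nz[OF i] by (simp add: field_simps)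
qed

text \<open>In a Schur basis A - z becomes upper triangular with diagonal \<open>es\<close> shifted
  by z, and conjugation leaves the trace of the inverse unchanged. Triangular form suffices, because
  the diagonal of the inverse depends only on the diagonal.\<close>

lemma trace_inverse_shift:
  fixes A R :: "complex mat"
  assumes A: "A \<in> carrier_mat n n" and es: "char_poly A = (\<Prod>a\<leftarrow>es. [:- a, 1:])"
    and z: "z \<notin> set es" and R: "R \<in> carrier_mat n n"
    and inv: "(A - z \<cdot>\<^sub>m 1\<^sub>m n) * R = 1\<^sub>m n"
  shows "(\<Sum>i<n. R $$ (i, i)) = (\<Sum>e\<leftarrow>es. 1 / (e - z))"
proof -
  obtain B P Q where dec: "schur_decomposition A es = (B, P, Q)" by (cases "schur_decomposition A es")
  from schur_decomposition[OF A es dec]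
  have wit: "similar_mat_wit A B P Q" and ut: "upper_triangular B" and diag: "diag_mat B = es" by auto
  note w = similar_mat_witD2[OF A wit]
  let ?z = "z \<cdot>\<^sub>m 1\<^sub>m n :: complex mat"
  define T where "T = B - ?z"
  define U where "U = Q * R * P"
  have T: "T \<in> carrier_mat n n" and U: "U \<in> carrier_mat n n"
    using w R by (auto simp: T_def U_def)
  note [simp] = assoc_mult_mat[of _ n n _ n _ n]
  have "Q * (A - ?z) * P = Q * A * P - Q * ?z * P"
    using w by (simp add: mult_minus_distrib_mat[of _ n n _ n] minus_mult_distrib_mat[of _ n n _ _ n])
  also have "Q * A * P = (Q * P) * B * (Q * P)"
    using w(5-7) by (subst w(3)) simp
  also have "\<dots> = B" unfolding w(2) using w(5) by simp
  also have "Q * ?z * P = z \<cdot>\<^sub>m (Q * P)"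
    using w by (simp add: mult_smult_distrib[of _ n n _ n] mult_smult_assoc_mat[of _ n n _ n])
  also have "\<dots> = ?z" by (simp only: w)
  finally have TS: "Q * (A - ?z) * P = T" by (simp add: T_def)
  have "T * U = Q * (A - ?z) * (P * Q) * R * P"
    using w(4-7) R by (simp add: U_def minus_carrier_mat mult_carrier_mat[of _ n n _ n] flip: TS)
  also have "\<dots> = Q * ((A - ?z) * R) * P"
    unfolding w(1) using w(4-7) R by (simp add: minus_carrier_mat mult_carrier_mat[of _ n n _ n])
  also have "\<dots> = 1\<^sub>m n" unfolding inv using w by simp
  finally have "U * T = 1\<^sub>m n" using mat_mult_left_right_inverse[OF T U] by simp
  have Bdiag: "map (\<lambda>i. B $$ (i, i)) [0..<n] = es"
    using diag w unfolding diag_mat_def by simp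
  have nz: "T $$ (i, i) \<noteq> 0" if "i < n" for i
  proof -
    have "B $$ (i, i) \<in> set es" using that by (auto simp flip: Bdiag)
    then show ?thesis using z w that by (auto simp: T_def)
  qed
  have utT: "upper_triangular T"
    using ut w unfolding upper_triangular_def T_def by auto
  have "(\<Sum>i<n. R $$ (i, i)) = (\<Sum>i<n. (R * (P * Q)) $$ (i, i))" using w R by simp
  also have "\<dots> = (\<Sum>i<n. (R * P * Q) $$ (i, i))" using w R by simp
  also have "\<dots> = (\<Sum>i<n. (Q * (R * P)) $$ (i, i))"
    using w R by (intro sum_diag_mult_comm) auto
  also have "\<dots> = (\<Sum>i<n. U $$ (i, i))" using w R by (simp add: U_def)
  also have "\<dots> = (\<Sum>i<n. 1 / T $$ (i, i))"
    using diag_inverse_upper_triangular[OF U T utT nz \<open>U * T = 1\<^sub>m n\<close>] by simp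
  also have "\<dots> = (\<Sum>i\<leftarrow>[0..<n]. 1 / (B $$ (i, i) - z))"
    using w by (subst interv_sum_list_conv_sum_set_nat) (auto simp: T_def atLeast0LessThan)
  also have "\<dots> = (\<Sum>e\<leftarrow>es. 1 / (e - z))" by (simp add: o_def flip: Bdiag)
  finally show ?thesis .
qed

text \<open>The imaginary part of the Stieltjes kernel, which is pi times the Poisson kernel of the
  upper half plane.\<close>

definition poisson :: "complex \<Rightarrow> real \<Rightarrow> real" where
  "poisson z x = Im (1 / (of_real x - z))"

lemma poisson_altdef: "poisson z x = Im z / ((x - Re z)\<^sup>2 + (Im z)\<^sup>2)"
  by (simp add: poisson_def Im_divide power2_eq_square)

lemma poisson_nonneg: "Im z > 0 \<Longrightarrow> poisson z x \<ge> 0"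
  by (simp add: poisson_altdef)

lemma poisson_le: "Im z > 0 \<Longrightarrow> poisson z x \<le> 1 / Im z"
proof -
  assume z: "Im z > 0"
  have "Im z / ((x - Re z)\<^sup>2 + (Im z)\<^sup>2) \<le> Im z / (Im z)\<^sup>2"
    using z by (intro divide_left_mono) (auto intro!: mult_pos_pos add_nonneg_pos)
  then show ?thesis using z by (simp add: poisson_altdef power2_eq_square)
qed

lemma continuous_on_poisson: "Im z > 0 \<Longrightarrow> continuous_on S (poisson z)"
  unfolding poisson_altdef[abs_def]
  by (intro continuous_intros) (auto simp: add_nonneg_eq_0_iff)

lemma borel_measurable_poisson: "Im z > 0 \<Longrightarrow> poisson z \<in> borel_measurable borel"
  by (intro borel_measurable_continuous_onI continuous_on_poisson)

lemma integrable_poisson: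
  assumes "finite_measure \<mu>" "sets \<mu> = sets borel" "Im z > 0"
  shows "integrable \<mu> (poisson z)"
proof (rule finite_measure.integrable_const_bound[OF assms(1), where B = "1 / Im z"])
  show "AE x in \<mu>. norm (poisson z x) \<le> 1 / Im z"
    using assms(3) by (simp add: poisson_nonneg poisson_le)
  show "poisson z \<in> borel_measurable \<mu>"
    using borel_measurable_poisson[OF assms(3)] assms(2) by (simp cong: measurable_cong_sets)
qed

section \<open>Integrals against finite linear combinations of measures\<close>

lemma SUP_sum_list_ennreal:
  fixes F :: "'a \<Rightarrow> nat \<Rightarrow> ennreal"
  assumes "\<And>p. p \<in> set ws \<Longrightarrow> incseq (F p)"
  shows "(SUP i. \<Sum>p\<leftarrow>ws. F p i) = (\<Sum>p\<leftarrow>ws. SUP i. F p i)"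
  using assms
proof (induction ws)
  case (Cons p ws)
  have "incseq (\<lambda>i. \<Sum>p\<leftarrow>ws. F p i)"
    using Cons.prems by (auto simp: incseq_def intro!: sum_list_mono)
  then show ?case
    using Cons by (simp add: ennreal_SUP_add)
qed simp

text \<open>The definition fixes only the values on Borel sets, so the formula is carried to
  functions by measure-theoretic induction; suprema pass through the finite sum by
  \<open>SUP_sum_list_ennreal\<close>.\<close>

lemma nn_integral_measure_lincomb:
  assumes sets: "\<And>w \<mu>. (w, \<mu>) \<in> set ws \<Longrightarrow> sets \<mu> = sets borel"
    and f: "f \<in> borel_measurable borel"
  shows "(\<integral>\<^sup>+x. f x \<partial>measure_lincomb ws) = (\<Sum>(w, \<mu>)\<leftarrow>ws. ennreal w * (\<integral>\<^sup>+x. f x \<partial>\<mu>))"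
  using f
proof (induction rule: borel_measurable_induct)
  case (cong f g)
  then have "f = g" by auto
  then show ?case using cong by simp
next
  case (set A)
  have "ennreal w * integral\<^sup>N \<mu> (indicator A) = ennreal w * emeasure \<mu> A" if "(w, \<mu>) \<in> set ws" for w \<mu>
    using sets[OF that] set by simp
  then have "(\<Sum>(w, \<mu>)\<leftarrow>ws. ennreal w * integral\<^sup>N \<mu> (indicator A)) =
      (\<Sum>(w, \<mu>)\<leftarrow>ws. ennreal w * emeasure \<mu> A)"
    by (intro arg_cong[where f = sum_list] map_cong refl) auto
  then show ?case using set emeasure_measure_lincomb[of ws A, OF sets] by simp
next
  case (mult u c)
  have "(\<Sum>(w, \<mu>)\<leftarrow>ws. ennreal w * (\<integral>\<^sup>+x. c * u x \<partial>\<mu>)) =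
      (\<Sum>p\<leftarrow>ws. c * (case p of (w, \<mu>) \<Rightarrow> ennreal w * (\<integral>\<^sup>+x. u x \<partial>\<mu>)))"
  proof (intro arg_cong[where f = sum_list] map_cong refl, safe)
    fix w \<mu> assume "(w, \<mu>) \<in> set ws"
    from sets[OF this] mult(2) have "u \<in> borel_measurable \<mu>"
      by (simp cong: measurable_cong_sets)
    then show "ennreal w * (\<integral>\<^sup>+x. c * u x \<partial>\<mu>) = c * (ennreal w * (\<integral>\<^sup>+x. u x \<partial>\<mu>))"
      by (simp add: nn_integral_cmult mult_ac)
  qed
  moreover have "(\<integral>\<^sup>+x. c * u x \<partial>measure_lincomb ws) = c * (\<integral>\<^sup>+x. u x \<partial>measure_lincomb ws)"
    using mult(2) by (intro nn_integral_cmult) measurable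
  ultimately show ?case using mult by (simp add: sum_list_const_mult)
next
  case (add u v)
  have "(\<Sum>(w, \<mu>)\<leftarrow>ws. ennreal w * (\<integral>\<^sup>+x. v x + u x \<partial>\<mu>)) =
      (\<Sum>p\<leftarrow>ws. (case p of (w, \<mu>) \<Rightarrow> ennreal w * (\<integral>\<^sup>+x. v x \<partial>\<mu>)) +
        (case p of (w, \<mu>) \<Rightarrow> ennreal w * (\<integral>\<^sup>+x. u x \<partial>\<mu>)))"
  proof (intro arg_cong[where f = sum_list] map_cong refl, safe)
    fix w \<mu> assume "(w, \<mu>) \<in> set ws"
    from sets[OF this] add.hyps(1,3) have "u \<in> borel_measurable \<mu>" "v \<in> borel_measurable \<mu>"
      by (simp_all cong: measurable_cong_sets)
    then show "ennreal w * (\<integral>\<^sup>+x. v x + u x \<partial>\<mu>) =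
        ennreal w * (\<integral>\<^sup>+x. v x \<partial>\<mu>) + ennreal w * (\<integral>\<^sup>+x. u x \<partial>\<mu>)"
      by (simp add: nn_integral_add distrib_left)
  qed
  moreover have "(\<integral>\<^sup>+x. v x + u x \<partial>measure_lincomb ws) =
      (\<integral>\<^sup>+x. v x \<partial>measure_lincomb ws) + (\<integral>\<^sup>+x. u x \<partial>measure_lincomb ws)"
    using add.hyps(1,3) measurable_cong_sets[of "measure_lincomb ws" borel borel borel]
    by (intro nn_integral_add) auto
  ultimately show ?case using add by (simp add: sum_list_addf)
next
  case (seq U)
  note [measurable] = seq.hyps(1)
  have U: "U i \<in> borel_measurable \<mu>" if "(w, \<mu>) \<in> set ws" for i w \<mu>
    using sets[OF that] seq.hyps(1)[of i] by (simp cong: measurable_cong_sets)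
  have "(\<integral>\<^sup>+x. (SUP i. U i) x \<partial>measure_lincomb ws) = (\<integral>\<^sup>+x. (SUP i. U i x) \<partial>measure_lincomb ws)"
    by (simp add: image_comp)
  also have "\<dots> = (SUP i. \<integral>\<^sup>+x. U i x \<partial>measure_lincomb ws)"
    using seq by (intro nn_integral_monotone_convergence_SUP) measurable
  also have "\<dots> = (SUP i. \<Sum>p\<leftarrow>ws. (case p of (w, \<mu>) \<Rightarrow> ennreal w * (\<integral>\<^sup>+x. U i x \<partial>\<mu>)))"
    using seq by simp
  also have "\<dots> = (\<Sum>p\<leftarrow>ws. SUP i. (case p of (w, \<mu>) \<Rightarrow> ennreal w * (\<integral>\<^sup>+x. U i x \<partial>\<mu>)))"
    using seq.hyps(3) by (intro SUP_sum_list_ennreal)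
      (auto simp: incseq_def le_fun_def intro!: mult_left_mono nn_integral_mono)
  also have "\<dots> = (\<Sum>p\<leftarrow>ws. (case p of (w, \<mu>) \<Rightarrow> ennreal w * (\<integral>\<^sup>+x. (SUP i. U i) x \<partial>\<mu>)))"
  proof (intro arg_cong[where f = sum_list] map_cong refl, safe)
    fix w \<mu> assume p: "(w, \<mu>) \<in> set ws"
    have "(\<integral>\<^sup>+x. (SUP i. U i) x \<partial>\<mu>) = (\<integral>\<^sup>+x. (SUP i. U i x) \<partial>\<mu>)"
      by (simp add: image_comp)
    also have "\<dots> = (SUP i. \<integral>\<^sup>+x. U i x \<partial>\<mu>)"
      using seq.hyps(3) U[OF p] by (intro nn_integral_monotone_convergence_SUP)
    finally show "(SUP i. ennreal w * (\<integral>\<^sup>+x. U i x \<partial>\<mu>)) = ennreal w * (\<integral>\<^sup>+x. (SUP i. U i) x \<partial>\<mu>)"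
      by (simp add: SUP_mult_left_ennreal)
  qed
  finally show ?case .
qed

lemma integral_measure_lincomb:
  assumes sets: "\<And>w \<mu>. (w, \<mu>) \<in> set ws \<Longrightarrow> sets \<mu> = sets borel"
    and w: "\<And>w \<mu>. (w, \<mu>) \<in> set ws \<Longrightarrow> w \<ge> 0"
    and int: "\<And>w \<mu>. (w, \<mu>) \<in> set ws \<Longrightarrow> integrable \<mu> f"
    and f: "f \<in> borel_measurable borel" "\<And>x. f x \<ge> 0"
  shows "(\<integral>x. f x \<partial>measure_lincomb ws) = (\<Sum>(w, \<mu>)\<leftarrow>ws. w * (\<integral>x. f x \<partial>\<mu>))"
proof -
  have "(\<integral>\<^sup>+x. ennreal (f x) \<partial>measure_lincomb ws) =
      (\<Sum>(w, \<mu>)\<leftarrow>ws. ennreal w * (\<integral>\<^sup>+x. ennreal (f x) \<partial>\<mu>))"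
    using f by (intro nn_integral_measure_lincomb[OF sets]) auto
  also have "\<dots> = (\<Sum>p\<leftarrow>ws. ennreal (case p of (w, \<mu>) \<Rightarrow> w * (\<integral>x. f x \<partial>\<mu>)))"
  proof (intro arg_cong[where f = sum_list] map_cong refl, safe)
    fix w' \<mu> assume p: "(w', \<mu>) \<in> set ws"
    show "ennreal w' * (\<integral>\<^sup>+x. ennreal (f x) \<partial>\<mu>) = ennreal (w' * (\<integral>x. f x \<partial>\<mu>))"
      using nn_integral_eq_integral[OF int[OF p]] f w[OF p] by (simp add: ennreal_mult)
  qed
  also have "\<dots> = ennreal (\<Sum>(w, \<mu>)\<leftarrow>ws. w * (\<integral>x. f x \<partial>\<mu>))"
    using w f by (intro sum_list_ennreal) auto
  finally have *: "(\<integral>\<^sup>+x. ennreal (f x) \<partial>measure_lincomb ws) =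
      ennreal (\<Sum>(w, \<mu>)\<leftarrow>ws. w * (\<integral>x. f x \<partial>\<mu>))" .
  have "(\<Sum>(w, \<mu>)\<leftarrow>ws. w * (\<integral>x. f x \<partial>\<mu>)) \<ge> 0"
    using w f by (intro sum_list_nonneg) auto
  moreover have "f \<in> borel_measurable (measure_lincomb ws)" using f by measurable
  ultimately show ?thesis using * f by (subst integral_eq_nn_integral) auto
qed

text \<open>Spectral measures are built from the roots of the characteristic polynomial. Here these
  are real, so \<open>Re\<close> loses nothing, and the sum of 1/(e - z) over them is the trace of
  the resolvent.\<close>

lemma poisson_spectral_measure:
  fixes n :: nat and H :: "nat \<Rightarrow> nat \<Rightarrow> real"
  defines "A \<equiv> Matrix.mat n n (\<lambda>(i, j). complex_of_real (H i j))"
  assumes sym: "sym_below n H" and z: "Im z > 0"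
  shows "(\<integral>x. poisson z x \<partial>spectral_measure A) = Im (resolvent_trace n H z) / real n"
proof -
  have A: "A \<in> carrier_mat n n" by (simp add: A_def)
  obtain es where es: "mset es = proots (char_poly A)" by (metis ex_mset)
  have "lead_coeff (char_poly A) = 1" using degree_monic_char_poly[OF A] by simp
  then have cp: "char_poly A = (\<Prod>a\<leftarrow>es. [:- a, 1:])"
    using complex_poly_decompose_multiset[of "char_poly A"]
    by (simp flip: es prod_mset_prod_list)
  have real: "e \<in> \<real>" if "e \<in> set es" for e
  proof -
    have "e \<in># proots (char_poly A)" using that by (simp flip: es)
    then show ?thesis
      using sym by (intro hermitian_proots_real[OF A]) (auto simp: A_def sym_below_def)
  qed
  define R where "R = Matrix.mat n n (\<lambda>(i, j). resolvent n H z i j)"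
  have "(A - z \<cdot>\<^sub>m 1\<^sub>m n) * R = 1\<^sub>m n"
  proof (rule eq_matI)
    fix i j assume ij: "i < dim_row (1\<^sub>m n :: complex mat)" "j < dim_col (1\<^sub>m n :: complex mat)"
    have "((A - z \<cdot>\<^sub>m 1\<^sub>m n) * R) $$ (i, j) =
        (\<Sum>l<n. (of_real (H i l) - (if i = l then z else 0)) * resolvent n H z l j)"
      using ij by (auto simp: A_def R_def times_mat_def scalar_prod_def atLeast0LessThan intro!: sum.cong)
    then show "((A - z \<cdot>\<^sub>m 1\<^sub>m n) * R) $$ (i, j) = (1\<^sub>m n) $$ (i, j)"
      using resolvent_right_inverse[OF sym z, of i j] ij by simp
  qed (auto simp: A_def R_def)
  \<comment> \<open>\<open>z\<close> is not among the roots, since they are real and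
    \<open>Im z > 0\<close>.\<close>
  then have "(\<Sum>i<n. R $$ (i, i)) = (\<Sum>e\<leftarrow>es. 1 / (e - z))"
    using real z by (intro trace_inverse_shift[OF A cp]) (auto simp: R_def complex_is_Real_iff)
  then have tr: "resolvent_trace n H z = (\<Sum>e\<leftarrow>es. 1 / (e - z))"
    by (simp add: resolvent_trace_def R_def)
  have Re: "complex_of_real (Re e) = e" if "e \<in> set es" for e
    using real[OF that] by (simp add: complex_is_Real_iff complex_eq_iff)
  have "(\<integral>x. poisson z x \<partial>spectral_measure A) =
      (\<Sum>(w, \<mu>)\<leftarrow>map (\<lambda>x. (1 / real n, return borel x)) (eigenvalue_list A). w * (\<integral>x. poisson z x \<partial>\<mu>))"
    unfolding spectral_measure_def using A z
    by (subst integral_measure_lincomb)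
      (auto simp: borel_measurable_poisson poisson_nonneg
        intro!: integrable_poisson prob_space.finite_measure prob_space_return)
  also have "\<dots> = (\<Sum>x\<leftarrow>eigenvalue_list A. poisson z x / real n)"
    using z by (simp add: o_def integral_return borel_measurable_poisson)
  also have "\<dots> = sum_mset (image_mset (\<lambda>x. poisson z x / real n) (mset (eigenvalue_list A)))"
    by (metis mset_map sum_mset_sum_list)
  also have "\<dots> = (\<Sum>e\<leftarrow>es. poisson z (Re e) / real n)"
    by (simp add: mset_eigenvalue_list image_mset.compositionality o_def flip: es mset_map sum_mset_sum_list)
  also have "\<dots> = (\<Sum>e\<leftarrow>es. Im (1 / (e - z)) / real n)"
    using Re by (intro arg_cong[where f = sum_list] map_cong refl) (simp add: poisson_def)
  also have "\<dots> = Im (\<Sum>e\<leftarrow>es. 1 / (e - z)) / real n"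
    by (induction es) (auto simp: add_divide_distrib)
  finally show ?thesis by (simp add: tr)
qed

section \<open>Weak convergence from Poisson integrals\<close>

text \<open>The integration runs over the real part \<open>y\<close> of the spectral parameter at
  fixed height \<open>\<eta>\<close>, not over the point \<open>x\<close>.\<close>

lemma poisson_integral_arctan:
  fixes a b \<eta> x :: real
  assumes "a \<le> b" "\<eta> > 0"
  shows "(\<integral>\<^sup>+y. ennreal (poisson (Complex y \<eta>) x) * indicator {a..b} y \<partial>lborel) =
    ennreal (arctan ((b - x) / \<eta>) - arctan ((a - x) / \<eta>))"
proof (rule nn_integral_FTC_Icc)
  show "(\<lambda>y. poisson (Complex y \<eta>) x) \<in> borel_measurable borel"
    unfolding poisson_altdef by simp
  show "((\<lambda>y. arctan ((y - x) / \<eta>)) has_real_derivative poisson (Complex y \<eta>) x) (at y)" for y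
  proof -
    have "((\<lambda>y. arctan ((y - x) / \<eta>)) has_real_derivative inverse (1 + ((y - x) / \<eta>)\<^sup>2) * (1 / \<eta>))
        (at y)"
      using assms by (auto intro!: derivative_eq_intros)
    moreover have "inverse (1 + ((y - x) / \<eta>)\<^sup>2) * (1 / \<eta>) = poisson (Complex y \<eta>) x"
    proof -
      have "1 + ((y - x) / \<eta>)\<^sup>2 = ((x - y)\<^sup>2 + \<eta>\<^sup>2) / \<eta>\<^sup>2"
        using assms by (simp add: field_simps power2_commute)
      then show ?thesis using assms by (simp add: poisson_altdef power2_eq_square)
    qed
    ultimately show ?thesis by simp
  qed
  show "0 \<le> poisson (Complex y \<eta>) x" for y using assms by (simp add: poisson_nonneg)
qed (use assms in auto)

text \<open>By Fubini, integrating the Poisson integral along a horizontal segment tests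
  \<open>\<mu>\<close> against a difference of arctangents. As \<open>\<eta>\<close> tends to 0 this
  function tends to pi inside the interval and to 0 off it, so it is a smoothed multiple of the
  indicator.\<close>

lemma nn_integral_arctan_eq:
  fixes \<mu> :: "real measure"
  assumes "real_distribution \<mu>" "a \<le> b" "\<eta> > 0"
  shows "(\<integral>\<^sup>+x. ennreal (arctan ((b - x) / \<eta>) - arctan ((a - x) / \<eta>)) \<partial>\<mu>) =
    (\<integral>\<^sup>+y. ennreal (\<integral>x. poisson (Complex y \<eta>) x \<partial>\<mu>) * indicator {a..b} y \<partial>lborel)"
proof -
  interpret real_distribution \<mu> by fact
  interpret pair_sigma_finite \<mu> lborel ..
  have m: "(\<lambda>(x, y). ennreal (poisson (Complex y \<eta>) x) * indicator {a..b} y)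
      \<in> borel_measurable (\<mu> \<Otimes>\<^sub>M lborel)"
    unfolding poisson_altdef complex.sel by measurable
  have "(\<integral>\<^sup>+x. ennreal (arctan ((b - x) / \<eta>) - arctan ((a - x) / \<eta>)) \<partial>\<mu>) =
      (\<integral>\<^sup>+x. (\<integral>\<^sup>+y. ennreal (poisson (Complex y \<eta>) x) * indicator {a..b} y \<partial>lborel) \<partial>\<mu>)"
    using assms by (simp add: poisson_integral_arctan)
  also have "\<dots> = (\<integral>\<^sup>+y. (\<integral>\<^sup>+x. ennreal (poisson (Complex y \<eta>) x) * indicator {a..b} y \<partial>\<mu>) \<partial>lborel)"
    using Fubini'[OF m] by simp
  also have "\<dots> = (\<integral>\<^sup>+y. ennreal (\<integral>x. poisson (Complex y \<eta>) x \<partial>\<mu>) * indicator {a..b} y \<partial>lborel)"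
  proof (rule nn_integral_cong)
    fix y :: real
    have z: "Im (Complex y \<eta>) > 0" using assms by simp
    note [measurable] = borel_measurable_poisson[OF z]
    have "(\<integral>\<^sup>+x. ennreal (poisson (Complex y \<eta>) x) * indicator {a..b} y \<partial>\<mu>) =
        (\<integral>\<^sup>+x. ennreal (poisson (Complex y \<eta>) x) \<partial>\<mu>) * indicator {a..b} y"
      by (intro nn_integral_multc) measurable
    also have "(\<integral>\<^sup>+x. ennreal (poisson (Complex y \<eta>) x) \<partial>\<mu>) = ennreal (\<integral>x. poisson (Complex y \<eta>) x \<partial>\<mu>)"
      using z by (intro nn_integral_eq_integral integrable_poisson)
        (auto simp: poisson_nonneg finite_measure_axioms)
    finally show "(\<integral>\<^sup>+x. ennreal (poisson (Complex y \<eta>) x) * indicator {a..b} y \<partial>\<mu>) =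
        ennreal (\<integral>x. poisson (Complex y \<eta>) x \<partial>\<mu>) * indicator {a..b} y" .
  qed
  finally show ?thesis .
qed

lemma arctan_diff_nonneg:
  fixes a b x \<eta> :: real
  assumes "a \<le> b" "\<eta> > 0"
  shows "arctan ((b - x) / \<eta>) - arctan ((a - x) / \<eta>) \<ge> 0"
  using assms by (simp add: arctan_le_iff divide_right_mono)

text \<open>Pointwise convergence in z is integrated over the segment, where the constant
  \<open>1 / \<eta>\<close> dominates.\<close>

lemma integral_arctan_tendsto:
  fixes \<mu> :: "nat \<Rightarrow> real measure" and \<nu> :: "real measure"
  assumes \<mu>: "\<And>n. real_distribution (\<mu> n)" and \<nu>: "real_distribution \<nu>"
    and conv: "\<And>z. Im z > 0 \<Longrightarrow> (\<lambda>n. \<integral>x. poisson z x \<partial>\<mu> n) \<longlonglongrightarrow> (\<integral>x. poisson z x \<partial>\<nu>)"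
    and ab: "a \<le> b" "\<eta> > 0"
  shows "(\<lambda>n. \<integral>x. arctan ((b - x) / \<eta>) - arctan ((a - x) / \<eta>) \<partial>\<mu> n) \<longlonglongrightarrow>
    (\<integral>x. arctan ((b - x) / \<eta>) - arctan ((a - x) / \<eta>) \<partial>\<nu>)"
proof -
  let ?h = "\<lambda>x. arctan ((b - x) / \<eta>) - arctan ((a - x) / \<eta>)"
  have "(\<lambda>n. \<integral>\<^sup>+y. ennreal (\<integral>x. poisson (Complex y \<eta>) x \<partial>\<mu> n) * indicator {a..b} y \<partial>lborel) \<longlonglongrightarrow>
      (\<integral>\<^sup>+y. ennreal (\<integral>x. poisson (Complex y \<eta>) x \<partial>\<nu>) * indicator {a..b} y \<partial>lborel)"
  proof (rule nn_integral_dominated_convergence[where w = "\<lambda>y. ennreal (1 / \<eta>) * indicator {a..b} y"])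
    have meas: "(\<lambda>y. ennreal (\<integral>x. poisson (Complex y \<eta>) x \<partial>\<rho>) * indicator {a..b} y) \<in> borel_measurable lborel"
      if "real_distribution \<rho>" for \<rho>
    proof -
      interpret real_distribution \<rho> by fact
      have "(\<lambda>(y, x). poisson (Complex y \<eta>) x) \<in> borel_measurable (lborel \<Otimes>\<^sub>M \<rho>)"
        unfolding poisson_altdef complex.sel by measurable
      then have "(\<lambda>y. \<integral>x. poisson (Complex y \<eta>) x \<partial>\<rho>) \<in> borel_measurable lborel"
        by (rule borel_measurable_lebesgue_integral)
      then show ?thesis by measurable
    qed
    show "(\<lambda>y. ennreal (\<integral>x. poisson (Complex y \<eta>) x \<partial>\<mu> n) * indicator {a..b} y) \<in> borel_measurable lborel"
      "(\<lambda>y. ennreal (\<integral>x. poisson (Complex y \<eta>) x \<partial>\<nu>) * indicator {a..b} y) \<in> borel_measurable lborel" for n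
      using meas \<mu> \<nu> by auto
    show "(\<integral>\<^sup>+y. ennreal (1 / \<eta>) * indicator {a..b} y \<partial>lborel) < \<infinity>"
      using ab by (subst nn_integral_cmult) (auto simp: ennreal_mult_less_top)
    show "AE y in lborel. (\<lambda>n. ennreal (\<integral>x. poisson (Complex y \<eta>) x \<partial>\<mu> n) * indicator {a..b} y) \<longlonglongrightarrow>
        ennreal (\<integral>x. poisson (Complex y \<eta>) x \<partial>\<nu>) * indicator {a..b} y"
    proof (rule AE_I2)
      fix y
      have "(\<lambda>n. ennreal (\<integral>x. poisson (Complex y \<eta>) x \<partial>\<mu> n)) \<longlonglongrightarrow>
          ennreal (\<integral>x. poisson (Complex y \<eta>) x \<partial>\<nu>)"
        using ab by (intro tendsto_ennrealI conv) auto
      then show "(\<lambda>n. ennreal (\<integral>x. poisson (Complex y \<eta>) x \<partial>\<mu> n) * indicator {a..b} y) \<longlonglongrightarrow>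
          ennreal (\<integral>x. poisson (Complex y \<eta>) x \<partial>\<nu>) * indicator {a..b} y"
        by (cases "y \<in> {a..b}") auto
    qed
    show "AE y in lborel. ennreal (\<integral>x. poisson (Complex y \<eta>) x \<partial>\<mu> n) * indicator {a..b} y \<le>
        ennreal (1 / \<eta>) * indicator {a..b} y" for n
    proof (intro AE_I2 mult_right_mono ennreal_leI)
      fix y
      interpret real_distribution "\<mu> n" by (rule \<mu>)
      have z: "Im (Complex y \<eta>) > 0" using ab by simp
      show "(\<integral>x. poisson (Complex y \<eta>) x \<partial>\<mu> n) \<le> 1 / \<eta>"
        using z poisson_le[OF z]
        by (intro integral_le_const integrable_poisson finite_measure_axioms AE_I2) auto
    qed auto
  qed auto
  then have *: "(\<lambda>n. \<integral>\<^sup>+x. ennreal (?h x) \<partial>\<mu> n) \<longlonglongrightarrow> (\<integral>\<^sup>+x. ennreal (?h x) \<partial>\<nu>)"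
    using ab by (simp add: nn_integral_arctan_eq[OF \<mu>] nn_integral_arctan_eq[OF \<nu>])
  have eq: "(\<integral>\<^sup>+x. ennreal (?h x) \<partial>\<rho>) = ennreal (\<integral>x. ?h x \<partial>\<rho>)" if "real_distribution \<rho>" for \<rho>
  proof -
    interpret real_distribution \<rho> by fact
    have "integrable \<rho> ?h"
    proof (rule integrable_const_bound[where B = pi])
      show "AE x in \<rho>. norm (?h x) \<le> pi"
      proof (rule AE_I2)
        fix x show "norm (?h x) \<le> pi"
          using arctan_bounded[of "(b - x) / \<eta>"] arctan_bounded[of "(a - x) / \<eta>"] by (simp add: abs_le_iff)
      qed
    qed measurable
    then show ?thesis using arctan_diff_nonneg[OF ab] by (intro nn_integral_eq_integral) auto
  qed
  have "(\<integral>x. ?h x \<partial>\<rho>) \<ge> 0" for \<rho>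
    using arctan_diff_nonneg[OF ab] by (intro integral_nonneg_AE AE_I2)
  then show ?thesis using * unfolding eq[OF \<mu>] eq[OF \<nu>] by (subst (asm) tendsto_ennreal_iff) auto
qed

text \<open>The arctangent difference is at most pi times the indicator of the larger interval plus
  \<tau>, and at least pi - 2 \<tau> on \<open>{c..d}\<close>, where \<tau> is the tail of arctan at
  distance \<open>\<delta> / 2\<close>. Lower bounds of this kind suffice for weak convergence,
  because the total mass is 1.\<close>

lemma eventually_interval_ge:
  fixes \<mu> :: "nat \<Rightarrow> real measure" and \<nu> :: "real measure"
  assumes \<mu>: "\<And>n. real_distribution (\<mu> n)" and \<nu>: "real_distribution \<nu>"
    and conv: "\<And>z. Im z > 0 \<Longrightarrow> (\<lambda>n. \<integral>x. poisson z x \<partial>\<mu> n) \<longlonglongrightarrow> (\<integral>x. poisson z x \<partial>\<nu>)"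
    and cd: "c \<le> d" "\<delta> > 0" "\<epsilon> > 0"
  shows "\<forall>\<^sub>F n in sequentially. measure (\<mu> n) {c - \<delta>..d + \<delta>} \<ge> measure \<nu> {c..d} - \<epsilon>"
proof -
  \<comment> \<open>The endpoints lie midway, at distance \<open>\<delta> / 2\<close> both from
    \<open>{c..d}\<close> and from the outside of the larger interval.\<close>
  define a b where "a = c - \<delta> / 2" and "b = d + \<delta> / 2"
  define \<tau> where "\<tau> = (\<lambda>\<eta>. pi / 2 - arctan ((\<delta> / 2) / \<eta>))"
  have "((\<lambda>\<eta>. arctan ((\<delta> / 2) / \<eta>)) \<longlongrightarrow> pi / 2) (at_right 0)"
  proof (rule filterlim_compose[OF tendsto_arctan_at_top])
    show "filterlim (\<lambda>\<eta>. (\<delta> / 2) / \<eta>) at_top (at_right 0)"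
      unfolding divide_inverse[of "_ / _"] using cd
      by (intro filterlim_tendsto_pos_mult_at_top[OF tendsto_const] filterlim_inverse_at_top_right) auto
  qed
  then have "(\<tau> \<longlongrightarrow> 0) (at_right 0)"
    unfolding \<tau>_def using tendsto_diff[OF tendsto_const[of "pi / 2"]] by (metis cancel_comm_monoid_add_class.diff_cancel)
  then have "\<forall>\<^sub>F \<eta> in at_right 0. \<tau> \<eta> < \<epsilon> / 4"
    using cd by (intro order_tendstoD) auto
  \<comment> \<open>The final loss is 2 \<tau> from below, \<tau> from above and
    \<open>\<epsilon> / 4\<close> from the limit, hence less than \<epsilon> in total.\<close>
  then obtain \<eta> where \<eta>: "\<eta> > 0" "\<tau> \<eta> < \<epsilon> / 4"
    using eventually_happens[OF eventually_conj[OF _ eventually_at_right_less[of 0]]] by force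
  let ?h = "\<lambda>x. arctan ((b - x) / \<eta>) - arctan ((a - x) / \<eta>)"
  have \<tau>_nonneg: "\<tau> \<eta> \<ge> 0" unfolding \<tau>_def using arctan_bounded[of "(\<delta> / 2) / \<eta>"] by simp
  have hle: "?h x \<le> pi" for x
    using arctan_bounded[of "(b - x) / \<eta>"] arctan_bounded[of "(a - x) / \<eta>"] by simp
  have upper: "?h x \<le> pi * indicator {c - \<delta>..d + \<delta>} x + \<tau> \<eta>" for x
  proof (cases "x \<in> {c - \<delta>..d + \<delta>}")
    case True
    then show ?thesis using hle[of x] \<tau>_nonneg by simp
  next
    case False
    then consider "x < c - \<delta>" | "x > d + \<delta>" by force
    then have "?h x \<le> \<tau> \<eta>"
    proof cases
      case 1
      then have "arctan ((\<delta> / 2) / \<eta>) \<le> arctan ((a - x) / \<eta>)"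
        using \<eta> by (intro arctan_monotone' divide_right_mono) (auto simp: a_def)
      then show ?thesis using arctan_bounded[of "(b - x) / \<eta>"] by (simp add: \<tau>_def)
    next
      case 2
      then have "arctan ((b - x) / \<eta>) \<le> arctan (- (\<delta> / 2) / \<eta>)"
        using \<eta> by (intro arctan_monotone' divide_right_mono) (auto simp: b_def)
      then show ?thesis using arctan_bounded[of "(a - x) / \<eta>"] by (simp add: \<tau>_def arctan_minus)
    qed
    then show ?thesis using False by simp
  qed
  have lower: "?h x \<ge> (pi - 2 * \<tau> \<eta>) * indicator {c..d} x" for x
  proof (cases "x \<in> {c..d}")
    case True
    then have "arctan ((\<delta> / 2) / \<eta>) \<le> arctan ((b - x) / \<eta>)"
      using \<eta> by (intro arctan_monotone' divide_right_mono) (auto simp: b_def)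
    moreover have "arctan ((a - x) / \<eta>) \<le> arctan (- (\<delta> / 2) / \<eta>)"
      using \<eta> True by (intro arctan_monotone' divide_right_mono) (auto simp: a_def)
    ultimately show ?thesis using True by (simp add: \<tau>_def arctan_minus)
  next
    case False
    then show ?thesis using arctan_diff_nonneg[of a b \<eta> x] \<eta> cd by (simp add: a_def b_def)
  qed
  have int: "integrable \<rho> ?h" if "real_distribution \<rho>" for \<rho>
  proof -
    interpret real_distribution \<rho> by fact
    show ?thesis
    proof (rule integrable_const_bound[where B = pi])
      show "AE x in \<rho>. norm (?h x) \<le> pi"
      proof (rule AE_I2)
        fix x show "norm (?h x) \<le> pi"
          using arctan_bounded[of "(b - x) / \<eta>"] arctan_bounded[of "(a - x) / \<eta>"] by (simp add: abs_le_iff)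
      qed
    qed measurable
  qed
  have up: "(\<integral>x. ?h x \<partial>\<mu> n) \<le> pi * measure (\<mu> n) {c - \<delta>..d + \<delta>} + \<tau> \<eta>" for n
  proof -
    interpret real_distribution "\<mu> n" by (rule \<mu>)
    have "(\<integral>x. ?h x \<partial>\<mu> n) \<le> (\<integral>x. pi * indicator {c - \<delta>..d + \<delta>} x + \<tau> \<eta> \<partial>\<mu> n)"
      by (intro integral_mono int \<mu> upper Bochner_Integration.integrable_add integrable_mult_right
          integrable_real_indicator) (auto simp: emeasure_eq_measure)
    also have "\<dots> = pi * measure (\<mu> n) {c - \<delta>..d + \<delta>} + \<tau> \<eta>"
      using prob_space by (subst Bochner_Integration.integral_add)
        (auto intro!: integrable_mult_right integrable_real_indicator simp: emeasure_eq_measure)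
    finally show ?thesis .
  qed
  have low: "(pi - 2 * \<tau> \<eta>) * measure \<nu> {c..d} \<le> (\<integral>x. ?h x \<partial>\<nu>)"
  proof -
    interpret real_distribution \<nu> by fact
    have "(\<integral>x. (pi - 2 * \<tau> \<eta>) * indicator {c..d} x \<partial>\<nu>) \<le> (\<integral>x. ?h x \<partial>\<nu>)"
      by (intro integral_mono int \<nu> lower integrable_mult_right integrable_real_indicator)
        (auto simp: emeasure_eq_measure)
    then show ?thesis by simp
  qed
  have "(\<lambda>n. \<integral>x. ?h x \<partial>\<mu> n) \<longlonglongrightarrow> (\<integral>x. ?h x \<partial>\<nu>)"
    using \<eta> cd by (intro integral_arctan_tendsto \<mu> \<nu> conv) (auto simp: a_def b_def)
  then have "\<forall>\<^sub>F n in sequentially. (\<integral>x. ?h x \<partial>\<mu> n) > (\<integral>x. ?h x \<partial>\<nu>) - \<epsilon> / 4"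
    using cd by (intro order_tendstoD) auto
  then show ?thesis
  proof eventually_elim
    case (elim n)
    interpret real_distribution \<nu> by fact
    have m1: "measure \<nu> {c..d} \<le> 1" by simp
    have "(pi - 2 * \<tau> \<eta>) * measure \<nu> {c..d} \<ge> pi * measure \<nu> {c..d} - 2 * \<tau> \<eta>"
      using mult_left_mono[OF m1, of "2 * \<tau> \<eta>"] \<tau>_nonneg by (simp add: algebra_simps)
    then have "pi * measure \<nu> {c..d} - 2 * \<tau> \<eta> - \<epsilon> / 4 \<le> pi * measure (\<mu> n) {c - \<delta>..d + \<delta>} + \<tau> \<eta>"
      using up[of n] low elim by linarith
    then have "pi * measure \<nu> {c..d} - \<epsilon> \<le> pi * measure (\<mu> n) {c - \<delta>..d + \<delta>}"
      using \<eta> by linarith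
    \<comment> \<open>The loss was measured against pi times the masses; it only shrinks when pi is
      divided out.\<close>
    moreover have "\<epsilon> \<le> pi * \<epsilon>" using pi_ge_two cd by simp
    ultimately have "pi * (measure \<nu> {c..d} - \<epsilon>) \<le> pi * measure (\<mu> n) {c - \<delta>..d + \<delta>}"
      by (simp add: right_diff_distrib)
    then show ?case by simp
  qed
qed

lemma (in real_distribution) measure_Icc_ge_cdf_diff:
  assumes "c \<le> d"
  shows "measure M {c..d} \<ge> cdf M d - cdf M c"
proof -
  have "cdf M d - cdf M c \<le> measure M {c<..d}"
    using assms by (cases "c = d") (simp_all add: cdf_diff_eq)
  also have "\<dots> \<le> measure M {c..d}" by (intro finite_measure_mono) auto
  finally show ?thesis .
qed

text \<open>Masses to the left of x are bounded below directly, masses to its right likewise, and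
  the latter bound the cdf from above since each measure has total mass 1. The limit is a
  probability measure, so no mass escapes and a compactness argument is avoided.\<close>

theorem weak_conv_m_if_poisson_integrals_converge:
  fixes \<mu> :: "nat \<Rightarrow> real measure" and \<nu> :: "real measure"
  assumes \<mu>: "\<And>n. real_distribution (\<mu> n)" and \<nu>: "real_distribution \<nu>"
    and conv: "\<And>z. Im z > 0 \<Longrightarrow> (\<lambda>n. \<integral>x. poisson z x \<partial>\<mu> n) \<longlonglongrightarrow> (\<integral>x. poisson z x \<partial>\<nu>)"
  shows "weak_conv_m \<mu> \<nu>"
  unfolding weak_conv_m_def weak_conv_def
proof (intro allI impI)
  fix x assume cont: "isCont (cdf \<nu>) x"
  interpret \<nu>: real_distribution \<nu> by (rule \<nu>)
  show "(\<lambda>n. cdf (\<mu> n) x) \<longlonglongrightarrow> cdf \<nu> x"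
  proof (rule tendstoI)
    fix e :: real assume "e > 0"
    \<comment> \<open>Three errors occur, each at most \<epsilon>: the tail of the limit, its
      continuity at x, and the convergence of the interval masses.\<close>
    define \<epsilon> where "\<epsilon> = e / 4"
    have \<epsilon>: "\<epsilon> > 0" using \<open>e > 0\<close> by (simp add: \<epsilon>_def)
    obtain \<delta> where \<delta>: "\<delta> > 0" "\<And>y. \<bar>y - x\<bar> < \<delta> \<Longrightarrow> \<bar>cdf \<nu> y - cdf \<nu> x\<bar> < \<epsilon>"
      using cont[unfolded continuous_at_eps_delta] \<epsilon> by (auto simp: dist_real_def)
    have "\<forall>\<^sub>F c in at_bot. cdf \<nu> c < \<epsilon>"
      using \<nu>.cdf_lim_at_bot \<epsilon> by (intro order_tendstoD) auto
    then have "\<forall>\<^sub>F c in at_bot. cdf \<nu> c < \<epsilon> \<and> c \<le> x - \<delta> / 2"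
      by (intro eventually_conj eventually_le_at_bot)
    then obtain c where c: "cdf \<nu> c < \<epsilon>" "c \<le> x - \<delta> / 2"
      using eventually_happens by force
    have "\<forall>\<^sub>F d in at_top. cdf \<nu> d > 1 - \<epsilon>"
      using \<nu>.cdf_lim_at_top_prob \<epsilon> by (intro order_tendstoD) auto
    then have "\<forall>\<^sub>F d in at_top. cdf \<nu> d > 1 - \<epsilon> \<and> d \<ge> x + \<delta> / 2"
      by (intro eventually_conj eventually_ge_at_top)
    then obtain d where d: "cdf \<nu> d > 1 - \<epsilon>" "d \<ge> x + \<delta> / 2"
      using eventually_happens by force
    \<comment> \<open>Enlarging by \<open>\<delta> / 4\<close> keeps the first interval to the left
      of x and the second one to its right.\<close>
    have "\<forall>\<^sub>F n in sequentially. measure (\<mu> n) {c - \<delta> / 4..x - \<delta> / 2 + \<delta> / 4} \<ge> measure \<nu> {c..x - \<delta> / 2} - \<epsilon>"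
      using c \<delta> \<epsilon> by (intro eventually_interval_ge[OF \<mu> \<nu> conv]) auto
    moreover have "\<forall>\<^sub>F n in sequentially. measure (\<mu> n) {x + \<delta> / 2 - \<delta> / 4..d + \<delta> / 4} \<ge> measure \<nu> {x + \<delta> / 2..d} - \<epsilon>"
      using d \<delta> \<epsilon> by (intro eventually_interval_ge[OF \<mu> \<nu> conv]) auto
    ultimately show "\<forall>\<^sub>F n in sequentially. dist (cdf (\<mu> n) x) (cdf \<nu> x) < e"
    proof eventually_elim
      case (elim n)
      interpret real_distribution "\<mu> n" by (rule \<mu>)
      have "measure (\<mu> n) {c - \<delta> / 4..x - \<delta> / 2 + \<delta> / 4} \<le> cdf (\<mu> n) x"
        unfolding cdf_def using \<delta> by (intro finite_measure_mono) auto
      moreover have "measure (\<mu> n) {x + \<delta> / 2 - \<delta> / 4..d + \<delta> / 4} \<le> measure (\<mu> n) (UNIV - {..x})"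
        using \<delta> by (intro finite_measure_mono) auto
      moreover have "measure (\<mu> n) (UNIV - {..x}) = 1 - cdf (\<mu> n) x"
        using prob_compl[of "{..x}"] by (simp add: cdf_def)
      moreover have "measure \<nu> {c..x - \<delta> / 2} \<ge> cdf \<nu> (x - \<delta> / 2) - cdf \<nu> c"
        by (rule \<nu>.measure_Icc_ge_cdf_diff[OF c(2)])
      moreover have "measure \<nu> {x + \<delta> / 2..d} \<ge> cdf \<nu> d - cdf \<nu> (x + \<delta> / 2)"
        by (rule \<nu>.measure_Icc_ge_cdf_diff[OF d(2)])
      moreover have "\<bar>cdf \<nu> (x - \<delta> / 2) - cdf \<nu> x\<bar> < \<epsilon>" "\<bar>cdf \<nu> (x + \<delta> / 2) - cdf \<nu> x\<bar> < \<epsilon>"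
        using \<delta> by auto
      ultimately have "\<bar>cdf (\<mu> n) x - cdf \<nu> x\<bar> < 4 * \<epsilon>"
        using elim c(1) d(1) by (simp add: abs_less_iff)
      then show ?case by (simp add: dist_real_def \<epsilon>_def)
    qed
  qed
qed

section \<open>The semicircle law\<close>

definition semicircle_density :: "real \<Rightarrow> real \<Rightarrow> real" where
  "semicircle_density v x =
     1 / (2 * pi * v) * sqrt (4 * v - x\<^sup>2) * indicator {- 2 * sqrt v .. 2 * sqrt v} x"

lemma semicircle_eq_density: "semicircle 0 v = density lborel (\<lambda>x. ennreal (semicircle_density v x))"
  by (simp add: semicircle_def semicircle_density_def)

lemma sets_semicircle [simp]: "sets (semicircle 0 v) = sets borel"
  by (simp add: semicircle_eq_density)

text \<open>The sign has to be checked only on the support: outside, \<open>sqrt\<close> has a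
  negative argument and is negative itself, but the indicator vanishes.\<close>

lemma semicircle_density_nonneg: "v > 0 \<Longrightarrow> semicircle_density v x \<ge> 0"
proof (cases "x \<in> {- 2 * sqrt v .. 2 * sqrt v}")
  case True
  assume v: "v > 0"
  have "\<bar>x\<bar> \<le> 2 * sqrt v" using True by auto
  then have "x\<^sup>2 \<le> (2 * sqrt v)\<^sup>2" by (metis abs_ge_zero power_mono power2_abs)
  then show ?thesis using v by (simp add: semicircle_density_def power_mult_distrib)
qed (simp add: semicircle_density_def)

lemma borel_measurable_semicircle_density [measurable]:
  "semicircle_density v \<in> borel_measurable borel"
  unfolding semicircle_density_def[abs_def] by measurable

text \<open>The substitution x = 2 sqrt(v) sin \<theta> rationalises the root: cos is nonnegative on
  the range, so the root equals 2 sqrt(v) cos \<theta>, and the weight becomes independent of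
  v.\<close>

lemma semicircle_density_substitution:
  fixes f :: "real \<Rightarrow> real"
  assumes v: "v > 0" and f: "continuous_on UNIV f"
  shows "integrable lborel (\<lambda>x. semicircle_density v x * f x)"
    and "((\<lambda>\<theta>. 2 / pi * (cos \<theta>)\<^sup>2 * f (2 * sqrt v * sin \<theta>)) has_integral
      (\<integral>x. semicircle_density v x * f x \<partial>lborel)) {- (pi / 2)..pi / 2}"
proof -
  define \<phi> where "\<phi> = (\<lambda>x. 1 / (2 * pi * v) * sqrt (4 * v - x\<^sup>2) * f x)"
  let ?S = "{- 2 * sqrt v .. 2 * sqrt v}"
  have eq: "(\<lambda>x. semicircle_density v x * f x) = (\<lambda>x. indicator ?S x *\<^sub>R \<phi> x)"
    by (auto simp: semicircle_density_def \<phi>_def)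
  have cont: "continuous_on ?S \<phi>"
    unfolding \<phi>_def using v by (intro continuous_intros continuous_on_subset[OF f]) auto
  then have int: "set_integrable lborel ?S \<phi>" by (rule borel_integrable_atLeastAtMost')
  then show "integrable lborel (\<lambda>x. semicircle_density v x * f x)"
    unfolding eq set_integrable_def .
  have val: "(\<integral>x. semicircle_density v x * f x \<partial>lborel) = integral ?S \<phi>"
    using set_borel_integral_eq_integral(2)[OF int] unfolding eq set_lebesgue_integral_def .
  define g where "g = (\<lambda>\<theta>. 2 * sqrt v * sin \<theta>)"
  have "((\<lambda>\<theta>. (2 * sqrt v * cos \<theta>) *\<^sub>R \<phi> (g \<theta>)) has_integral integral {g (- (pi / 2))..g (pi / 2)} \<phi>)
      {- (pi / 2)..pi / 2}"
  proof (rule has_integral_substitution[where c = "- 2 * sqrt v" and d = "2 * sqrt v"])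
    show "g ` {- (pi / 2)..pi / 2} \<subseteq> ?S"
    proof
      fix y assume "y \<in> g ` {- (pi / 2)..pi / 2}"
      then obtain \<theta> where "y = 2 * sqrt v * sin \<theta>" by (auto simp: g_def)
      moreover have "2 * sqrt v * sin \<theta> \<le> 2 * sqrt v * 1" "2 * sqrt v * (- 1) \<le> 2 * sqrt v * sin \<theta>"
        using v by (intro mult_left_mono; simp)+
      ultimately show "y \<in> ?S" by simp
    qed
    show "(g has_real_derivative 2 * sqrt v * cos \<theta>) (at \<theta> within {- (pi / 2)..pi / 2})" for \<theta>
      unfolding g_def by (auto intro!: derivative_eq_intros)
  qed (use v cont in \<open>auto simp: g_def\<close>)
  moreover have "(2 * sqrt v * cos \<theta>) *\<^sub>R \<phi> (g \<theta>) = 2 / pi * (cos \<theta>)\<^sup>2 * f (2 * sqrt v * sin \<theta>)"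
    if "\<theta> \<in> {- (pi / 2)..pi / 2}" for \<theta>
  proof -
    have "cos \<theta> \<ge> 0" using that by (intro cos_ge_zero) auto
    moreover have "4 * v - (g \<theta>)\<^sup>2 = (2 * sqrt v * cos \<theta>)\<^sup>2"
      using v by (simp add: g_def power_mult_distrib sin_squared_eq algebra_simps)
    ultimately have "sqrt (4 * v - (g \<theta>)\<^sup>2) = 2 * sqrt v * cos \<theta>"
      using v by (simp add: real_sqrt_mult)
    then have "\<phi> (g \<theta>) = 1 / (2 * pi * v) * (2 * sqrt v * cos \<theta>) * f (g \<theta>)"
      by (simp only: \<phi>_def)
    then have "(2 * sqrt v * cos \<theta>) *\<^sub>R \<phi> (g \<theta>) =
        (sqrt v * sqrt v) / v * (2 / pi * (cos \<theta>)\<^sup>2 * f (g \<theta>))"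
      by (simp add: power2_eq_square field_simps)
    then show ?thesis using v by (simp add: g_def)
  qed
  ultimately have "((\<lambda>\<theta>. 2 / pi * (cos \<theta>)\<^sup>2 * f (2 * sqrt v * sin \<theta>)) has_integral
      integral {g (- (pi / 2))..g (pi / 2)} \<phi>) {- (pi / 2)..pi / 2}"
    by (rule has_integral_eq[rotated])
  then show "((\<lambda>\<theta>. 2 / pi * (cos \<theta>)\<^sup>2 * f (2 * sqrt v * sin \<theta>)) has_integral
      (\<integral>x. semicircle_density v x * f x \<partial>lborel)) {- (pi / 2)..pi / 2}"
    unfolding val by (simp add: g_def)
qed

lemma prob_space_semicircle:
  assumes v: "v > 0"
  shows "prob_space (semicircle 0 v)"
proof
  have c: "continuous_on UNIV (\<lambda>_ :: real. 1 :: real)" by simp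
  have "((\<lambda>\<theta>. 2 / pi * (cos \<theta>)\<^sup>2) has_integral
      ((pi / 2 + sin (pi / 2) * cos (pi / 2)) / pi -
       (- (pi / 2) + sin (- (pi / 2)) * cos (- (pi / 2))) / pi)) {- (pi / 2)..pi / 2}"
  proof (rule fundamental_theorem_of_calculus)
    fix \<theta> :: real
    have "((\<lambda>\<theta>. (\<theta> + sin \<theta> * cos \<theta>) / pi) has_real_derivative
        (1 + (cos \<theta> * cos \<theta> - sin \<theta> * sin \<theta>)) / pi) (at \<theta> within {- (pi / 2)..pi / 2})"
      by (auto intro!: derivative_eq_intros)
    also have "(1 + (cos \<theta> * cos \<theta> - sin \<theta> * sin \<theta>)) / pi = 2 / pi * (cos \<theta>)\<^sup>2"
      using sin_squared_eq[of \<theta>] by (simp add: power2_eq_square)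
    finally show "((\<lambda>\<theta>. (\<theta> + sin \<theta> * cos \<theta>) / pi) has_vector_derivative 2 / pi * (cos \<theta>)\<^sup>2)
        (at \<theta> within {- (pi / 2)..pi / 2})"
      by (simp add: has_real_derivative_iff_has_vector_derivative)
  qed simp
  then have "((\<lambda>\<theta>. 2 / pi * (cos \<theta>)\<^sup>2) has_integral 1) {- (pi / 2)..pi / 2}" by simp
  then have "(\<integral>x. semicircle_density v x \<partial>lborel) = 1"
    using semicircle_density_substitution(2)[OF v c] by (simp add: has_integral_unique)
  moreover have "integrable lborel (semicircle_density v)"
    using semicircle_density_substitution(1)[OF v c] by simp
  ultimately have "(\<integral>\<^sup>+x. ennreal (semicircle_density v x) \<partial>lborel) = 1"
    using semicircle_density_nonneg[OF v] by (subst nn_integral_eq_integral) auto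
  then show "emeasure (semicircle 0 v) (space (semicircle 0 v)) = 1"
    by (simp add: semicircle_eq_density emeasure_density)
qed

text \<open>Dividing the equation by m gives z = -v m - 1/m, whose imaginary part Im m (1/|m|^2 - v)
  must be positive. The bound places w = sqrt(v) m in the unit disc.\<close>

lemma root_norm_less:
  assumes v: "v > 0" and z: "Im z > 0" and m: "of_real v * m\<^sup>2 + z * m + 1 = 0" "Im m > 0"
  shows "v * (cmod m)\<^sup>2 < 1"
proof -
  have m0: "m \<noteq> 0" using m(2) by auto
  have "z = - of_real v * m - 1 / m"
  proof -
    have "z * m = - of_real v * m\<^sup>2 - 1" using m(1) by (simp add: eq_neg_iff_add_eq_0 algebra_simps)
    then have "z = (- of_real v * m\<^sup>2 - 1) / m" using m0 by (metis nonzero_mult_div_cancel_right)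
    then show ?thesis using m0 by (simp add: diff_divide_distrib power2_eq_square)
  qed
  then have "Im z = - v * Im m + Im m / (cmod m)\<^sup>2"
    by (simp add: Im_divide cmod_power2)
  then have "Im m * (1 / (cmod m)\<^sup>2 - v) > 0" using z by (simp add: algebra_simps)
  then have "v < 1 / (cmod m)\<^sup>2" using m(2) by (simp add: zero_less_mult_iff)
  then show ?thesis using m0 by (simp add: field_simps)
qed

text \<open>Antiderivative of \<open>cos\<^sup>2 \<theta> / (1 + w\<^sup>2 + 2 w sin \<theta>)\<close>: divide with remainder in \<open>sin \<theta>\<close> and use
  \<open>(1 - w\<^sup>2) / (1 + w\<^sup>2 + 2 w sin \<theta>) = 1 / (1 - \<i> w e) + 1 / (1 + \<i> w / e) - 1\<close> with
  \<open>e = exp (\<i> \<theta>)\<close>.\<close>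

lemma semicircle_cauchy_integral:
  assumes w: "cmod w < 1" "w \<noteq> 0"
  shows "((\<lambda>\<theta>. of_real ((cos \<theta>)\<^sup>2) / (1 + w\<^sup>2 + 2 * w * of_real (sin \<theta>))) has_integral of_real (pi / 2))
    {- (pi / 2)..pi / 2}"
proof -
  define L where "L = (\<lambda>\<zeta>. \<zeta> + \<i> * (Ln (1 - \<i> * w * exp (\<i> * \<zeta>)) - Ln (1 + \<i> * w * exp (- (\<i> * \<zeta>)))))"
  \<comment> \<open>With s = sin \<theta> and P the denominator, 1 - s^2 divided by P has quotient
    k2 - k1 s and remainder -k3 (1 - w^2).\<close>
  define k1 k2 k3 where "k1 = 1 / (2 * w)" and "k2 = (1 + w\<^sup>2) / (4 * w\<^sup>2)"
    and "k3 = (1 - w\<^sup>2) / (4 * w\<^sup>2)"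
  define \<Phi> where "\<Phi> = (\<lambda>\<zeta>. k1 * cos \<zeta> + k2 * \<zeta> - k3 * L \<zeta>)"
  let ?f = "\<lambda>\<theta>. of_real ((cos \<theta>)\<^sup>2) / (1 + w\<^sup>2 + 2 * w * of_real (sin \<theta>))"
  have deriv: "((\<lambda>\<theta>. \<Phi> (of_real \<theta>)) has_vector_derivative ?f \<theta>) (at \<theta> within {- (pi / 2)..pi / 2})"
    for \<theta> :: real
  proof -
    define E E' where "E = exp (\<i> * of_real \<theta>)" and "E' = exp (- (\<i> * of_real \<theta>))"
    define s c where "s = complex_of_real (sin \<theta>)" and "c = complex_of_real (cos \<theta>)"
    have E: "E = c + \<i> * s" "E' = c - \<i> * s"
      by (simp_all add: E_def E'_def s_def c_def exp_Euler exp_minus_Euler flip: cos_of_real sin_of_real)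
    have cs: "c\<^sup>2 + s\<^sup>2 = 1" unfolding c_def s_def
      by (metis of_real_1 of_real_add of_real_power sin_cos_squared_add2)
    have nE: "cmod E = 1" "cmod E' = 1" by (simp_all add: E_def E'_def norm_exp_eq_Re)
    define P where "P = 1 + w\<^sup>2 + 2 * w * s"
    define p p' where "p = 1 - \<i> * w * E" and "p' = 1 + \<i> * w * E'"
    \<comment> \<open>|w| < 1 keeps the arguments of both logarithms in the right half plane, where
      the principal branch is differentiable.\<close>
    have "Re (\<i> * w * E) \<le> cmod (\<i> * w * E)" by (rule complex_Re_le_cmod)
    then have Rep: "Re p > 0" using w nE by (simp add: p_def norm_mult)
    have "- Re (\<i> * w * E') \<le> cmod (\<i> * w * E')" by (metis abs_Re_le_cmod abs_le_D2)
    then have Rep': "Re p' > 0" using w nE by (simp add: p'_def norm_mult)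
    have nz: "p \<noteq> 0" "p' \<noteq> 0" using Rep Rep' by auto
    have nonpos: "p \<notin> \<real>\<^sub>\<le>\<^sub>0" "p' \<notin> \<real>\<^sub>\<le>\<^sub>0" using Rep Rep' by (auto simp: complex_nonpos_Reals_iff)
    have "p * p' = 1 + w\<^sup>2 * (c\<^sup>2 + s\<^sup>2) + 2 * w * s"
      by (simp add: p_def p'_def E algebra_simps power2_eq_square)
    then have P: "P = p * p'" by (simp add: P_def cs)
    have P0: "P \<noteq> 0" using nz by (simp add: P)
    have sum: "p + p' = 2 + 2 * w * s"
      by (simp add: p_def p'_def E algebra_simps)
    have L': "(L has_field_derivative (1 + \<i> * (w * E / p - w * E' / p'))) (at (of_real \<theta>))"
      using nonpos unfolding L_def p_def p'_def E_def E'_def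
      by (auto intro!: derivative_eq_intros simp: field_simps)
    have "\<i> * (w * E / p) = 1 / p - 1" using nz by (simp add: field_simps p_def)
    moreover have "\<i> * (w * E' / p') = 1 - 1 / p'" using nz by (simp add: field_simps p'_def)
    ultimately have "1 + \<i> * (w * E / p - w * E' / p') = 1 / p + 1 / p' - 1"
      by (simp add: right_diff_distrib)
    also have "\<dots> = (p + p' - P) / P" using nz by (simp add: P field_simps)
    also have "p + p' - P = 1 - w\<^sup>2" unfolding sum P_def by simp
    finally have L'': "(L has_field_derivative (1 - w\<^sup>2) / P) (at (of_real \<theta>))" using L' by simp
    have "(\<Phi> has_field_derivative
        (k1 * (- s) + k2 - k3 * ((1 - w\<^sup>2) / P))) (at (of_real \<theta>))"
      unfolding \<Phi>_def by (auto intro!: derivative_eq_intros L'' simp: s_def sin_of_real)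
    also have "k1 * (- s) + k2 - k3 * ((1 - w\<^sup>2) / P) =
        ((1 + w\<^sup>2 - 2 * w * s) * P - (1 - w\<^sup>2)\<^sup>2) / (4 * w\<^sup>2 * P)"
      using w P0 by (simp add: k1_def k2_def k3_def field_simps power2_eq_square)
    also have "(1 + w\<^sup>2 - 2 * w * s) * P - (1 - w\<^sup>2)\<^sup>2 = 4 * w\<^sup>2 * (1 - s\<^sup>2)"
      by (simp add: P_def algebra_simps power2_eq_square)
    also have "1 - s\<^sup>2 = c\<^sup>2" using cs by (simp add: algebra_simps)
    also have "4 * w\<^sup>2 * c\<^sup>2 / (4 * w\<^sup>2 * P) = c\<^sup>2 / P" using w by simp
    also have "c\<^sup>2 / P = ?f \<theta>" by (simp add: c_def s_def P_def)
    finally show ?thesis by (rule has_vector_derivative_real_field)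
  qed
  have "(?f has_integral \<Phi> (of_real (pi / 2)) - \<Phi> (of_real (- (pi / 2)))) {- (pi / 2)..pi / 2}"
    by (rule fundamental_theorem_of_calculus[OF _ deriv]) simp
  moreover have "\<Phi> (of_real (pi / 2)) - \<Phi> (of_real (- (pi / 2))) = of_real (pi / 2)"
  proof -
    have e: "exp (\<i> * of_real (pi / 2)) = \<i>" "exp (- (\<i> * of_real (pi / 2))) = - \<i>"
      "exp (\<i> * of_real (- (pi / 2))) = - \<i>" "exp (- (\<i> * of_real (- (pi / 2)))) = \<i>"
      using cis_conv_exp[of "pi / 2"] cis_conv_exp[of "- (pi / 2)"] by simp_all
    \<comment> \<open>At each endpoint the two logarithms have the same argument, 1 + w at pi/2 and
      1 - w at -pi/2, and cancel.\<close>
    have L: "L (of_real (pi / 2)) = of_real (pi / 2)" "L (of_real (- (pi / 2))) = - of_real (pi / 2)"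
      unfolding L_def e by (simp_all add: mult.commute)
    have c: "cos (complex_of_real (pi / 2)) = 0" "cos (complex_of_real (- (pi / 2))) = 0"
      by (simp_all only: cos_of_real cos_minus cos_pi_half of_real_0)
    have "\<Phi> (of_real (pi / 2)) - \<Phi> (of_real (- (pi / 2))) =
        (k2 - k3) * (2 * of_real (pi / 2))"
      unfolding \<Phi>_def L c by (simp add: algebra_simps)
    also have "k2 - k3 = 1 / 2"
      using w by (simp add: k2_def k3_def field_simps)
    finally show ?thesis by simp
  qed
  ultimately show ?thesis by (simp only:)
qed

text \<open>With w = sqrt(v) m the quadratic equation reads z m = -(1 + w^2), so the denominator of
  the trigonometric integral is m (x - z) for x = 2 sqrt(v) sin \<theta>.\<close>

lemma poisson_semicircle:
  assumes v: "v > 0" and z: "Im z > 0" and m: "of_real v * m\<^sup>2 + z * m + 1 = 0" "Im m > 0"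
  shows "(\<integral>x. poisson z x \<partial>semicircle 0 v) = Im m"
proof -
  define w where "w = of_real (sqrt v) * m"
  have m0: "m \<noteq> 0" using m(2) by auto
  have w0: "w \<noteq> 0" using m0 v by (simp add: w_def)
  have "(cmod w)\<^sup>2 < 1\<^sup>2"
    using root_norm_less[OF v z m] v by (simp add: w_def norm_mult power_mult_distrib)
  then have w1: "cmod w < 1" by (rule power_less_imp_less_base) simp
  have key: "2 / of_real pi * m * (of_real ((cos \<theta>)\<^sup>2) / (1 + w\<^sup>2 + 2 * w * of_real (sin \<theta>))) =
      of_real (2 / pi * (cos \<theta>)\<^sup>2) / (of_real (2 * sqrt v * sin \<theta>) - z)" for \<theta>
  proof -
    have sv: "complex_of_real (sqrt v) * of_real (sqrt v) = of_real v"
      using v by (simp flip: of_real_mult)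
    have "m * (of_real (2 * sqrt v * sin \<theta>) - z) = 2 * w * of_real (sin \<theta>) - z * m"
      by (simp add: w_def algebra_simps)
    also have "z * m = - (1 + w\<^sup>2)"
      using m(1) sv by (simp add: w_def power2_eq_square algebra_simps eq_neg_iff_add_eq_0)
    finally have "1 + w\<^sup>2 + 2 * w * of_real (sin \<theta>) = m * (of_real (2 * sqrt v * sin \<theta>) - z)"
      by simp
    then show ?thesis using m0 by simp
  qed
  have "((\<lambda>\<theta>. 2 / of_real pi * m * (of_real ((cos \<theta>)\<^sup>2) / (1 + w\<^sup>2 + 2 * w * of_real (sin \<theta>))))
      has_integral 2 / of_real pi * m * of_real (pi / 2)) {- (pi / 2)..pi / 2}"
    by (intro has_integral_mult_right semicircle_cauchy_integral w1 w0)
  then have "((\<lambda>\<theta>. of_real (2 / pi * (cos \<theta>)\<^sup>2) / (of_real (2 * sqrt v * sin \<theta>) - z)) has_integral m)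
      {- (pi / 2)..pi / 2}"
    unfolding key by simp
  from has_integral_linear[OF this bounded_linear_Im]
  have "((\<lambda>\<theta>. Im (of_real (2 / pi * (cos \<theta>)\<^sup>2) / (of_real (2 * sqrt v * sin \<theta>) - z))) has_integral Im m)
      {- (pi / 2)..pi / 2}" by (simp add: o_def)
  moreover have "Im (of_real a / b) = a * Im (1 / b)" for a b
    by (simp add: Im_divide)
  ultimately have "((\<lambda>\<theta>. 2 / pi * (cos \<theta>)\<^sup>2 * poisson z (2 * sqrt v * sin \<theta>)) has_integral Im m)
      {- (pi / 2)..pi / 2}"
    by (simp only: poisson_def)
  then have "(\<integral>x. semicircle_density v x * poisson z x \<partial>lborel) = Im m"
    using semicircle_density_substitution(2)[OF v continuous_on_poisson[OF z]]
    by (rule has_integral_unique[rotated])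
  moreover have "(\<integral>x. poisson z x \<partial>semicircle 0 v) = (\<integral>x. semicircle_density v x *\<^sub>R poisson z x \<partial>lborel)"
    unfolding semicircle_eq_density
    using semicircle_density_nonneg[OF v] borel_measurable_poisson[OF z]
    by (intro integral_density) auto
  ultimately show ?thesis by simp
qed

text \<open>The two roots have product 1/v, so if one lies in the lower half plane, the other lies
  in the upper. A real root would satisfy Im z * root = 0 and hence be 0, which is no root.\<close>

lemma semicircle_equation_root_exists:
  assumes v: "v > 0" and z: "Im z > 0"
  obtains m where "of_real v * m\<^sup>2 + z * m + 1 = 0" "Im m > 0"
proof -
  define d where "d = csqrt (z\<^sup>2 - 4 * of_real v)"
  define m1 where "m1 = (- z + d) / (2 * of_real v)"
  have d: "d\<^sup>2 = z\<^sup>2 - 4 * of_real v" by (simp add: d_def)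
  have v0: "complex_of_real v \<noteq> 0" using v by simp
  have "of_real v * m1\<^sup>2 + z * m1 + 1 = (d\<^sup>2 - z\<^sup>2 + 4 * of_real v) / (4 * of_real v)"
    using v0 by (simp add: m1_def field_simps power2_eq_square)
  then have m1: "of_real v * m1\<^sup>2 + z * m1 + 1 = 0" by (simp add: d)
  then have m10: "m1 \<noteq> 0" by auto
  show thesis
  proof (cases "Im m1 > 0")
    case True
    then show ?thesis using that m1 by blast
  next
    case False
    have "Im m1 \<noteq> 0"
    proof
      assume "Im m1 = 0"
      then obtain r where r: "m1 = of_real r" by (metis complex_is_Real_iff Reals_cases)
      have "Im z * r = Im (of_real v * m1\<^sup>2 + z * m1 + 1)" by (simp add: r power2_eq_square)
      also have "\<dots> = 0" by (simp only: m1 zero_complex.sel)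
      finally show False using m10 z r by simp
    qed
    then have neg: "Im m1 < 0" using False by simp
    define m2 where "m2 = 1 / (of_real v * m1)"
    have "of_real v * m2\<^sup>2 + z * m2 + 1 = (of_real v * m1\<^sup>2 + z * m1 + 1) / (of_real v * m1\<^sup>2)"
      using v0 m10 by (simp add: m2_def field_simps power2_eq_square)
    moreover have "Im m2 > 0"
    proof -
      have "m2 = of_real (1 / v) * (1 / m1)" by (simp add: m2_def)
      then have "Im m2 = 1 / v * Im (1 / m1)"
        by (simp only: times_complex.sel Re_complex_of_real Im_complex_of_real mult_zero_left add_0_right)
      moreover have "Im (1 / m1) = - Im m1 / (cmod m1)\<^sup>2" by (simp add: Im_divide cmod_power2)
      ultimately show ?thesis using neg v m10 by (simp add: divide_less_0_iff zero_less_mult_iff)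
    qed
    ultimately show ?thesis using that[of m2] m1 by simp
  qed
qed

section \<open>Bounded differences inequality\<close>

lemma (in prob_space) abs_integral_le_const:
  fixes f :: "'a \<Rightarrow> real"
  assumes "f \<in> borel_measurable M" "\<And>x. x \<in> space M \<Longrightarrow> \<bar>f x\<bar> \<le> c"
  shows "\<bar>\<integral>x. f x \<partial>M\<bar> \<le> c"
proof -
  have "integrable M f" using assms by (intro integrable_const_bound[where B = c]) auto
  then have "(\<integral>x. f x \<partial>M) \<le> c" "(\<integral>x. f x \<partial>M) \<ge> - c"
    using assms(2) by (auto intro!: integral_le_const integral_ge_const AE_I2 simp: abs_le_iff)
      (metis minus_le_iff)
  then show ?thesis by (simp add: abs_le_iff)
qed

text \<open>The variation is taken over blocks of coordinates. Block i will be the i-th row of the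
  upper triangle, so that there are n blocks and not of the order of n^2.\<close>

definition bounded_differences ::
    "('i \<Rightarrow> 'a) measure \<Rightarrow> nat \<Rightarrow> (nat \<Rightarrow> 'i set) \<Rightarrow> (nat \<Rightarrow> real) \<Rightarrow> (('i \<Rightarrow> 'a) \<Rightarrow> real) \<Rightarrow> bool" where
  "bounded_differences P N B c f \<longleftrightarrow> (\<forall>i<N. \<forall>x\<in>space P. \<forall>y\<in>space P.
     (\<forall>p. p \<notin> B i \<longrightarrow> x p = y p) \<longrightarrow> \<bar>f x - f y\<bar> \<le> c i)"

lemma bounded_differencesI:
  assumes "\<And>i x y. i < N \<Longrightarrow> x \<in> space P \<Longrightarrow> y \<in> space P \<Longrightarrow>
    (\<And>p. p \<notin> B i \<Longrightarrow> x p = y p) \<Longrightarrow> \<bar>f x - f y\<bar> \<le> c i"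
  shows "bounded_differences P N B c f"
  using assms unfolding bounded_differences_def by blast

lemma bounded_differencesD:
  assumes "bounded_differences P N B c f" "i < N" "x \<in> space P" "y \<in> space P"
    "\<And>p. p \<notin> B i \<Longrightarrow> x p = y p"
  shows "\<bar>f x - f y\<bar> \<le> c i"
  using assms unfolding bounded_differences_def by blast

text \<open>Integrating out the last block leaves a function \<open>g\<close> of the others with the
  same difference bounds, to which the induction hypothesis applies. For fixed \<open>x\<close> the
  deviation of \<open>F x\<close> from \<open>g x\<close> is centred and bounded by
  \<open>c N\<close>, so Hoeffding's lemma handles the last block. The bound \<open>C\<close>
  secures integrability.\<close>

lemma mcdiarmid_mgf:
  fixes D :: "'i \<Rightarrow> 'a measure" and f :: "('i \<Rightarrow> 'a) \<Rightarrow> real"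
  assumes D: "\<And>i. prob_space (D i)"
    and fin: "\<And>i. i < N \<Longrightarrow> finite (B i)"
    and disj: "disjoint_family_on B {..<N}"
    and meas: "f \<in> borel_measurable (PiM (\<Union>i<N. B i) D)"
    and bdd: "\<And>x. x \<in> space (PiM (\<Union>i<N. B i) D) \<Longrightarrow> \<bar>f x\<bar> \<le> C"
    and diff: "bounded_differences (PiM (\<Union>i<N. B i) D) N B c f"
    and l: "l > 0"
  shows "(\<integral>x. exp (l * (f x - (\<integral>y. f y \<partial>PiM (\<Union>i<N. B i) D))) \<partial>PiM (\<Union>i<N. B i) D)
    \<le> exp (l\<^sup>2 * (\<Sum>i<N. (c i)\<^sup>2) / 2)"
  using fin disj meas bdd diff
proof (induction N arbitrary: f)
  case 0
  interpret product_sigma_finite D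
    by (intro product_sigma_finite.intro prob_space_imp_sigma_finite D)
  show ?case by (simp add: PiM_empty lebesgue_integral_count_space_finite)
next
  case (Suc N)
  define I where "I = (\<Union>i<N. B i)"
  define J where "J = B N"
  have IJ: "(\<Union>i<Suc N. B i) = I \<union> J" by (auto simp: I_def J_def lessThan_Suc)
  have "B i \<inter> B N = {}" if "i < N" for i
    using disjoint_family_onD[OF Suc.prems(2), of i N] that by simp
  then have disjIJ: "I \<inter> J = {}" unfolding I_def J_def by blast
  have finIJ: "finite I" "finite J" using Suc.prems(1) by (auto simp: I_def J_def)
  let ?P = "PiM (I \<union> J) D" and ?PI = "PiM I D" and ?PJ = "PiM J D"
  interpret product_sigma_finite D
    by (intro product_sigma_finite.intro prob_space_imp_sigma_finite D)
  interpret P: prob_space ?P by (intro prob_space_PiM D)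
  interpret PI: prob_space ?PI by (intro prob_space_PiM D)
  interpret PJ: prob_space ?PJ by (intro prob_space_PiM D)
  note meas = Suc.prems(3)[unfolded IJ] and bdd = Suc.prems(4)[unfolded IJ]
    and diff = bounded_differencesD[OF Suc.prems(5)[unfolded IJ]]
  define F where "F = (\<lambda>x y. f (merge I J (x, y)))"
  have F_meas: "case_prod F \<in> borel_measurable (?PI \<Otimes>\<^sub>M ?PJ)"
    using measurable_compose[OF measurable_merge meas] by (simp add: F_def split_def)
  have mergeP: "merge I J (x, y) \<in> space ?P" if "x \<in> space ?PI" "y \<in> space ?PJ" for x y
    using measurable_space[OF measurable_merge, of "(x, y)" I D J] that
    by (simp add: space_pair_measure)
  have Fx_meas: "F x \<in> borel_measurable ?PJ" if "x \<in> space ?PI" for x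
    using measurable_Pair2[OF F_meas that] by simp
  have F_bdd: "\<bar>F x y\<bar> \<le> C" if "x \<in> space ?PI" "y \<in> space ?PJ" for x y
    using bdd[OF mergeP[OF that]] by (simp add: F_def)
  have Fx_int: "integrable ?PJ (F x)" if "x \<in> space ?PI" for x
    using F_bdd[OF that] Fx_meas[OF that] by (intro PJ.integrable_const_bound[where B = C]) auto
  define g where "g = (\<lambda>x. \<integral>y. F x y \<partial>?PJ)"
  have g_meas: "g \<in> borel_measurable ?PI"
    unfolding g_def using F_meas by (rule PJ.borel_measurable_lebesgue_integral)
  have g_bdd: "\<bar>g x\<bar> \<le> C" if "x \<in> space ?PI" for x
    unfolding g_def using F_bdd[OF that] Fx_meas[OF that] by (intro PJ.abs_integral_le_const)
  have f_int: "integrable ?P f"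
    using bdd meas by (intro P.integrable_const_bound[where B = C]) auto
  have Ef: "(\<integral>x. f x \<partial>?P) = (\<integral>x. g x \<partial>?PI)"
    unfolding g_def F_def by (rule product_integral_fold[OF disjIJ finIJ f_int])
  have g_diff: "\<bar>g x - g x'\<bar> \<le> c i"
    if "i < N" and x: "x \<in> space ?PI" "x' \<in> space ?PI"
      and agree: "\<And>p. p \<notin> B i \<Longrightarrow> x p = x' p" for i x x'
  proof -
    have "\<bar>F x y - F x' y\<bar> \<le> c i" if y: "y \<in> space ?PJ" for y
      unfolding F_def
    proof (rule diff)
      fix p assume "p \<notin> B i"
      then show "merge I J (x, y) p = merge I J (x', y) p" using agree by (simp add: merge_def)
    qed (use \<open>i < N\<close> mergeP x y in auto)
    moreover have "g x - g x' = (\<integral>y. F x y - F x' y \<partial>?PJ)"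
      unfolding g_def using Fx_int x by simp
    ultimately show ?thesis
      using Fx_meas x by (simp add: PJ.abs_integral_le_const)
  qed
  have IH: "(\<integral>x. exp (l * (g x - (\<integral>y. g y \<partial>?PI))) \<partial>?PI) \<le> exp (l\<^sup>2 * (\<Sum>i<N. (c i)\<^sup>2) / 2)"
    unfolding I_def
  proof (rule Suc.IH)
    show "disjoint_family_on B {..<N}"
      using Suc.prems(2) by (rule disjoint_family_on_mono[rotated]) auto
    show "finite (B i)" if "i < N" for i using Suc.prems(1) that by simp
    show "bounded_differences (PiM (\<Union> (B ` {..<N})) D) N B c g"
      by (rule bounded_differencesI) (fact g_diff[unfolded I_def])
  qed (fact g_meas[unfolded I_def] g_bdd[unfolded I_def])+
  define E where "E = (\<integral>x. f x \<partial>?P)"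
  have E: "\<bar>E\<bar> \<le> C" unfolding E_def using meas bdd by (rule P.abs_integral_le_const)
  \<comment> \<open>Hoeffding's lemma on an interval of length 2 c N gives the exponent l^2 (2 c
    N)^2 / 8.\<close>
  have hoeff: "(\<integral>y. exp (l * (F x y - g x)) \<partial>?PJ) \<le> exp (l\<^sup>2 * (c N)\<^sup>2 / 2)"
    if x: "x \<in> space ?PI" for x
  proof -
    have "F x y - g x \<in> {- c N..c N}" if y: "y \<in> space ?PJ" for y
    proof -
      \<comment> \<open>Averaging over a second copy y' of the block turns the difference bound into
        a bound on the deviation from the mean.\<close>
      have "F x y - g x = (\<integral>y'. F x y - F x y' \<partial>?PJ)"
        unfolding g_def using Fx_int[OF x] by (simp add: PJ.prob_space)
      moreover have "\<bar>F x y - F x y'\<bar> \<le> c N" if y': "y' \<in> space ?PJ" for y'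
        unfolding F_def
      proof (rule diff)
        fix p assume "p \<notin> B N"
        then show "merge I J (x, y) p = merge I J (x, y') p" by (simp add: merge_def J_def)
      qed (use mergeP x y y' in auto)
      ultimately have "\<bar>F x y - g x\<bar> \<le> c N"
        using Fx_meas[OF x] by (simp add: PJ.abs_integral_le_const)
      then have "- c N \<le> F x y - g x" "F x y - g x \<le> c N" by linarith+
      then show ?thesis by simp
    qed
    then interpret B: interval_bounded_random_variable ?PJ "\<lambda>y. F x y - g x" "- c N" "c N"
      using Fx_meas[OF x] by unfold_locales (simp, rule AE_I2)
    have "PJ.expectation (\<lambda>y. F x y - g x) = 0"
      using Fx_int[OF x] by (simp add: g_def PJ.prob_space)
    from B.Hoeffdings_lemma_nn_integral_0[OF l this]
    have "(\<integral>\<^sup>+y. exp (l * (F x y - g x)) \<partial>?PJ) \<le> ennreal (exp (l\<^sup>2 * (c N)\<^sup>2 / 2))"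
      by (simp add: power2_eq_square field_simps)
    moreover have "(\<integral>y. exp (l * (F x y - g x)) \<partial>?PJ) =
        enn2real (\<integral>\<^sup>+y. exp (l * (F x y - g x)) \<partial>?PJ)"
      using Fx_meas[OF x] by (intro integral_eq_nn_integral) auto
    ultimately show ?thesis
      by (metis enn2real_leI exp_ge_zero)
  qed
  have exp_int: "integrable ?P (\<lambda>x. exp (l * (f x - E)))"
  proof (rule P.integrable_const_bound[where B = "exp (l * (C + C))"])
    show "AE x in ?P. norm (exp (l * (f x - E))) \<le> exp (l * (C + C))"
    proof (rule AE_I2)
      fix x assume "x \<in> space ?P"
      then have "f x - E \<le> C + C" using bdd[of x] E by linarith
      then show "norm (exp (l * (f x - E))) \<le> exp (l * (C + C))" using l by simp
    qed
  qed (use meas in measurable)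
  have g_exp_int: "integrable ?PI (\<lambda>x. exp (l * (g x - E)) * exp (l\<^sup>2 * (c N)\<^sup>2 / 2))"
  proof (intro integrable_mult_left PI.integrable_const_bound[where B = "exp (l * (C + C))"])
    show "AE x in ?PI. norm (exp (l * (g x - E))) \<le> exp (l * (C + C))"
    proof (rule AE_I2)
      fix x assume "x \<in> space ?PI"
      then have "g x - E \<le> C + C" using g_bdd[of x] E by linarith
      then show "norm (exp (l * (g x - E))) \<le> exp (l * (C + C))" using l by simp
    qed
  qed (use g_meas in measurable)
  have "(\<integral>x. exp (l * (f x - E)) \<partial>?P) = (\<integral>x. \<integral>y. exp (l * (F x y - E)) \<partial>?PJ \<partial>?PI)"
    unfolding F_def by (rule product_integral_fold[OF disjIJ finIJ exp_int])
  also have "\<dots> \<le> (\<integral>x. exp (l * (g x - E)) * exp (l\<^sup>2 * (c N)\<^sup>2 / 2) \<partial>?PI)"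
  proof (rule integral_mono'[OF g_exp_int])
    fix x assume x: "x \<in> space ?PI"
    have "(\<integral>y. exp (l * (F x y - E)) \<partial>?PJ) = (\<integral>y. exp (l * (g x - E)) * exp (l * (F x y - g x)) \<partial>?PJ)"
      by (intro Bochner_Integration.integral_cong refl) (simp add: algebra_simps flip: exp_add)
    also have "\<dots> = exp (l * (g x - E)) * (\<integral>y. exp (l * (F x y - g x)) \<partial>?PJ)" by simp
    finally show "(\<integral>y. exp (l * (F x y - E)) \<partial>?PJ) \<le> exp (l * (g x - E)) * exp (l\<^sup>2 * (c N)\<^sup>2 / 2)"
      using hoeff[OF x] by simp
  qed simp
  also have "\<dots> = (\<integral>x. exp (l * (g x - (\<integral>y. g y \<partial>?PI))) \<partial>?PI) * exp (l\<^sup>2 * (c N)\<^sup>2 / 2)"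
    by (simp add: E_def Ef)
  also have "\<dots> \<le> exp (l\<^sup>2 * (\<Sum>i<N. (c i)\<^sup>2) / 2) * exp (l\<^sup>2 * (c N)\<^sup>2 / 2)"
    using IH by simp
  also have "\<dots> = exp (l\<^sup>2 * (\<Sum>i<Suc N. (c i)\<^sup>2) / 2)"
    by (simp add: field_simps flip: exp_add)
  finally show ?case unfolding IJ E_def .
qed

lemma mcdiarmid:
  fixes D :: "'i \<Rightarrow> 'a measure" and f :: "('i \<Rightarrow> 'a) \<Rightarrow> real" and B :: "nat \<Rightarrow> 'i set"
  defines "P N \<equiv> PiM (\<Union>i<N. B i) D"
  assumes D: "\<And>i. prob_space (D i)"
    and fin: "\<And>i. i < N \<Longrightarrow> finite (B i)"
    and disj: "disjoint_family_on B {..<N}"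
    and meas: "f \<in> borel_measurable (P N)"
    and bdd: "\<And>x. x \<in> space (P N) \<Longrightarrow> \<bar>f x\<bar> \<le> C"
    and diff: "bounded_differences (P N) N B c f"
    and S: "(\<Sum>i<N. (c i)\<^sup>2) = S" "S > 0" and \<epsilon>: "\<epsilon> > 0"
  shows "measure (P N) {x \<in> space (P N). \<bar>f x - (\<integral>y. f y \<partial>P N)\<bar> \<ge> \<epsilon>} \<le> 2 * exp (- (\<epsilon>\<^sup>2 / (2 * S)))"
proof -
  interpret P: prob_space "P N" unfolding P_def by (intro prob_space_PiM D)
  \<comment> \<open>The minimiser of the Chernoff exponent
    \<open>l\<^sup>2 * S / 2 - l * \<epsilon>\<close>.\<close>
  define l where "l = \<epsilon> / S"
  have l: "l > 0" using S \<epsilon> by (simp add: l_def)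
  have one: "measure (P N) {x \<in> space (P N). h x - (\<integral>y. h y \<partial>P N) \<ge> \<epsilon>} \<le> exp (- (\<epsilon>\<^sup>2 / (2 * S)))"
    if h: "h \<in> borel_measurable (P N)" "\<And>x. x \<in> space (P N) \<Longrightarrow> \<bar>h x\<bar> \<le> C"
      "bounded_differences (P N) N B c h" for h
  proof -
    define E where "E = (\<integral>y. h y \<partial>P N)"
    have mgf: "(\<integral>x. exp (l * (h x - E)) \<partial>P N) \<le> exp (l\<^sup>2 * S / 2)"
      unfolding E_def P_def S(1)[symmetric]
      by (rule mcdiarmid_mgf[where C = C and B = B and N = N and f = h and D = D and c = c and l = l])
        (fact D fin disj h[unfolded P_def] l)+
    have E: "\<bar>E\<bar> \<le> C" unfolding E_def using h by (intro P.abs_integral_le_const)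
    have int: "integrable (P N) (\<lambda>x. exp (l * (h x - E)))"
    proof (rule P.integrable_const_bound[where B = "exp (l * (C + C))"])
      show "AE x in P N. norm (exp (l * (h x - E))) \<le> exp (l * (C + C))"
      proof (rule AE_I2)
        fix x assume "x \<in> space (P N)"
        then have "h x - E \<le> C + C" using h(2)[of x] E by linarith
        then show "norm (exp (l * (h x - E))) \<le> exp (l * (C + C))" using l by simp
      qed
    qed (use h in measurable)
    have "{x \<in> space (P N). h x - E \<ge> \<epsilon>} = {x \<in> space (P N). exp (l * (h x - E)) \<ge> exp (l * \<epsilon>)}"
      using l by auto
    also have "measure (P N) \<dots> \<le> (\<integral>x. exp (l * (h x - E)) \<partial>P N) / exp (l * \<epsilon>)"
      by (rule integral_Markov_inequality_measure[OF int, of "{}"]) auto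
    also have "\<dots> \<le> exp (l\<^sup>2 * S / 2) / exp (l * \<epsilon>)"
      using mgf by (intro divide_right_mono) auto
    also have "\<dots> = exp (l\<^sup>2 * S / 2 - l * \<epsilon>)" by (simp add: exp_diff)
    also have "l\<^sup>2 * S / 2 - l * \<epsilon> = - (\<epsilon>\<^sup>2 / (2 * S))"
      using S by (simp add: l_def field_simps power2_eq_square)
    finally show ?thesis unfolding E_def .
  qed
  have neg: "measure (P N) {x \<in> space (P N). - f x - (\<integral>y. - f y \<partial>P N) \<ge> \<epsilon>} \<le> exp (- (\<epsilon>\<^sup>2 / (2 * S)))"
  proof (rule one)
    show "bounded_differences (P N) N B c (\<lambda>x. - f x)"
      using diff by (simp add: bounded_differences_def abs_minus_commute)
  qed (use meas bdd in auto)
  have "measure (P N) {x \<in> space (P N). \<bar>f x - (\<integral>y. f y \<partial>P N)\<bar> \<ge> \<epsilon>} \<le>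
      measure (P N) ({x \<in> space (P N). f x - (\<integral>y. f y \<partial>P N) \<ge> \<epsilon>} \<union>
        {x \<in> space (P N). - f x - (\<integral>y. - f y \<partial>P N) \<ge> \<epsilon>})"
    using meas by (intro P.finite_measure_mono) auto
  also have "\<dots> \<le> exp (- (\<epsilon>\<^sup>2 / (2 * S))) + exp (- (\<epsilon>\<^sup>2 / (2 * S)))"
    using meas by (intro order.trans[OF measure_Un_le] add_mono one[OF meas bdd diff] neg) auto
  finally show ?thesis by simp
qed

section \<open>Expansion of the resolvent in one entry\<close>

text \<open>The direction in which a symmetric matrix moves when one of its variables changes; on
  the diagonal it has a single 1 and no 2.\<close>

definition entry_unit :: "nat \<Rightarrow> nat \<Rightarrow> nat \<Rightarrow> nat \<Rightarrow> real" where
  "entry_unit i j a b = (if a = i \<and> b = j \<or> a = j \<and> b = i then 1 else 0)"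

text \<open>The entry \<open>(a, b)\<close> of \<open>A E B\<close>, where \<open>E\<close> is \<open>entry_unit i j\<close>.\<close>

definition entry_sandwich ::
    "nat \<Rightarrow> nat \<Rightarrow> (nat \<Rightarrow> nat \<Rightarrow> complex) \<Rightarrow> (nat \<Rightarrow> nat \<Rightarrow> complex) \<Rightarrow> nat \<Rightarrow> nat \<Rightarrow> complex" where
  "entry_sandwich i j A B a b = A a i * B j b + (if i = j then 0 else A a j * B i b)"

lemma entry_sandwich_eq_sum:
  assumes ij: "i < n" "j < n"
  shows "(\<Sum>c<n. \<Sum>d<n. A a c * of_real (entry_unit i j c d) * B d b) = entry_sandwich i j A B a b"
proof -
  have inner: "(\<Sum>d<n. A a c * of_real (entry_unit i j c d) * B d b) =
      (if c = i then A a i * B j b else 0) + (if c = j \<and> i \<noteq> j then A a j * B i b else 0)" for c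
  proof -
    have "(\<Sum>d<n. A a c * of_real (entry_unit i j c d) * B d b) =
        (\<Sum>d<n. (if d = j then (if c = i then A a i * B j b else 0) else 0) +
          (if d = i then (if c = j \<and> i \<noteq> j then A a j * B i b else 0) else 0))"
      by (intro sum.cong refl) (auto simp: entry_unit_def)
    also have "\<dots> = (if c = i then A a i * B j b else 0) + (if c = j \<and> i \<noteq> j then A a j * B i b else 0)"
      using ij by (simp add: sum.distrib)
    finally show ?thesis .
  qed
  show ?thesis
    unfolding inner sum.distrib using ij by (simp add: entry_sandwich_def)
qed

lemma entry_sandwich_diff_left:
  assumes "cmod (A a i - A' a i) \<le> \<delta>" "cmod (A a j - A' a j) \<le> \<delta>"
    "cmod (B i b) \<le> K" "cmod (B j b) \<le> K" "\<delta> \<ge> 0" "K \<ge> 0"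
  shows "cmod (entry_sandwich i j A B a b - entry_sandwich i j A' B a b) \<le> 2 * (\<delta> * K)"
proof -
  have "entry_sandwich i j A B a b - entry_sandwich i j A' B a b =
      (A a i - A' a i) * B j b + (if i = j then 0 else (A a j - A' a j) * B i b)"
    by (simp add: entry_sandwich_def algebra_simps)
  also have "cmod \<dots> \<le> cmod ((A a i - A' a i) * B j b) + cmod (if i = j then 0 else (A a j - A' a j) * B i b)"
    by (rule norm_triangle_ineq)
  also have "\<dots> \<le> \<delta> * K + \<delta> * K"
    using assms by (intro add_mono) (auto simp: norm_mult intro!: mult_mono)
  finally show ?thesis by (simp only: mult_2)
qed

lemma entry_sandwich_diff_right:
  assumes "cmod (B i b - B' i b) \<le> \<delta>" "cmod (B j b - B' j b) \<le> \<delta>"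
    "cmod (A a i) \<le> K" "cmod (A a j) \<le> K" "\<delta> \<ge> 0" "K \<ge> 0"
  shows "cmod (entry_sandwich i j A B a b - entry_sandwich i j A B' a b) \<le> 2 * (\<delta> * K)"
proof -
  have "entry_sandwich i j A B a b - entry_sandwich i j A B' a b =
      A a i * (B j b - B' j b) + (if i = j then 0 else A a j * (B i b - B' i b))"
    by (simp add: entry_sandwich_def algebra_simps)
  also have "cmod \<dots> \<le> cmod (A a i * (B j b - B' j b)) + cmod (if i = j then 0 else A a j * (B i b - B' i b))"
    by (rule norm_triangle_ineq)
  also have "\<dots> \<le> K * \<delta> + K * \<delta>"
    using assms by (intro add_mono) (auto simp: norm_mult intro!: mult_mono)
  finally show ?thesis by (simp add: mult.commute)
qed

text \<open>The error of a second order expansion when only two moments exist: for small x the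
  minimum produces a third moment over sqrt(n), for large x it is capped, so that the second moment
  controls it. The summand \<open>v\<close> comes from the compensating variance term.\<close>

definition truncated_moment :: "real measure \<Rightarrow> real \<Rightarrow> nat \<Rightarrow> real" where
  "truncated_moment D v n = (\<integral>x. (x\<^sup>2 + v) * min 1 (\<bar>x\<bar> / sqrt (real n)) \<partial>D)"

text \<open>The minimum tends to 0 pointwise, and \<open>x\<^sup>2 + v\<close> dominates. No rate
  results.\<close>

lemma truncated_moment_tendsto_0:
  assumes D: "prob_space D" and sets: "sets D = sets borel"
    and int: "integrable D (\<lambda>x. x\<^sup>2)" and v: "v \<ge> 0"
  shows "truncated_moment D v \<longlonglongrightarrow> 0"
proof -
  interpret prob_space D by fact
  note [measurable_cong] = sets
  have "(\<lambda>n. \<integral>x. (x\<^sup>2 + v) * min 1 (\<bar>x\<bar> / sqrt (real n)) \<partial>D) \<longlonglongrightarrow> (\<integral>x. 0 \<partial>D)"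
  proof (rule integral_dominated_convergence[where w = "\<lambda>x. x\<^sup>2 + v"])
    show "AE x in D. (\<lambda>n. (x\<^sup>2 + v) * min 1 (\<bar>x\<bar> / sqrt (real n))) \<longlonglongrightarrow> 0"
    proof (rule AE_I2)
      fix x :: real
      have "filterlim (\<lambda>n. sqrt (real n)) at_top sequentially"
        by (intro filterlim_compose[OF sqrt_at_top] filterlim_real_sequentially)
      then have "(\<lambda>n. \<bar>x\<bar> / sqrt (real n)) \<longlonglongrightarrow> 0"
        by (intro tendsto_divide_0[OF tendsto_const] filterlim_at_top_imp_at_infinity)
      then have "(\<lambda>n. (x\<^sup>2 + v) * min 1 (\<bar>x\<bar> / sqrt (real n))) \<longlonglongrightarrow> (x\<^sup>2 + v) * min 1 0"
        by (intro tendsto_intros)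
      then show "(\<lambda>n. (x\<^sup>2 + v) * min 1 (\<bar>x\<bar> / sqrt (real n))) \<longlonglongrightarrow> 0" by simp
    qed
    show "AE x in D. norm ((x\<^sup>2 + v) * min 1 (\<bar>x\<bar> / sqrt (real n))) \<le> x\<^sup>2 + v" for n
    proof (rule AE_I2)
      fix x :: real
      have "(x\<^sup>2 + v) * min 1 (\<bar>x\<bar> / sqrt (real n)) \<le> (x\<^sup>2 + v) * 1"
        using v by (intro mult_left_mono) auto
      then show "norm ((x\<^sup>2 + v) * min 1 (\<bar>x\<bar> / sqrt (real n))) \<le> x\<^sup>2 + v"
        using v by (simp add: abs_mult)
    qed
    show "integrable D (\<lambda>x. x\<^sup>2 + v)" using int by simp
  qed measurable
  then show ?thesis by (simp add: truncated_moment_def[abs_def])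
qed

text \<open>A substitute for Gaussian integration by parts. With Q(x, y) the sandwich of G x and G
  y, the resolvent identity gives G x = G 0 - (x / sqrt n) Q(x, 0), so (x / sqrt n) G x = (x / sqrt
  n) G 0 - (x^2 / n) Q(x, 0). Once every Q is replaced by Q(0, 0), the integral is 0 by the values
  of mean and variance; the cost of the replacement is the truncated moment.\<close>

lemma one_entry_expansion:
  fixes D :: "real measure" and H :: "nat \<Rightarrow> nat \<Rightarrow> real" and n i j :: nat and z :: complex
  defines "G \<equiv> \<lambda>x. resolvent n (\<lambda>a b. H a b + x / sqrt (real n) * entry_unit i j a b) z"
  assumes sym: "sym_below n H" and z: "Im z > 0" and ij: "i < n" "j < n"
    and D: "prob_space D" and sets: "sets D = sets borel"
    and int: "integrable D (\<lambda>x. x\<^sup>2)" and mean: "(\<integral>x. x \<partial>D) = 0" and var: "(\<integral>x. x\<^sup>2 \<partial>D) = v"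
  shows "cmod (\<integral>x. of_real (x / sqrt (real n)) * G x j i +
      of_real (v / real n) * entry_sandwich i j (G x) (G x) j i \<partial>D)
    \<le> 4 * (2 / Im z + 2 / (Im z)\<^sup>2) / Im z * truncated_moment D v n / real n"
proof -
  interpret prob_space D by fact
  note [measurable_cong] = sets
  define \<eta> where "\<eta> = Im z"
  \<comment> \<open>\<open>K\<close> dominates both the trivial bound 2/\<eta> on the change of a
    resolvent entry and the factor 2/\<eta>^2 of its linear bound.\<close>
  define K where "K = 2 / \<eta> + 2 / \<eta>\<^sup>2"
  have \<eta>: "\<eta> > 0" using z by (simp add: \<eta>_def)
  have n: "n > 0" using ij by simp
  have v: "v \<ge> 0" using var by (metis integral_nonneg_AE AE_I2 zero_le_power2)
  have int1: "integrable D (\<lambda>x. x)"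
    by (rule square_integrable_imp_integrable[OF _ int]) measurable
  define H' where "H' = (\<lambda>x a b. H a b + x / sqrt (real n) * entry_unit i j a b)"
  have symx: "sym_below n (H' x)" for x
    using sym by (auto simp: H'_def sym_below_def entry_unit_def)
  have G: "G x = resolvent n (H' x) z" for x by (simp add: G_def H'_def)
  have G_bd: "cmod (G x a b) \<le> 1 / \<eta>" if "a < n" "b < n" for x a b
    unfolding G \<eta>_def using resolvent_entry_bound[OF symx z that] .
  have G_meas: "(\<lambda>x. G x a b) \<in> borel_measurable D" if "a < n" "b < n" for a b
    unfolding G by (intro measurable_resolvent that) (simp add: H'_def)
  have G_diff: "G x a b - G 0 a b = - of_real (x / sqrt (real n)) * entry_sandwich i j (G x) (G 0) a b"
    if ab: "a < n" "b < n" for x a b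
  proof -
    have "G x a b - G 0 a b =
        (\<Sum>c<n. \<Sum>d<n. G x a c * of_real (H' 0 c d - H' x c d) * G 0 d b)"
      unfolding G by (rule resolvent_identity[OF symx symx z ab])
    also have "\<dots> = (\<Sum>c<n. \<Sum>d<n. - of_real (x / sqrt (real n)) *
        (G x a c * of_real (entry_unit i j c d) * G 0 d b))"
      by (intro sum.cong refl) (simp add: H'_def)
    also have "\<dots> = - of_real (x / sqrt (real n)) * entry_sandwich i j (G x) (G 0) a b"
      by (simp only: entry_sandwich_eq_sum[OF ij, symmetric] sum_distrib_left)
    finally show ?thesis .
  qed
  define \<delta> where "\<delta> = (\<lambda>x. K * min 1 (\<bar>x\<bar> / sqrt (real n)))"
  have K: "K \<ge> 0" using \<eta> by (simp add: K_def)
  have \<delta>_nonneg: "\<delta> x \<ge> 0" for x using K by (simp add: \<delta>_def)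
  have sandwich_bd: "cmod (entry_sandwich i j (G x) (G y) a b) \<le> 2 / \<eta>\<^sup>2" if "a < n" "b < n" for x y a b
  proof -
    have "cmod (entry_sandwich i j (G x) (G y) a b - entry_sandwich i j (\<lambda>_ _. 0) (G y) a b)
        \<le> 2 * (1 / \<eta> * (1 / \<eta>))"
      using G_bd that ij \<eta> by (intro entry_sandwich_diff_left) auto
    moreover have "entry_sandwich i j (\<lambda>_ _. 0) (G y) a b = 0" by (simp add: entry_sandwich_def)
    ultimately show ?thesis by (simp add: power2_eq_square)
  qed
  have \<delta>: "cmod (G x a b - G 0 a b) \<le> \<delta> x" if ab: "a < n" "b < n" for x a b
  proof -
    have "cmod (G x a b - G 0 a b) \<le> cmod (G x a b) + cmod (G 0 a b)" by (rule norm_triangle_ineq4)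
    also have "\<dots> \<le> 1 / \<eta> + 1 / \<eta>" using G_bd[OF ab] by (intro add_mono)
    also have "\<dots> \<le> K * 1" using \<eta> by (simp add: K_def)
    finally have 1: "cmod (G x a b - G 0 a b) \<le> K * 1" .
    have "cmod (G x a b - G 0 a b) =
        \<bar>x\<bar> / sqrt (real n) * cmod (entry_sandwich i j (G x) (G 0) a b)"
      unfolding G_diff[OF ab] by (simp add: norm_mult norm_divide)
    also have "\<dots> \<le> \<bar>x\<bar> / sqrt (real n) * (2 / \<eta>\<^sup>2)"
      using sandwich_bd[OF ab] by (intro mult_left_mono) auto
    also have "\<dots> \<le> \<bar>x\<bar> / sqrt (real n) * K"
      using \<eta> by (intro mult_left_mono) (auto simp: K_def)
    finally have "cmod (G x a b - G 0 a b) \<le> K * (\<bar>x\<bar> / sqrt (real n))" by (simp add: mult.commute)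
    then show ?thesis using 1 by (simp add: \<delta>_def min_def)
  qed
  define \<sigma> where "\<sigma> = v / real n"
  define Q where "Q = (\<lambda>x y. entry_sandwich i j (G x) (G y) j i)"
  \<comment> \<open>\<open>R\<close> collects the replacement errors; what is left of
    \<open>f\<close> is \<open>g\<close>, which has mean 0.\<close>
  define R where "R = (\<lambda>x. - of_real (x\<^sup>2 / real n) * (Q x 0 - Q 0 0) + of_real \<sigma> * (Q x x - Q 0 0))"
  define f where "f = (\<lambda>x. of_real (x / sqrt (real n)) * G x j i + of_real \<sigma> * Q x x)"
  define g where "g = (\<lambda>x. of_real (x / sqrt (real n)) * G 0 j i + of_real (\<sigma> - x\<^sup>2 / real n) * Q 0 0)"
  have sqrt2: "complex_of_real (x / sqrt (real n)) * of_real (x / sqrt (real n)) = of_real (x\<^sup>2 / real n)" for x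
    by (simp add: power2_eq_square flip: of_real_mult)
  have f_eq: "f x = g x + R x" for x
  proof -
    have "G x j i = G 0 j i - of_real (x / sqrt (real n)) * Q x 0"
      using G_diff[OF ij(2,1), of x] by (simp add: Q_def algebra_simps)
    then have "of_real (x / sqrt (real n)) * G x j i =
        of_real (x / sqrt (real n)) * G 0 j i - of_real (x\<^sup>2 / real n) * Q x 0"
      by (simp only: right_diff_distrib mult.assoc[symmetric] sqrt2)
    then show ?thesis by (simp add: f_def g_def R_def algebra_simps diff_divide_distrib)
  qed
  have Q_meas: "(\<lambda>x. Q x x) \<in> borel_measurable D" "(\<lambda>x. Q x 0) \<in> borel_measurable D"
    unfolding Q_def entry_sandwich_def using G_meas ij by measurable
  have QL: "cmod (Q x 0 - Q 0 0) \<le> 2 * (\<delta> x * (1 / \<eta>))" for x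
    unfolding Q_def using \<delta> \<delta>_nonneg G_bd ij \<eta> by (intro entry_sandwich_diff_left) auto
  have QR: "cmod (Q x x - Q x 0) \<le> 2 * (\<delta> x * (1 / \<eta>))" for x
    unfolding Q_def using \<delta> \<delta>_nonneg G_bd ij \<eta> by (intro entry_sandwich_diff_right) auto
  have \<sigma>: "\<sigma> \<ge> 0" using v by (simp add: \<sigma>_def)
  define w where "w = (\<lambda>x. 4 * K / \<eta> / real n * ((x\<^sup>2 + v) * min 1 (\<bar>x\<bar> / sqrt (real n))))"
  have R_bd: "cmod (R x) \<le> w x" for x
  proof -
    \<comment> \<open>One factor of the sandwich is changed at a time, passing through
      \<open>Q x 0\<close>.\<close>
    have "cmod (Q x x - Q 0 0) \<le> 4 * (\<delta> x * (1 / \<eta>))"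
      using norm_triangle_ineq[of "Q x x - Q x 0" "Q x 0 - Q 0 0"] QL[of x] QR[of x] by simp
    then have a: "cmod (of_real \<sigma> * (Q x x - Q 0 0)) \<le> \<sigma> * (4 * (\<delta> x * (1 / \<eta>)))"
      unfolding norm_mult using \<sigma> by (intro mult_mono) auto
    have b: "cmod (- of_real (x\<^sup>2 / real n) * (Q x 0 - Q 0 0)) \<le> x\<^sup>2 / real n * (2 * (\<delta> x * (1 / \<eta>)))"
      unfolding norm_mult norm_minus_cancel norm_of_real using QL by (intro mult_mono) auto
    have "x\<^sup>2 / real n * (2 * (\<delta> x * (1 / \<eta>))) \<le> x\<^sup>2 / real n * (4 * (\<delta> x * (1 / \<eta>)))"
      using \<delta>_nonneg[of x] \<eta> by (intro mult_left_mono mult_right_mono) auto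
    then have "cmod (R x) \<le> x\<^sup>2 / real n * (4 * (\<delta> x * (1 / \<eta>))) + \<sigma> * (4 * (\<delta> x * (1 / \<eta>)))"
      unfolding R_def using a b norm_triangle_mono by fastforce
    also have "\<dots> = w x" by (simp add: w_def \<delta>_def \<sigma>_def add_divide_distrib ring_distribs mult_ac)
    finally show ?thesis .
  qed
  have w_int: "integrable D w"
  proof (rule Bochner_Integration.integrable_bound)
    show "integrable D (\<lambda>x. 4 * K / \<eta> / real n * (x\<^sup>2 + v))" using int by simp
    show "w \<in> borel_measurable D" unfolding w_def by measurable
    show "AE x in D. norm (w x) \<le> norm (4 * K / \<eta> / real n * (x\<^sup>2 + v))"
    proof (rule AE_I2)
      fix x :: real
      have "(x\<^sup>2 + v) * min 1 (\<bar>x\<bar> / sqrt (real n)) \<le> (x\<^sup>2 + v) * 1"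
        using v by (intro mult_left_mono) auto
      then have "w x \<le> 4 * K / \<eta> / real n * (x\<^sup>2 + v)"
        unfolding w_def using K \<eta> by (intro mult_left_mono) auto
      moreover have "w x \<ge> 0" unfolding w_def using K \<eta> v by (intro mult_nonneg_nonneg) auto
      ultimately show "norm (w x) \<le> norm (4 * K / \<eta> / real n * (x\<^sup>2 + v))"
        unfolding real_norm_def by linarith
    qed
  qed
  have R_int: "integrable D R"
  proof (rule Bochner_Integration.integrable_bound[OF w_int])
    show "R \<in> borel_measurable D" unfolding R_def using Q_meas by measurable
    show "AE x in D. cmod (R x) \<le> norm (w x)"
      using R_bd by (intro AE_I2) (metis abs_ge_self order.trans real_norm_def)
  qed
  have g_int: "integrable D g" and g0: "(\<integral>x. g x \<partial>D) = 0"
  proof -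
    have 1: "integrable D (\<lambda>x. complex_of_real (x / sqrt (real n)))"
      using int1 by (intro integrable_of_real integrable_divide) auto
    have 2: "integrable D (\<lambda>x. complex_of_real (\<sigma> - x\<^sup>2 / real n))"
      using int by (intro integrable_of_real) auto
    show "integrable D g" unfolding g_def using 1 2
      by (intro Bochner_Integration.integrable_add integrable_mult_left)
    have "(\<integral>x. g x \<partial>D) = (\<integral>x. complex_of_real (x / sqrt (real n)) \<partial>D) * G 0 j i +
        (\<integral>x. complex_of_real (\<sigma> - x\<^sup>2 / real n) \<partial>D) * Q 0 0"
      unfolding g_def
      by (simp only: Bochner_Integration.integral_add[OF integrable_mult_left[OF 1] integrable_mult_left[OF 2]]
          integral_mult_left_zero)
    also have "(\<integral>x. complex_of_real (x / sqrt (real n)) \<partial>D) = of_real (\<integral>x. x / sqrt (real n) \<partial>D)"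
      by (rule integral_complex_of_real)
    also have "(\<integral>x. x / sqrt (real n) \<partial>D) = 0" using mean by simp
    also have "(\<integral>x. complex_of_real (\<sigma> - x\<^sup>2 / real n) \<partial>D) = of_real (\<integral>x. \<sigma> - x\<^sup>2 / real n \<partial>D)"
      by (rule integral_complex_of_real)
    also have "(\<integral>x. \<sigma> - x\<^sup>2 / real n \<partial>D) = 0" using int var by (simp add: \<sigma>_def prob_space)
    finally show "(\<integral>x. g x \<partial>D) = 0" by simp
  qed
  have "(\<integral>x. f x \<partial>D) = (\<integral>x. g x \<partial>D) + (\<integral>x. R x \<partial>D)"
    unfolding f_eq by (rule Bochner_Integration.integral_add[OF g_int R_int])
  then have "cmod (\<integral>x. f x \<partial>D) = cmod (\<integral>x. R x \<partial>D)" using g0 by simp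
  also have "\<dots> \<le> (\<integral>x. w x \<partial>D)"
    using R_bd by (intro Bochner_Integration.integral_norm_bound_integral R_int w_int)
  also have "\<dots> = 4 * K / \<eta> * truncated_moment D v n / real n"
    unfolding w_def truncated_moment_def by simp
  finally show ?thesis unfolding f_def Q_def \<sigma>_def K_def \<eta>_def .
qed

section \<open>The loop equation of a Wigner matrix\<close>

definition upper_indices :: "nat \<Rightarrow> (nat \<times> nat) set" where
  "upper_indices n = {(i, j). i \<le> j \<and> j < n}"

definition wigner :: "nat \<Rightarrow> (nat \<times> nat \<Rightarrow> real) \<Rightarrow> nat \<Rightarrow> nat \<Rightarrow> real" where
  "wigner n x a b = x (min a b, max a b) / sqrt (real n)"

lemma finite_upper_indices [simp]: "finite (upper_indices n)"
  by (rule finite_subset[of _ "{..n} \<times> {..<n}"]) (auto simp: upper_indices_def)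

lemma min_max_in_upper_indices: "i < n \<Longrightarrow> j < n \<Longrightarrow> (min i j, max i j) \<in> upper_indices n"
  by (auto simp: upper_indices_def)

lemma sym_below_wigner: "sym_below n (wigner n x)"
  by (simp add: sym_below_def wigner_def min.commute max.commute)

lemma wigner_cong:
  assumes "\<And>p. p \<in> upper_indices n \<Longrightarrow> x p = y p" "a < n" "b < n"
  shows "wigner n x a b = wigner n y a b"
  using assms(1)[OF min_max_in_upper_indices[OF assms(2,3)]] by (simp add: wigner_def)

text \<open>Varying one variable gives a line through a matrix that does not contain it, which is
  the form required by \<open>one_entry_expansion\<close>.\<close>

lemma wigner_update:
  "wigner n (x((min i j, max i j) := t)) a b =
     wigner n (x((min i j, max i j) := 0)) a b + t / sqrt (real n) * entry_unit i j a b"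
proof (cases "(min a b, max a b) = (min i j, max i j)")
  case True
  then have "a = i \<and> b = j \<or> a = j \<and> b = i" by (auto simp: min_def max_def split: if_splits)
  then show ?thesis using True by (simp add: wigner_def entry_unit_def)
next
  case False
  then have "\<not> (a = i \<and> b = j \<or> a = j \<and> b = i)" by (auto simp: min.commute max.commute)
  then have unit: "entry_unit i j a b = 0" by (auto simp: entry_unit_def)
  show ?thesis
    unfolding wigner_def unit fun_upd_other[OF False] by simp
qed

text \<open>\<open>D\<close> is the common law of the entries before scaling, the diagonal included.
  The product of copies of \<open>D\<close> over the upper triangle serves as the law of the whole
  matrix, and the spectral parameter is fixed once.\<close>

locale centered_entries = prob_space D for D :: "real measure" +
  fixes v :: real and z :: complex
  assumes sets_D [measurable_cong]: "sets D = sets borel"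
    and square_integrable: "integrable D (\<lambda>x. x\<^sup>2)"
    and mean_0: "(\<integral>x. x \<partial>D) = 0"
    and variance_v: "(\<integral>x. x\<^sup>2 \<partial>D) = v"
    and Im_z: "Im z > 0"
begin

lemma v_nonneg: "v \<ge> 0"
  using variance_v by (metis integral_nonneg_AE AE_I2 zero_le_power2)

abbreviation entries :: "nat \<Rightarrow> (nat \<times> nat \<Rightarrow> real) measure" where
  "entries n \<equiv> PiM (upper_indices n) (\<lambda>_. D)"

definition G :: "nat \<Rightarrow> (nat \<times> nat \<Rightarrow> real) \<Rightarrow> nat \<Rightarrow> nat \<Rightarrow> complex" where
  "G n x = resolvent n (wigner n x) z"

definition S :: "nat \<Rightarrow> (nat \<times> nat \<Rightarrow> real) \<Rightarrow> complex" where
  "S n x = resolvent_trace n (wigner n x) z"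

lemma prob_space_entries: "prob_space (entries n)"
  by (intro prob_space_PiM prob_space_axioms)

lemma product_sigma_finite_D: "product_sigma_finite (\<lambda>_. D)"
  by (intro product_sigma_finite.intro sigma_finite_measure_axioms)

lemma measurable_component: "p \<in> upper_indices n \<Longrightarrow> (\<lambda>x. x p) \<in> borel_measurable (entries n)"
  using measurable_component_singleton[of p "upper_indices n" "\<lambda>_. D"]
  by (simp add: measurable_cong_sets[OF refl sets_D])

lemma measurable_wigner: "a < n \<Longrightarrow> b < n \<Longrightarrow> (\<lambda>x. wigner n x a b) \<in> borel_measurable (entries n)"
  unfolding wigner_def
  by (intro borel_measurable_divide measurable_component min_max_in_upper_indices) auto

lemma measurable_G: "a < n \<Longrightarrow> b < n \<Longrightarrow> (\<lambda>x. G n x a b) \<in> borel_measurable (entries n)"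
  unfolding G_def by (intro measurable_resolvent measurable_wigner)

lemma measurable_S: "S n \<in> borel_measurable (entries n)"
  unfolding S_def[abs_def] by (intro measurable_resolvent_trace measurable_wigner)

lemma G_bound: "a < n \<Longrightarrow> b < n \<Longrightarrow> cmod (G n x a b) \<le> 1 / Im z"
  unfolding G_def by (intro resolvent_entry_bound sym_below_wigner Im_z)

lemma S_bound: "cmod (S n x) \<le> real n / Im z"
  unfolding S_def by (intro resolvent_trace_bound sym_below_wigner Im_z)

lemma integrable_component:
  assumes "p \<in> upper_indices n"
  shows "integrable (entries n) (\<lambda>x. x p)"
proof -
  have int: "integrable D (\<lambda>x. x)"
    by (rule square_integrable_imp_integrable[OF _ square_integrable]) measurable
  interpret product_prob_space "\<lambda>_. D" "upper_indices n" by unfold_locales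
  from int have "integrable (distr (entries n) D (\<lambda>x. x p)) (\<lambda>x. x)"
    using PiM_component[OF assms] by simp
  then show ?thesis
    by (rule integrable_distr[OF measurable_component_singleton[OF assms, of "\<lambda>_. D"]])
qed

lemma integrable_wigner_G:
  assumes "i < n" "j < n"
  shows "integrable (entries n) (\<lambda>x. of_real (wigner n x i j) * G n x j i)"
proof (rule Bochner_Integration.integrable_bound)
  show "integrable (entries n) (\<lambda>x. x (min i j, max i j) / sqrt (real n) * (1 / Im z))"
    using integrable_component[OF min_max_in_upper_indices[OF assms]]
    by (intro integrable_mult_left integrable_divide)
  show "(\<lambda>x. of_real (wigner n x i j) * G n x j i) \<in> borel_measurable (entries n)"
    using measurable_wigner[OF assms] measurable_G[OF assms(2,1)] by measurable
  show "AE x in entries n. cmod (of_real (wigner n x i j) * G n x j i)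
      \<le> norm (x (min i j, max i j) / sqrt (real n) * (1 / Im z))"
  proof (rule AE_I2)
    fix x
    have "\<bar>wigner n x i j\<bar> * cmod (G n x j i) \<le> \<bar>wigner n x i j\<bar> * (1 / Im z)"
      using G_bound[OF assms(2,1)] by (intro mult_left_mono) auto
    also have "\<dots> = norm (x (min i j, max i j) / sqrt (real n) * (1 / Im z))"
      using Im_z by (simp add: wigner_def abs_mult)
    finally show "cmod (of_real (wigner n x i j) * G n x j i)
        \<le> norm (x (min i j, max i j) / sqrt (real n) * (1 / Im z))"
      by (simp only: norm_mult norm_of_real)
  qed
qed

lemma sandwich_bound:
  assumes "i < n" "j < n"
  shows "cmod (entry_sandwich i j (G n x) (G n x) j i) \<le> 2 / (Im z)\<^sup>2"
proof -
  have "cmod (entry_sandwich i j (G n x) (G n x) j i - entry_sandwich i j (\<lambda>_ _. 0) (G n x) j i)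
      \<le> 2 * (1 / Im z * (1 / Im z))"
    using G_bound assms Im_z by (intro entry_sandwich_diff_left) auto
  moreover have "entry_sandwich i j (\<lambda>_ _. 0) (G n x) j i = 0" by (simp add: entry_sandwich_def)
  ultimately show ?thesis by (simp add: power2_eq_square)
qed

lemma integrable_sandwich:
  assumes "i < n" "j < n"
  shows "integrable (entries n) (\<lambda>x. entry_sandwich i j (G n x) (G n x) j i)"
proof -
  interpret P: prob_space "entries n" by (rule prob_space_entries)
  have "(\<lambda>x. entry_sandwich i j (G n x) (G n x) j i) \<in> borel_measurable (entries n)"
    unfolding entry_sandwich_def using measurable_G assms by measurable
  then show ?thesis
    using sandwich_bound[OF assms] by (intro P.integrable_const_bound[where B = "2 / (Im z)\<^sup>2"]) auto
qed

definition loop_const :: real where "loop_const = 4 * (2 / Im z + 2 / (Im z)\<^sup>2) / Im z"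

text \<open>Fubini isolates the variable of this entry. With all others frozen the one-entry bound
  holds uniformly, hence it survives the integration over them.\<close>

lemma expected_entry_bound:
  assumes ij: "i < n" "j < n"
  shows "cmod (\<integral>x. of_real (wigner n x i j) * G n x j i +
      of_real (v / real n) * entry_sandwich i j (G n x) (G n x) j i \<partial>entries n)
    \<le> loop_const * truncated_moment D v n / real n"
proof -
  define p where "p = (min i j, max i j)"
  define I where "I = upper_indices n - {p}"
  have I: "finite I" "p \<notin> I" "insert p I = upper_indices n"
    using min_max_in_upper_indices[OF ij] by (auto simp: I_def p_def)
  define f where "f = (\<lambda>x. of_real (wigner n x i j) * G n x j i +
      of_real (v / real n) * entry_sandwich i j (G n x) (G n x) j i)"
  have int: "integrable (entries n) f"
    unfolding f_def using integrable_wigner_G[OF ij] integrable_sandwich[OF ij]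
    by (intro Bochner_Integration.integrable_add integrable_mult_right)
  interpret product_sigma_finite "\<lambda>_. D" by (rule product_sigma_finite_D)
  interpret P: prob_space "PiM I (\<lambda>_. D)" by (intro prob_space_PiM prob_space_axioms)
  have eq: "(\<integral>x. f x \<partial>entries n) = (\<integral>x. \<integral>t. f (x(p := t)) \<partial>D \<partial>PiM I (\<lambda>_. D))"
    using product_integral_insert[OF I(1,2), of f] int unfolding I(3) by simp
  have bd: "cmod (\<integral>t. f (x(p := t)) \<partial>D) \<le> loop_const * truncated_moment D v n / real n" for x
  proof -
    define H where "H = wigner n (x(p := 0))"
    have "wigner n (x(p := t)) = (\<lambda>a b. H a b + t / sqrt (real n) * entry_unit i j a b)" for t
      unfolding H_def p_def by (intro ext) (rule wigner_update)
    then have G: "G n (x(p := t)) =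
        resolvent n (\<lambda>a b. H a b + t / sqrt (real n) * entry_unit i j a b) z" for t
      by (simp only: G_def)
    have w: "wigner n (x(p := t)) i j = t / sqrt (real n)" for t
      by (simp add: wigner_def p_def)
    show ?thesis unfolding f_def w G loop_const_def
      by (rule one_entry_expansion)
        (auto simp: H_def sym_below_wigner Im_z ij prob_space_axioms sets_D square_integrable mean_0 variance_v)
  qed
  have "cmod (\<integral>x. f x \<partial>entries n) \<le> (\<integral>x. cmod (\<integral>t. f (x(p := t)) \<partial>D) \<partial>PiM I (\<lambda>_. D))"
    unfolding eq by (rule integral_norm_bound)
  also have "\<dots> \<le> (\<integral>x. loop_const * truncated_moment D v n / real n \<partial>PiM I (\<lambda>_. D))"
    using bd order.trans[OF norm_ge_zero bd] by (intro integral_mono') auto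
  finally show ?thesis unfolding f_def by (simp add: P.prob_space)
qed

text \<open>The products of two diagonal entries add up to the squared trace; what remains are
  squares of off-diagonal entries, controlled by the column norms.\<close>

lemma sum_sandwich:
  "cmod ((\<Sum>i<n. \<Sum>j<n. entry_sandwich i j (G n x) (G n x) j i) - (S n x)\<^sup>2) \<le> real n / (Im z)\<^sup>2"
proof -
  let ?G = "G n x"
  have "(\<Sum>i<n. \<Sum>j<n. entry_sandwich i j ?G ?G j i) =
      (\<Sum>i<n. \<Sum>j<n. ?G i i * ?G j j + (if i = j then 0 else ?G j i * ?G j i))"
    by (intro sum.cong refl) (auto simp: entry_sandwich_def)
  also have "\<dots> = (S n x)\<^sup>2 + (\<Sum>i<n. \<Sum>j<n. (if i = j then 0 else ?G j i * ?G j i))"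
    by (simp add: sum.distrib S_def resolvent_trace_def power2_eq_square sum_product G_def)
  finally have "(\<Sum>i<n. \<Sum>j<n. entry_sandwich i j ?G ?G j i) - (S n x)\<^sup>2 =
      (\<Sum>i<n. \<Sum>j<n. (if i = j then 0 else ?G j i * ?G j i))" by simp
  also have "cmod \<dots> \<le> (\<Sum>i<n. \<Sum>j<n. (cmod (?G j i))\<^sup>2)"
    by (intro sum_norm_le) (auto simp: norm_mult power2_eq_square)
  also have "\<dots> \<le> (\<Sum>i<n. 1 / (Im z)\<^sup>2)"
    unfolding G_def using resolvent_column_bound[OF sym_below_wigner Im_z] by (intro sum_mono) auto
  finally show ?thesis by simp
qed

lemma integrable_S:
  shows "integrable (entries n) (S n)" "integrable (entries n) (\<lambda>x. (S n x)\<^sup>2)"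
proof -
  interpret P: prob_space "entries n" by (rule prob_space_entries)
  show "integrable (entries n) (S n)"
    using S_bound measurable_S by (intro P.integrable_const_bound[where B = "real n / Im z"]) auto
  show "integrable (entries n) (\<lambda>x. (S n x)\<^sup>2)"
  proof (rule P.integrable_const_bound[where B = "(real n / Im z)\<^sup>2"])
    show "AE x in entries n. cmod ((S n x)\<^sup>2) \<le> (real n / Im z)\<^sup>2"
      using S_bound by (intro AE_I2) (simp only: norm_power, intro power_mono, auto)
  qed (use measurable_S in measurable)
qed

text \<open>The resolvent equation evaluates the sum of all H_ij G_ji as n + z S, and the sandwiches
  add up to S^2 up to O(n). The n^2 one-entry errors carry a factor 1/n each, so after division by n
  a multiple of the truncated moment is left.\<close>

lemma loop_equation:
  assumes n: "n > 0"
  shows "cmod (of_real v * (\<integral>x. (S n x / of_nat n)\<^sup>2 \<partial>entries n) +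
      z * (\<integral>x. S n x / of_nat n \<partial>entries n) + 1)
    \<le> loop_const * truncated_moment D v n + v / (real n * (Im z)\<^sup>2)"
proof -
  interpret P: prob_space "entries n" by (rule prob_space_entries)
  define F where "F = (\<lambda>i j x. of_real (wigner n x i j) * G n x j i)"
  define Q where "Q = (\<lambda>i j x. entry_sandwich i j (G n x) (G n x) j i)"
  define q where "q = (\<lambda>x. (\<Sum>i<n. \<Sum>j<n. Q i j x))"
  have F_int: "integrable (entries n) (F i j)" if "i < n" "j < n" for i j
    unfolding F_def using integrable_wigner_G[OF that] .
  have Q_int: "integrable (entries n) (Q i j)" if "i < n" "j < n" for i j
    unfolding Q_def using integrable_sandwich[OF that] .
  have q_int: "integrable (entries n) q"
    unfolding q_def using Q_int by (intro Bochner_Integration.integrable_sum) auto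
  have sum_int: "(\<integral>x. (\<Sum>i<n. \<Sum>j<n. f i j x) \<partial>entries n) = (\<Sum>i<n. \<Sum>j<n. \<integral>x. f i j x \<partial>entries n)"
    if f: "\<And>i j. i < n \<Longrightarrow> j < n \<Longrightarrow> integrable (entries n) (f i j)" for f :: "nat \<Rightarrow> nat \<Rightarrow> _ \<Rightarrow> complex"
  proof -
    have "(\<integral>x. (\<Sum>i<n. \<Sum>j<n. f i j x) \<partial>entries n) = (\<Sum>i<n. \<integral>x. (\<Sum>j<n. f i j x) \<partial>entries n)"
      using f by (intro Bochner_Integration.integral_sum Bochner_Integration.integrable_sum) auto
    also have "\<dots> = (\<Sum>i<n. \<Sum>j<n. \<integral>x. f i j x \<partial>entries n)"
      using f by (intro sum.cong Bochner_Integration.integral_sum) auto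
    finally show ?thesis .
  qed
  have trace: "(\<Sum>i<n. \<Sum>j<n. F i j x) = of_nat n + z * S n x" for x
  proof -
    have "(\<Sum>i<n. (\<Sum>j<n. of_real (wigner n x i j) * resolvent n (wigner n x) z j i) -
        z * resolvent n (wigner n x) z i i) = (\<Sum>i<n. 1)"
      using resolvent_equation[OF sym_below_wigner Im_z] by (intro sum.cong refl) auto
    then show ?thesis
      by (simp add: sum_subtractf F_def S_def resolvent_trace_def G_def sum_distrib_left algebra_simps)
  qed
  have "(\<Sum>i<n. \<Sum>j<n. \<integral>x. F i j x + of_real (v / real n) * Q i j x \<partial>entries n) =
      (\<integral>x. (\<Sum>i<n. \<Sum>j<n. F i j x + of_real (v / real n) * Q i j x) \<partial>entries n)"
    using F_int Q_int by (intro sum_int[symmetric] Bochner_Integration.integrable_add integrable_mult_right)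
  also have "\<dots> = (\<integral>x. (of_nat n + z * S n x) + of_real (v / real n) * q x \<partial>entries n)"
    by (simp only: sum.distrib trace q_def sum_distrib_left)
  also have "\<dots> = (\<integral>x. of_nat n + z * S n x \<partial>entries n) + (\<integral>x. of_real (v / real n) * q x \<partial>entries n)"
    using integrable_S(1)[of n] q_int by (intro Bochner_Integration.integral_add) auto
  also have "(\<integral>x. of_nat n + z * S n x \<partial>entries n) = of_nat n + z * (\<integral>x. S n x \<partial>entries n)"
    using integrable_S(1)[of n] by (simp add: P.prob_space)
  finally have sum_eq: "(\<Sum>i<n. \<Sum>j<n. \<integral>x. F i j x + of_real (v / real n) * Q i j x \<partial>entries n) =
      of_nat n + z * (\<integral>x. S n x \<partial>entries n) + of_real (v / real n) * (\<integral>x. q x \<partial>entries n)"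
    by (simp only: integral_mult_right_zero)
  have "cmod (\<Sum>i<n. \<Sum>j<n. \<integral>x. F i j x + of_real (v / real n) * Q i j x \<partial>entries n) \<le>
      (\<Sum>i<n. \<Sum>j<n. loop_const * truncated_moment D v n / real n)"
    unfolding F_def Q_def using expected_entry_bound by (intro sum_norm_le) auto
  also have "\<dots> = real n * (loop_const * truncated_moment D v n)" using n by simp
  finally have 1: "cmod (of_nat n + z * (\<integral>x. S n x \<partial>entries n) +
      of_real (v / real n) * (\<integral>x. q x \<partial>entries n)) \<le> real n * (loop_const * truncated_moment D v n)"
    unfolding sum_eq .
  have "cmod ((\<integral>x. (S n x)\<^sup>2 \<partial>entries n) - (\<integral>x. q x \<partial>entries n)) \<le> real n / (Im z)\<^sup>2"
  proof -
    have "(\<integral>x. (S n x)\<^sup>2 \<partial>entries n) - (\<integral>x. q x \<partial>entries n) = (\<integral>x. (S n x)\<^sup>2 - q x \<partial>entries n)"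
      using integrable_S(2) q_int by simp
    also have "cmod \<dots> \<le> (\<integral>x. cmod ((S n x)\<^sup>2 - q x) \<partial>entries n)"
      by (rule integral_norm_bound)
    also have "\<dots> \<le> (\<integral>x. real n / (Im z)\<^sup>2 \<partial>entries n)"
      using sum_sandwich[of n] by (intro integral_mono') (auto simp: q_def Q_def norm_minus_commute)
    finally show ?thesis by (simp add: P.prob_space)
  qed
  then have "v / real n * cmod ((\<integral>x. (S n x)\<^sup>2 \<partial>entries n) - (\<integral>x. q x \<partial>entries n)) \<le>
      v / real n * (real n / (Im z)\<^sup>2)"
    using v_nonneg by (intro mult_left_mono) auto
  then have 2: "cmod (of_real (v / real n) * ((\<integral>x. (S n x)\<^sup>2 \<partial>entries n) - (\<integral>x. q x \<partial>entries n))) \<le>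
      v / (Im z)\<^sup>2"
    using v_nonneg n by (simp add: norm_mult norm_divide)
  define s1 s2 where "s1 = (\<integral>x. S n x \<partial>entries n)" and "s2 = (\<integral>x. (S n x)\<^sup>2 \<partial>entries n)"
  have "cmod (of_nat n + z * s1 + of_real (v / real n) * s2) \<le>
      cmod (of_nat n + z * s1 + of_real (v / real n) * (\<integral>x. q x \<partial>entries n)) +
      cmod (of_real (v / real n) * (s2 - (\<integral>x. q x \<partial>entries n)))"
    by (rule order.trans[OF _ norm_triangle_ineq]) (simp add: algebra_simps)
  also have "\<dots> \<le> real n * (loop_const * truncated_moment D v n) + v / (Im z)\<^sup>2"
    using 1 2 unfolding s1_def s2_def by (rule add_mono)
  finally have 3: "cmod (of_nat n + z * s1 + of_real (v / real n) * s2) \<le>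
      real n * (loop_const * truncated_moment D v n) + v / (Im z)\<^sup>2" .
  have "of_real v * (\<integral>x. (S n x / of_nat n)\<^sup>2 \<partial>entries n) + z * (\<integral>x. S n x / of_nat n \<partial>entries n) + 1 =
      of_real v * (s2 / (of_nat n)\<^sup>2) + z * (s1 / of_nat n) + 1"
    by (simp add: s1_def s2_def power_divide)
  also have "\<dots> = (of_nat n + z * s1 + of_real (v / real n) * s2) / of_nat n"
    using n by (simp add: field_simps power2_eq_square)
  also have "cmod \<dots> \<le> (real n * (loop_const * truncated_moment D v n) + v / (Im z)\<^sup>2) / real n"
    using 3 n by (simp add: norm_divide divide_right_mono)
  also have "\<dots> = loop_const * truncated_moment D v n + v / (real n * (Im z)\<^sup>2)"
    using n by (simp add: field_simps)
  finally show ?thesis .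
qed

end

section \<open>Almost sure convergence for Wigner matrices\<close>

text \<open>Borel-Cantelli for each threshold 1/(k + 1), followed by a countable intersection over
  k.\<close>

lemma (in prob_space) AE_tendsto_0_if_summable_tails:
  fixes Y :: "nat \<Rightarrow> 'a \<Rightarrow> real"
  assumes [measurable]: "\<And>n. Y n \<in> borel_measurable M"
    and sum: "\<And>\<epsilon>. \<epsilon> > 0 \<Longrightarrow> summable (\<lambda>n. measure M {\<omega> \<in> space M. \<epsilon> \<le> \<bar>Y n \<omega>\<bar>})"
  shows "AE \<omega> in M. (\<lambda>n. Y n \<omega>) \<longlonglongrightarrow> 0"
proof -
  have "AE \<omega> in M. \<forall>\<^sub>F n in sequentially. \<omega> \<in> space M - {\<omega> \<in> space M. 1 / real (Suc k) \<le> \<bar>Y n \<omega>\<bar>}" for k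
    by (rule borel_cantelli_AE1) (use sum in \<open>auto simp: emeasure_eq_measure\<close>)
  then have "AE \<omega> in M. \<forall>k. \<forall>\<^sub>F n in sequentially.
      \<omega> \<in> space M - {\<omega> \<in> space M. 1 / real (Suc k) \<le> \<bar>Y n \<omega>\<bar>}"
    by (simp add: AE_all_countable)
  then show ?thesis
  proof eventually_elim
    case (elim \<omega>)
    show ?case
    proof (rule tendstoI)
      fix e :: real assume "e > 0"
      then obtain k where k: "1 / real (Suc k) < e" by (rule nat_approx_posE)
      show "\<forall>\<^sub>F n in sequentially. dist (Y n \<omega>) 0 < e"
        using elim[rule_format, of k] by eventually_elim (use k in auto)
    qed
  qed
qed

text \<open>Subtracting the equation for m leaves (e n - m)(v (e n + m) + z), and the second factor
  has imaginary part at least \<open>Im z\<close> because both points lie in the closed upper half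
  plane. This selects the correct root without following it in z.\<close>

lemma semicircle_root_stable:
  fixes e :: "nat \<Rightarrow> complex"
  assumes v: "v \<ge> 0" and z: "Im z > 0" and m: "of_real v * m\<^sup>2 + z * m + 1 = 0" "Im m > 0"
    and e: "\<And>n. Im (e n) \<ge> 0" and lim: "(\<lambda>n. of_real v * (e n)\<^sup>2 + z * e n + 1) \<longlonglongrightarrow> 0"
  shows "e \<longlonglongrightarrow> m"
proof -
  define q where "q = (\<lambda>n. of_real v * (e n)\<^sup>2 + z * e n + 1)"
  have bd: "cmod (e n - m) \<le> cmod (q n) / Im z" for n
  proof -
    have "q n = q n - (of_real v * m\<^sup>2 + z * m + 1)" using m by simp
    also have "\<dots> = (e n - m) * (of_real v * (e n + m) + z)"
      by (simp add: q_def algebra_simps power2_eq_square)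
    finally have "cmod (q n) = cmod (e n - m) * cmod (of_real v * (e n + m) + z)"
      by (simp add: norm_mult)
    moreover have "Im z \<le> Im (of_real v * (e n + m) + z)" using v e[of n] m by simp
    moreover have "\<dots> \<le> cmod (of_real v * (e n + m) + z)"
      by (metis abs_Im_le_cmod abs_le_D1)
    ultimately have "cmod (e n - m) * Im z \<le> cmod (q n)"
      by (simp add: mult_left_mono)
    then show ?thesis using z by (simp add: field_simps)
  qed
  have "(\<lambda>n. cmod (q n) / Im z) \<longlonglongrightarrow> cmod 0 / Im z"
    using lim z by (intro tendsto_intros) (auto simp: q_def)
  then have lim0: "(\<lambda>n. cmod (q n) / Im z) \<longlonglongrightarrow> 0" by simp
  have "\<forall>\<^sub>F n in sequentially. norm (e n - m) \<le> cmod (q n) / Im z"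
    using bd by (intro always_eventually allI)
  then have "(\<lambda>n. e n - m) \<longlonglongrightarrow> 0" using lim0 by (rule Lim_null_comparison)
  then show ?thesis by (simp add: LIM_zero_iff)
qed

context centered_entries
begin

text \<open>The row from the diagonal on, so that the blocks partition the upper triangle; a change
  inside one of them affects only row and column i of the symmetric matrix.\<close>

definition row_indices :: "nat \<Rightarrow> nat \<Rightarrow> (nat \<times> nat) set" where
  "row_indices n i = {(i', j). i' = i \<and> i \<le> j \<and> j < n}"

lemma UN_row_indices: "(\<Union>i<n. row_indices n i) = upper_indices n"
  by (auto simp: row_indices_def upper_indices_def)

lemma S_row_change:
  assumes "i < n" and agree: "\<And>p. p \<notin> row_indices n i \<Longrightarrow> x p = y p"
  shows "cmod (S n x - S n y) \<le> 2 / Im z"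
  unfolding S_def
proof (rule resolvent_trace_row_change[OF sym_below_wigner sym_below_wigner Im_z \<open>i < n\<close>])
  fix a b assume "a \<noteq> i" "b \<noteq> i"
  then have "(min a b, max a b) \<notin> row_indices n i" by (auto simp: row_indices_def min_def)
  then show "wigner n y a b = wigner n x a b" using agree by (simp add: wigner_def)
qed

text \<open>\<open>h\<close> stands for \<open>Re\<close> or \<open>Im\<close>, as the bounded
  differences inequality is about real functions. Each of the n rows contributes 2/(n Im z), so the
  squares sum to 4/(n (Im z)^2), and the tail is geometric in n and hence summable.\<close>

lemma S_concentration:
  fixes h :: "complex \<Rightarrow> real"
  assumes n: "n > 0" and \<epsilon>: "\<epsilon> > 0" and h: "bounded_linear h" "\<And>w. \<bar>h w\<bar> \<le> cmod w"
  shows "measure (entries n) {x \<in> space (entries n).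
      \<epsilon> \<le> \<bar>h (S n x / of_nat n) - (\<integral>x. h (S n x / of_nat n) \<partial>entries n)\<bar>}
    \<le> 2 * exp (- (\<epsilon>\<^sup>2 * (Im z)\<^sup>2 / 8)) ^ n"
proof -
  define f where "f = (\<lambda>x. h (S n x / of_nat n))"
  define c where "c = (\<lambda>_ :: nat. 2 / (real n * Im z))"
  have "measure (PiM (\<Union>i<n. row_indices n i) (\<lambda>_. D)) {x \<in> space (PiM (\<Union>i<n. row_indices n i) (\<lambda>_. D)).
      \<epsilon> \<le> \<bar>f x - (\<integral>x. f x \<partial>PiM (\<Union>i<n. row_indices n i) (\<lambda>_. D))\<bar>}
    \<le> 2 * exp (- (\<epsilon>\<^sup>2 / (2 * (4 / (real n * (Im z)\<^sup>2)))))"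
  proof (rule mcdiarmid[where C = "1 / Im z" and c = c])
    show "finite (row_indices n i)" for i
      by (rule finite_subset[OF _ finite_upper_indices[of n]]) (auto simp: row_indices_def upper_indices_def)
    show "disjoint_family_on (row_indices n) {..<n}"
      by (auto simp: disjoint_family_on_def row_indices_def)
    show "f \<in> borel_measurable (PiM (\<Union>i<n. row_indices n i) (\<lambda>_. D))"
      unfolding UN_row_indices f_def
      using borel_measurable_continuous_onI[OF linear_continuous_on[OF h(1)]] measurable_S[of n] by measurable
    show "\<bar>f x\<bar> \<le> 1 / Im z" for x
    proof -
      have "\<bar>f x\<bar> \<le> cmod (S n x) / real n" using h(2)[of "S n x / of_nat n"] by (simp add: f_def norm_divide)
      also have "\<dots> \<le> (real n / Im z) / real n" using S_bound[of n x] by (intro divide_right_mono) auto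
      finally show ?thesis using n by simp
    qed
    show "bounded_differences (PiM (\<Union>i<n. row_indices n i) (\<lambda>_. D)) n (row_indices n) c f"
    proof (rule bounded_differencesI)
      fix i :: nat and x y :: "nat \<times> nat \<Rightarrow> real"
      assume i: "i < n" and agree: "\<And>p. p \<notin> row_indices n i \<Longrightarrow> x p = y p"
      have "f x - f y = h ((S n x - S n y) / of_nat n)"
        unfolding f_def diff_divide_distrib by (rule linear_diff[OF bounded_linear.linear[OF h(1)], symmetric])
      then have "\<bar>f x - f y\<bar> \<le> cmod (S n x - S n y) / real n"
        using h(2)[of "(S n x - S n y) / of_nat n"] by (simp add: norm_divide)
      also have "\<dots> \<le> (2 / Im z) / real n"
        using S_row_change[OF i agree] by (intro divide_right_mono) auto
      finally show "\<bar>f x - f y\<bar> \<le> c i" by (simp add: c_def mult.commute)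
    qed
    show "(\<Sum>i<n. (c i)\<^sup>2) = 4 / (real n * (Im z)\<^sup>2)"
      using n by (simp add: c_def power_divide power_mult_distrib field_simps power2_eq_square)
    show "4 / (real n * (Im z)\<^sup>2) > 0" using n Im_z by simp
  qed (use \<epsilon> prob_space_axioms in auto)
  also have "- (\<epsilon>\<^sup>2 / (2 * (4 / (real n * (Im z)\<^sup>2)))) = real n * (- (\<epsilon>\<^sup>2 * (Im z)\<^sup>2 / 8))"
    by (simp add: field_simps)
  also have "exp \<dots> = exp (- (\<epsilon>\<^sup>2 * (Im z)\<^sup>2 / 8)) ^ n" by (rule exp_of_nat_mult)
  finally show ?thesis unfolding UN_row_indices f_def .
qed

lemma wigner_stieltjes_centered:
  fixes M :: "'w measure" and X :: "nat \<times> nat \<Rightarrow> 'w \<Rightarrow> real"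
  assumes M: "prob_space M"
    and indep: "prob_space.indep_vars M (\<lambda>_. borel) X {(i, j). i \<le> j}"
    and distr: "\<And>i j. i \<le> j \<Longrightarrow> distr M borel (X (i, j)) = D"
    and m: "of_real v * m\<^sup>2 + z * m + 1 = 0" "Im m > 0"
  shows "AE \<omega> in M. (\<lambda>n. resolvent_trace n (wigner n (\<lambda>p. X p \<omega>)) z / of_nat n) \<longlonglongrightarrow> m"
proof -
  interpret M: prob_space M by (rule M)
  \<comment> \<open>The upper triangle of size n cut from the infinite array. The matrices of
    different size are nested and dependent, but Borel-Cantelli uses only their individual
    laws.\<close>
  define Xr where "Xr = (\<lambda>n \<omega>. \<lambda>p\<in>upper_indices n. X p \<omega>)"
  have rv: "X p \<in> borel_measurable M" if "p \<in> upper_indices n" for p n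
    using indep that unfolding M.indep_vars_def by (auto simp: upper_indices_def)
  have sets_entries: "sets (entries n) = sets (PiM (upper_indices n) (\<lambda>_. borel))" for n
    by (intro sets_PiM_cong refl sets_D)
  have Xr_meas: "Xr n \<in> measurable M (entries n)" for n
    unfolding Xr_def measurable_cong_sets[OF refl sets_entries]
    by (intro measurable_restrict rv)
  have law: "distr M (entries n) (Xr n) = entries n" if n: "n > 0" for n
  proof -
    have ne: "upper_indices n \<noteq> {}" using min_max_in_upper_indices[of 0 n 0] n by blast
    have "M.indep_vars (\<lambda>_. borel) X (upper_indices n)"
      by (rule M.indep_vars_subset[OF indep]) (auto simp: upper_indices_def)
    then have "distr M (PiM (upper_indices n) (\<lambda>_. borel)) (Xr n) =
        PiM (upper_indices n) (\<lambda>p. distr M borel (X p))"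
      unfolding Xr_def using M.indep_vars_iff_distr_eq_PiM'[where M' = "\<lambda>_. borel" and X = X, OF ne]
        rv[of _ n] by blast
    also have "\<dots> = entries n"
      by (intro PiM_cong refl) (auto simp: upper_indices_def distr)
    finally show ?thesis
      using distr_cong[OF refl sets_entries, of M "Xr n" "Xr n" n] by simp
  qed
  define s where "s = (\<lambda>n \<omega>. S n (Xr n \<omega>) / of_nat n)"
  define e where "e = (\<lambda>n. \<integral>x. S n x / of_nat n \<partial>entries n)"
  have s_meas: "s n \<in> borel_measurable M" for n
    unfolding s_def using measurable_compose[OF Xr_meas measurable_S] by measurable
  have s_eq: "s n \<omega> = resolvent_trace n (wigner n (\<lambda>p. X p \<omega>)) z / of_nat n" for n \<omega>
  proof -
    have "resolvent_trace n (wigner n (Xr n \<omega>)) z = resolvent_trace n (wigner n (\<lambda>p. X p \<omega>)) z"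
      by (intro resolvent_trace_cong wigner_cong) (auto simp: Xr_def)
    then show ?thesis by (simp add: s_def S_def)
  qed
  have Sn_bound: "cmod (S n x / of_nat n) \<le> 1 / Im z" for n x
    using S_bound[of n x] Im_z by (cases "n = 0") (auto simp: norm_divide field_simps)
  have conc: "AE \<omega> in M. (\<lambda>n. h (s n \<omega>) - (\<integral>x. h (S n x / of_nat n) \<partial>entries n)) \<longlonglongrightarrow> 0"
    if h: "bounded_linear h" "\<And>w. \<bar>h w\<bar> \<le> cmod w" for h :: "complex \<Rightarrow> real"
  proof (rule M.AE_tendsto_0_if_summable_tails)
    have h_meas: "h \<in> borel_measurable borel"
      using borel_measurable_continuous_onI[OF linear_continuous_on[OF h(1)]] .
    show "(\<lambda>\<omega>. h (s n \<omega>) - (\<integral>x. h (S n x / of_nat n) \<partial>entries n)) \<in> borel_measurable M" for n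
      using measurable_compose[OF s_meas h_meas] by measurable
    fix \<epsilon> :: real assume \<epsilon>: "\<epsilon> > 0"
    define c where "c = exp (- (\<epsilon>\<^sup>2 * (Im z)\<^sup>2 / 8))"
    have "\<epsilon>\<^sup>2 * (Im z)\<^sup>2 > 0" using \<epsilon> Im_z by simp
    then have c: "0 < c" "c < 1" by (auto simp: c_def)
    show "summable (\<lambda>n. measure M {\<omega> \<in> space M. \<epsilon> \<le> \<bar>h (s n \<omega>) - (\<integral>x. h (S n x / of_nat n) \<partial>entries n)\<bar>})"
    \<comment> \<open>The bound starts at n = 1, since the law of \<open>Xr n\<close> is identified
      only for a nonempty index set.\<close>
    proof (rule summable_comparison_test'[where N = 1 and g = "\<lambda>n. 2 * c ^ n"])
      show "summable (\<lambda>n. 2 * c ^ n)" using c by (intro summable_mult summable_geometric) auto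
      fix n :: nat assume "n \<ge> 1"
      then have n: "n > 0" by simp
      let ?A = "{x \<in> space (entries n). \<epsilon> \<le> \<bar>h (S n x / of_nat n) - (\<integral>x. h (S n x / of_nat n) \<partial>entries n)\<bar>}"
      have "?A \<in> sets (entries n)"
        using measurable_compose[OF _ h_meas, of "\<lambda>x. S n x / of_nat n" "entries n"] measurable_S[of n]
        by measurable
      then have "measure (distr M (entries n) (Xr n)) ?A = measure M (Xr n -` ?A \<inter> space M)"
        by (rule measure_distr[OF Xr_meas])
      also have "Xr n -` ?A \<inter> space M =
          {\<omega> \<in> space M. \<epsilon> \<le> \<bar>h (s n \<omega>) - (\<integral>x. h (S n x / of_nat n) \<partial>entries n)\<bar>}"
        using measurable_space[OF Xr_meas] by (auto simp: s_def)
      finally have "measure M {\<omega> \<in> space M. \<epsilon> \<le> \<bar>h (s n \<omega>) - (\<integral>x. h (S n x / of_nat n) \<partial>entries n)\<bar>} =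
          measure (entries n) ?A" unfolding law[OF n] by simp
      also have "\<dots> \<le> 2 * c ^ n" unfolding c_def by (rule S_concentration[OF n \<epsilon> h])
      finally show "norm (measure M {\<omega> \<in> space M. \<epsilon> \<le> \<bar>h (s n \<omega>) -
          (\<integral>x. h (S n x / of_nat n) \<partial>entries n)\<bar>}) \<le> 2 * c ^ n" by simp
    qed
  qed
  have int_Sn: "integrable (entries n) (\<lambda>x. S n x / of_nat n)" for n
    using integrable_S(1) by (intro integrable_divide) auto
  have "AE \<omega> in M. (\<lambda>n. Re (s n \<omega>) - Re (e n)) \<longlonglongrightarrow> 0"
    using conc[OF bounded_linear_Re abs_Re_le_cmod] by (simp only: e_def integral_Re[OF int_Sn])
  moreover have "AE \<omega> in M. (\<lambda>n. Im (s n \<omega>) - Im (e n)) \<longlonglongrightarrow> 0"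
    using conc[OF bounded_linear_Im abs_Im_le_cmod] by (simp only: e_def integral_Im[OF int_Sn])
  ultimately have conv: "AE \<omega> in M. (\<lambda>n. s n \<omega> - e n) \<longlonglongrightarrow> 0"
    by eventually_elim (simp add: tendsto_complex_iff)
  have s_bd: "cmod (s n \<omega>) \<le> 1 / Im z" for n \<omega> unfolding s_def by (rule Sn_bound)
  have s_int: "integrable M (s n)" "integrable M (\<lambda>\<omega>. (s n \<omega>)\<^sup>2)" for n
  proof -
    show "integrable M (s n)"
      using s_bd s_meas by (intro M.integrable_const_bound[where B = "1 / Im z"]) auto
    show "integrable M (\<lambda>\<omega>. (s n \<omega>)\<^sup>2)"
    proof (rule M.integrable_const_bound[where B = "(1 / Im z)\<^sup>2"])
      show "AE \<omega> in M. cmod ((s n \<omega>)\<^sup>2) \<le> (1 / Im z)\<^sup>2"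
        by (intro AE_I2, simp only: norm_power, intro power_mono s_bd norm_ge_zero)
    qed (use s_meas in measurable)
  qed
  have e_eq: "(\<integral>\<omega>. s n \<omega> \<partial>M) = e n" if "n > 0" for n
    unfolding s_def e_def using integral_distr[OF Xr_meas, of "\<lambda>x. S n x / of_nat n" n] measurable_S[of n] law[OF that]
    by auto
  have e2_eq: "(\<integral>\<omega>. (s n \<omega>)\<^sup>2 \<partial>M) = (\<integral>x. (S n x / of_nat n)\<^sup>2 \<partial>entries n)" if "n > 0" for n
    unfolding s_def using integral_distr[OF Xr_meas, of "\<lambda>x. (S n x / of_nat n)\<^sup>2" n] measurable_S[of n] law[OF that]
    by auto
  have e_bd: "cmod (e n) \<le> 1 / Im z" for n
  proof -
    interpret P: prob_space "entries n" by (rule prob_space_entries)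
    have "cmod (e n) \<le> (\<integral>x. cmod (S n x / of_nat n) \<partial>entries n)"
      unfolding e_def by (rule integral_norm_bound)
    also have "\<dots> \<le> 1 / Im z"
      using Sn_bound int_Sn by (intro P.integral_le_const) auto
    finally show ?thesis .
  qed
  \<comment> \<open>The square is complex, without modulus, so that its mean is exactly E[s^2] - (E
    s)^2. Boundedness turns almost sure convergence into convergence of this mean.\<close>
  have "(\<lambda>n. \<integral>\<omega>. (s n \<omega> - e n)\<^sup>2 \<partial>M) \<longlonglongrightarrow> (\<integral>\<omega>. 0 \<partial>M)"
  proof (rule integral_dominated_convergence[where w = "\<lambda>_. (1 / Im z + 1 / Im z)\<^sup>2"])
    show "AE \<omega> in M. (\<lambda>n. (s n \<omega> - e n)\<^sup>2) \<longlonglongrightarrow> 0"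
      using conv
    proof eventually_elim
      case (elim \<omega>)
      from tendsto_power[OF elim, of 2] show ?case by simp
    qed
    show "AE \<omega> in M. cmod ((s n \<omega> - e n)\<^sup>2) \<le> (1 / Im z + 1 / Im z)\<^sup>2" for n
    proof (rule AE_I2)
      fix \<omega>
      have "cmod (s n \<omega> - e n) \<le> 1 / Im z + 1 / Im z"
        using norm_triangle_ineq4[of "s n \<omega>" "e n"] s_bd[of n \<omega>] e_bd[of n] by linarith
      then show "cmod ((s n \<omega> - e n)\<^sup>2) \<le> (1 / Im z + 1 / Im z)\<^sup>2"
        by (simp only: norm_power) (intro power_mono norm_ge_zero)
    qed
    show "(\<lambda>\<omega>. (s n \<omega> - e n)\<^sup>2) \<in> borel_measurable M" for n using s_meas[of n] by measurable
  qed auto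
  then have var: "(\<lambda>n. \<integral>\<omega>. (s n \<omega> - e n)\<^sup>2 \<partial>M) \<longlonglongrightarrow> 0" by simp
  have var_eq: "(\<integral>\<omega>. (s n \<omega> - e n)\<^sup>2 \<partial>M) = (\<integral>x. (S n x / of_nat n)\<^sup>2 \<partial>entries n) - (e n)\<^sup>2" if n: "n > 0" for n
  proof -
    have "(\<integral>\<omega>. (s n \<omega> - e n)\<^sup>2 \<partial>M) = (\<integral>\<omega>. (s n \<omega>)\<^sup>2 - 2 * e n * s n \<omega> + (e n)\<^sup>2 \<partial>M)"
      by (intro Bochner_Integration.integral_cong refl) (simp add: power2_eq_square algebra_simps)
    also have "\<dots> = (\<integral>\<omega>. (s n \<omega>)\<^sup>2 \<partial>M) - 2 * e n * (\<integral>\<omega>. s n \<omega> \<partial>M) + (e n)\<^sup>2"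
      using s_int[of n] by (simp add: M.prob_space)
    also have "\<dots> = (\<integral>x. (S n x / of_nat n)\<^sup>2 \<partial>entries n) - (e n)\<^sup>2"
      unfolding e_eq[OF n] e2_eq[OF n] by (simp add: power2_eq_square)
    finally show ?thesis .
  qed
  define r where "r = (\<lambda>n. of_real v * (\<integral>x. (S n x / of_nat n)\<^sup>2 \<partial>entries n) + z * e n + 1)"
  have r: "r \<longlonglongrightarrow> 0"
  proof (rule Lim_null_comparison)
    show "\<forall>\<^sub>F n in sequentially. norm (r n) \<le> loop_const * truncated_moment D v n + v / (real n * (Im z)\<^sup>2)"
      using eventually_gt_at_top[of 0] unfolding r_def e_def
      by eventually_elim (rule loop_equation)
    have "truncated_moment D v \<longlonglongrightarrow> 0"
      by (intro truncated_moment_tendsto_0 prob_space_axioms sets_D square_integrable v_nonneg)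
    moreover have "(\<lambda>n. v / (Im z)\<^sup>2 * (1 / real n)) \<longlonglongrightarrow> v / (Im z)\<^sup>2 * 0"
      by (intro tendsto_mult tendsto_const lim_1_over_n)
    ultimately have "(\<lambda>n. loop_const * truncated_moment D v n + v / (Im z)\<^sup>2 * (1 / real n)) \<longlonglongrightarrow> loop_const * 0 + v / (Im z)\<^sup>2 * 0"
      by (intro tendsto_add tendsto_mult tendsto_const lim_1_over_n)
    then show "(\<lambda>n. loop_const * truncated_moment D v n + v / (real n * (Im z)\<^sup>2)) \<longlonglongrightarrow> 0"
      by (simp add: mult.commute)
  qed
  \<comment> \<open>Replacing E[s^2] by (E s)^2 leaves an approximate quadratic equation for
    \<open>e n\<close> alone.\<close>
  have "(\<lambda>n. r n - of_real v * (\<integral>\<omega>. (s n \<omega> - e n)\<^sup>2 \<partial>M)) \<longlonglongrightarrow> 0 - of_real v * 0"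
    using r var by (intro tendsto_intros)
  moreover have "\<forall>\<^sub>F n in sequentially. r n - of_real v * (\<integral>\<omega>. (s n \<omega> - e n)\<^sup>2 \<partial>M) =
      of_real v * (e n)\<^sup>2 + z * e n + 1"
    using eventually_gt_at_top[of 0] by eventually_elim (simp add: var_eq r_def algebra_simps)
  ultimately have lim: "(\<lambda>n. of_real v * (e n)\<^sup>2 + z * e n + 1) \<longlonglongrightarrow> 0"
    by (simp add: tendsto_cong)
  have "Im (e n) \<ge> 0" for n
  proof -
    have "Im (e n) = (\<integral>x. Im (S n x / of_nat n) \<partial>entries n)"
      by (simp only: e_def integral_Im[OF int_Sn])
    also have "\<dots> \<ge> 0"
      using resolvent_trace_Im_nonneg[OF sym_below_wigner Im_z, of n]
      by (intro integral_nonneg_AE AE_I2) (simp add: S_def Im_divide_of_nat)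
    finally show ?thesis .
  qed
  then have "e \<longlonglongrightarrow> m" by (intro semicircle_root_stable[OF v_nonneg Im_z m _ lim])
  from conv show ?thesis
  proof eventually_elim
    case (elim \<omega>)
    from tendsto_add[OF elim \<open>e \<longlonglongrightarrow> m\<close>] show ?case by (simp add: s_eq)
  qed
qed

end

theorem wigner_stieltjes:
  fixes M :: "'w measure" and X :: "nat \<times> nat \<Rightarrow> 'w \<Rightarrow> real" and D :: "real measure"
  assumes M: "prob_space M"
    and indep: "prob_space.indep_vars M (\<lambda>_. borel) X {(i, j). i \<le> j}"
    and distr: "\<And>i j. i \<le> j \<Longrightarrow> distr M borel (X (i, j)) = D"
    and int: "integrable D (\<lambda>x. x\<^sup>2)" and var: "(\<integral>x. (x - (\<integral>y. y \<partial>D))\<^sup>2 \<partial>D) = v"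
    and z: "Im z > 0" and m: "of_real v * m\<^sup>2 + z * m + 1 = 0" "Im m > 0"
  shows "AE \<omega> in M. (\<lambda>n. resolvent_trace n (wigner n (\<lambda>p. X p \<omega>)) z / of_nat n) \<longlonglongrightarrow> m"
proof -
  interpret M: prob_space M by (rule M)
  have rv: "X (i, j) \<in> borel_measurable M" if "i \<le> j" for i j
    using indep that unfolding M.indep_vars_def by auto
  have D: "prob_space D" using M.prob_space_distr[OF rv[of 0 0]] distr[of 0 0] by simp
  have sets_D [measurable_cong]: "sets D = sets borel" using distr[of 0 0] by (metis order_refl sets_distr)
  interpret D: prob_space D by (rule D)
  define c where "c = (\<integral>y. y \<partial>D)"
  define D' where "D' = distr D borel (\<lambda>x. x - c)"
  have shift [measurable]: "(\<lambda>x. x - c) \<in> measurable D borel" by measurable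
  have int1: "integrable D (\<lambda>x. x)"
    by (rule D.square_integrable_imp_integrable[OF _ int]) measurable
  interpret centered_entries D' v z
  proof (unfold centered_entries_def centered_entries_axioms_def, intro conjI)
    show "prob_space D'" unfolding D'_def by (rule D.prob_space_distr[OF shift])
    show "sets D' = sets borel" by (simp add: D'_def)
    have "integrable D (\<lambda>x. x\<^sup>2 - 2 * c * x + c\<^sup>2)" using int int1 by simp
    moreover have "(\<lambda>x. x\<^sup>2 - 2 * c * x + c\<^sup>2) = (\<lambda>x. (x - c)\<^sup>2)"
      by (auto simp: power2_eq_square algebra_simps)
    ultimately show "integrable D' (\<lambda>x. x\<^sup>2)"
      unfolding D'_def by (subst integrable_distr_eq) auto
    have "(\<integral>x. x \<partial>D') = (\<integral>x. x - c \<partial>D)"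
      unfolding D'_def by (rule integral_distr[OF shift]) simp
    also have "\<dots> = (\<integral>x. x \<partial>D) - (\<integral>x. c \<partial>D)"
      using int1 by (intro Bochner_Integration.integral_diff) auto
    finally show "(\<integral>x. x \<partial>D') = 0" using D.prob_space by (simp add: c_def)
    have "(\<integral>x. x\<^sup>2 \<partial>D') = (\<integral>x. (x - c)\<^sup>2 \<partial>D)"
      unfolding D'_def by (rule integral_distr[OF shift]) simp
    then show "(\<integral>x. x\<^sup>2 \<partial>D') = v" unfolding c_def var .
  qed (rule z)
  define X' where "X' = (\<lambda>p \<omega>. X p \<omega> - c)"
  have "AE \<omega> in M. (\<lambda>n. resolvent_trace n (wigner n (\<lambda>p. X' p \<omega>)) z / of_nat n) \<longlonglongrightarrow> m"
  proof (rule wigner_stieltjes_centered[OF M _ _ m])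
    show "M.indep_vars (\<lambda>_. borel) X' {(i, j). i \<le> j}"
      unfolding X'_def by (rule M.indep_vars_compose2[OF indep, where Y = "\<lambda>_ x. x - c"]) measurable
    fix i j :: nat assume "i \<le> j"
    have "distr M borel (X' (i, j)) = distr (distr M borel (X (i, j))) borel (\<lambda>x. x - c)"
      unfolding X'_def using rv[OF \<open>i \<le> j\<close>] by (subst distr_distr) (auto simp: o_def)
    then show "distr M borel (X' (i, j)) = D'" by (simp add: distr[OF \<open>i \<le> j\<close>] D'_def)
  qed
  then show ?thesis
  proof eventually_elim
    case (elim \<omega>)
    define d where "d = (\<lambda>n. resolvent_trace n (wigner n (\<lambda>p. X p \<omega>)) z / of_nat n -
      resolvent_trace n (wigner n (\<lambda>p. X' p \<omega>)) z / of_nat n)"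
    have "cmod (d n) \<le> 1 / Im z * (1 / real n)" for n
    proof -
      \<comment> \<open>The diagonal has the same mean as the other entries, so the mean matrix is
        exactly c / sqrt n times the all-ones matrix.\<close>
      have "wigner n (\<lambda>p. X p \<omega>) = (\<lambda>a b. wigner n (\<lambda>p. X' p \<omega>) a b + c / sqrt (real n) * 1 * 1)"
        by (intro ext) (simp add: wigner_def X'_def diff_divide_distrib)
      then have "cmod (resolvent_trace n (wigner n (\<lambda>p. X p \<omega>)) z - resolvent_trace n (wigner n (\<lambda>p. X' p \<omega>)) z)
          \<le> 1 / Im z"
        using resolvent_trace_rank_one[OF sym_below_wigner z, of n "\<lambda>p. X' p \<omega>" "c / sqrt (real n)" "\<lambda>_. 1"] by simp
      then have "cmod (d n) \<le> (1 / Im z) / real n"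
        unfolding d_def diff_divide_distrib[symmetric] norm_divide norm_of_nat by (intro divide_right_mono) auto
      then show ?thesis by simp
    qed
    moreover have "(\<lambda>n. 1 / Im z * (1 / real n)) \<longlonglongrightarrow> 1 / Im z * 0"
      by (intro tendsto_mult tendsto_const lim_1_over_n)
    ultimately have "d \<longlonglongrightarrow> 0"
      by (intro Lim_null_comparison[of d "\<lambda>n. 1 / Im z * (1 / real n)"]) auto
    from tendsto_add[OF this elim] show ?case by (simp add: d_def)
  qed
qed

section \<open>Diagonalisation of the circulant blocks\<close>

definition unity_root :: "nat \<Rightarrow> nat \<Rightarrow> complex" where
  "unity_root k x = cis (2 * pi * real x / real k)"

lemma unity_root_add: "unity_root k (x + y) = unity_root k x * unity_root k y"
  by (simp add: unity_root_def cis_mult add_divide_distrib ring_distribs)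

lemma unity_root_0 [simp]: "unity_root k 0 = 1"
  by (simp add: unity_root_def)

lemma unity_root_mult: "unity_root k (m * x) = unity_root k x ^ m"
  by (induction m) (simp_all add: unity_root_add)

lemma unity_root_self: "k > 0 \<Longrightarrow> unity_root k k = 1"
  by (simp add: unity_root_def)

lemma unity_root_mod: "k > 0 \<Longrightarrow> unity_root k (x mod k) = unity_root k x"
proof -
  assume k: "k > 0"
  have "unity_root k x = unity_root k (x div k * k + x mod k)" by simp
  also have "\<dots> = unity_root k (x mod k)"
    unfolding unity_root_add unity_root_mult unity_root_self[OF k] by simp
  finally show ?thesis by simp
qed

lemma unity_root_cong: "k > 0 \<Longrightarrow> x mod k = y mod k \<Longrightarrow> unity_root k x = unity_root k y"
  by (metis unity_root_mod)

lemma unity_root_cnj_mult [simp]: "unity_root k x * cnj (unity_root k x) = 1"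
  by (simp add: unity_root_def cis_cnj cis_mult)

text \<open>Summation is over the frequency at fixed positions, which is the inversion formula of
  the transform. For distinct positions the sum is geometric with a ratio different from 1 whose
  k-th power is 1.\<close>

lemma unity_root_orthogonal:
  assumes xy: "x < k" "y < k"
  shows "(\<Sum>m<k. unity_root k (m * x) * cnj (unity_root k (m * y))) = (if x = y then of_nat k else 0)"
proof -
  have k: "k > 0" using xy by simp
  define \<zeta> where "\<zeta> = unity_root k x * cnj (unity_root k y)"
  have sum: "(\<Sum>m<k. unity_root k (m * x) * cnj (unity_root k (m * y))) = (\<Sum>m<k. \<zeta> ^ m)"
    by (simp add: unity_root_mult \<zeta>_def power_mult_distrib)
  show ?thesis
  proof (cases "x = y")
    case True
    then show ?thesis unfolding sum by (simp add: \<zeta>_def)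
  next
    case False
    have "\<zeta> \<noteq> 1"
    proof
      assume "\<zeta> = 1"
      then have "\<zeta> * unity_root k y = unity_root k y" by simp
      then have "unity_root k x = unity_root k y"
        by (simp add: \<zeta>_def mult.assoc mult.commute[of "cnj _"])
      moreover have "inj_on (\<lambda>j. cis (2 * pi * real j / real k)) {..<k}"
        using Complex.bij_betw_roots_unity[OF k] by (rule bij_betw_imp_inj_on)
      ultimately show False using False xy by (auto simp: unity_root_def inj_on_def)
    qed
    moreover have "\<zeta> ^ k = 1"
      using unity_root_mult[of k k x] unity_root_mult[of k k y] unity_root_mult[of k x k] unity_root_mult[of k y k]
      by (simp add: \<zeta>_def power_mult_distrib unity_root_self[OF k] mult.commute flip: complex_cnj_power)
    ultimately have "(\<Sum>m<k. \<zeta> ^ m) = 0"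
      using geometric_sum[of \<zeta> k] by simp
    then show ?thesis using False sum by simp
  qed
qed

text \<open>The number of the variable at cyclic offset d, column minus row; d and k - d carry the
  same one. Offsets count from 0, variables from 1.\<close>

definition circ_index :: "nat \<Rightarrow> nat \<Rightarrow> nat" where
  "circ_index k d = (if d \<le> k div 2 then d else k - d) + 1"

lemma circ_index_range: "d < k \<Longrightarrow> circ_index k d \<in> {1..k div 2 + 1}"
  by (auto simp: circ_index_def)

text \<open>The reflection is written (k - d) mod k so that it sends 0 to 0; its fixed points are 0
  and, for even k, k/2.\<close>

lemma circ_index_eq_iff:
  assumes "d < k" "d' < k"
  shows "circ_index k d' = circ_index k d \<longleftrightarrow> d' = d \<or> d' = (k - d) mod k"
proof (cases "d = 0")
  case True
  then show ?thesis using assms by (auto simp: circ_index_def split: if_splits)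
next
  case False
  then have "(k - d) mod k = k - d" using assms by simp
  then show ?thesis using assms False by (simp add: circ_index_def) linarith
qed

lemma sym_circulant_index:
  assumes "r < k" "t < k"
  shows "sym_circulant k b $$ (r, t) = b (circ_index k ((t + k - r) mod k)) / sqrt (real k)"
proof -
  define d where "d = (t + k - r) mod k"
  have d: "d < k" using assms by (simp add: d_def)
  have "(if d + 1 \<le> k div 2 + 1 then b (d + 1) else b (k - (d + 1) + 2)) = b (circ_index k d)"
    using d by (auto simp: circ_index_def intro!: arg_cong[where f = b])
  moreover have "sym_circulant k b $$ (r, t) =
      1 / sqrt (real k) * (if d + 1 \<le> k div 2 + 1 then b (d + 1) else b (k - (d + 1) + 2))"
    using assms unfolding sym_circulant_def circulant_def d_def by simp
  ultimately show ?thesis by (simp only: d_def) simp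
qed

lemma sym_circulant_cong:
  assumes "\<And>l. 1 \<le> l \<Longrightarrow> l \<le> k div 2 + 1 \<Longrightarrow> b l = b' l" "r < k" "t < k"
  shows "sym_circulant k b $$ (r, t) = sym_circulant k b' $$ (r, t)"
proof -
  have "(t + k - r) mod k < k" using assms by simp
  from circ_index_range[OF this] show ?thesis
    unfolding sym_circulant_index[OF assms(2,3)] using assms(1) by simp
qed

text \<open>The eigenvalue of a block on the Fourier vector of frequency m. Sines are absent because
  they cancel under the reflection of the offset.\<close>

definition circ_eigenvalue :: "nat \<Rightarrow> nat \<Rightarrow> (nat \<Rightarrow> real) \<Rightarrow> real" where
  "circ_eigenvalue k m b = (\<Sum>d<k. cos (2 * pi * real (m * d) / real k) / sqrt (real k) * b (circ_index k d))"

lemma sum_reflect_mod: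
  fixes f :: "nat \<Rightarrow> 'a :: comm_monoid_add"
  assumes "k > 0"
  shows "(\<Sum>d<k. f ((k - d) mod k)) = (\<Sum>d<k. f d)"
proof (rule sum.reindex_bij_witness[where i = "\<lambda>d. (k - d) mod k" and j = "\<lambda>d. (k - d) mod k"])
  fix d assume d: "d \<in> {..<k}"
  show "(k - (k - d) mod k) mod k = d"
    using d by (cases "d = 0") auto
  then show "(k - (k - d) mod k) mod k = d" .
qed (use assms in auto)

lemma sum_shift_mod:
  fixes f :: "nat \<Rightarrow> 'a :: comm_monoid_add"
  assumes r: "r < k"
  shows "(\<Sum>t<k. f ((t + k - r) mod k)) = (\<Sum>d<k. f d)"
proof (rule sum.reindex_bij_witness[where i = "\<lambda>d. (d + r) mod k" and j = "\<lambda>t. (t + k - r) mod k"])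
  fix t assume t: "t \<in> {..<k}"
  have "((t + k - r) mod k + r) mod k = (t + k - r + r) mod k" by (rule mod_add_left_eq)
  then show "((t + k - r) mod k + r) mod k = t" using r t by simp
next
  fix d assume d: "d \<in> {..<k}"
  show "((d + r) mod k + k - r) mod k = d"
  proof (cases "d + r < k")
    case True
    then show ?thesis using d by simp
  next
    case False
    then have "(d + r) mod k = d + r - k" using r d by (simp add: le_mod_geq)
    then show ?thesis using d False by simp
  qed
qed (use r in auto)

lemma Re_unity_root: "Re (unity_root k x) = cos (2 * pi * real x / real k)"
  and Im_unity_root: "Im (unity_root k x) = sin (2 * pi * real x / real k)"
  by (simp_all add: unity_root_def)

lemma unity_root_reflect:
  assumes "k > 0" "d < k"
  shows "unity_root k (m * ((k - d) mod k)) = cnj (unity_root k (m * d))"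
proof -
  have "unity_root k ((k - d) mod k) * unity_root k d = unity_root k ((k - d) mod k + d)"
    by (simp add: unity_root_add)
  also have "\<dots> = unity_root k 0"
    using assms by (intro unity_root_cong) (auto simp: mod_add_left_eq)
  finally have inv: "unity_root k ((k - d) mod k) * unity_root k d = 1" by simp
  have "unity_root k ((k - d) mod k) = unity_root k ((k - d) mod k) * (unity_root k d * cnj (unity_root k d))"
    by simp
  also have "\<dots> = cnj (unity_root k d)"
    by (simp only: inv mult.assoc[symmetric] mult_1_left)
  finally show ?thesis by (simp add: unity_root_mult)
qed

lemma circ_index_reflect:
  assumes "d < k"
  shows "circ_index k ((k - d) mod k) = circ_index k d"
  using circ_index_eq_iff[of d k "(k - d) mod k"] assms by simp

text \<open>The reflection of the offset maps the sum to its complex conjugate, so it equals its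
  real part.\<close>

lemma circ_eigenvalue_complex:
  assumes k: "k > 0"
  shows "(\<Sum>d<k. of_real (b (circ_index k d) / sqrt (real k)) * unity_root k (m * d)) =
    of_real (circ_eigenvalue k m b)"
proof -
  define s where "s = (\<Sum>d<k. of_real (b (circ_index k d) / sqrt (real k)) * unity_root k (m * d))"
  have "s = (\<Sum>d<k. of_real (b (circ_index k ((k - d) mod k)) / sqrt (real k)) *
      unity_root k (m * ((k - d) mod k)))"
    unfolding s_def by (rule sum_reflect_mod[OF k, symmetric])
  also have "\<dots> = (\<Sum>d<k. of_real (b (circ_index k d) / sqrt (real k)) * cnj (unity_root k (m * d)))"
    using k by (intro sum.cong refl) (simp add: circ_index_reflect unity_root_reflect)
  also have "\<dots> = cnj s" by (simp add: s_def)
  finally have "s = of_real (Re s)" by (metis Reals_cnj_iff complex_is_Real_iff complex_eq_iff Re_complex_of_real Im_complex_of_real)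
  moreover have "Re s = circ_eigenvalue k m b"
    by (simp add: s_def circ_eigenvalue_def Re_unity_root mult.commute)
  ultimately show ?thesis unfolding s_def[symmetric] by metis
qed

text \<open>Passing from the column \<open>t\<close> to the offset from row \<open>r\<close> pulls
  out the phase of the row.\<close>

lemma sym_circulant_eigenvector:
  assumes r: "r < k"
  shows "(\<Sum>t<k. of_real (sym_circulant k b $$ (r, t)) * unity_root k (m * t)) =
    of_real (circ_eigenvalue k m b) * unity_root k (m * r)"
proof -
  have k: "k > 0" using r by simp
  define f where "f = (\<lambda>d. of_real (b (circ_index k d) / sqrt (real k)) * unity_root k (m * (d + r)))"
  have "(\<Sum>t<k. of_real (sym_circulant k b $$ (r, t)) * unity_root k (m * t)) =
      (\<Sum>t<k. f ((t + k - r) mod k))"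
  proof (intro sum.cong refl)
    fix t assume t: "t \<in> {..<k}"
    have "(m * t) mod k = (m * ((t + k - r) mod k + r)) mod k"
    proof -
      have "((t + k - r) mod k + r) mod k = t mod k"
        using r by (simp add: mod_add_left_eq)
      then show ?thesis by (metis mod_mult_right_eq)
    qed
    then have "unity_root k (m * t) = unity_root k (m * ((t + k - r) mod k + r))"
      by (rule unity_root_cong[OF k])
    then show "of_real (sym_circulant k b $$ (r, t)) * unity_root k (m * t) = f ((t + k - r) mod k)"
      using r t by (simp add: sym_circulant_index f_def)
  qed
  also have "\<dots> = (\<Sum>d<k. f d)" by (rule sum_shift_mod[OF r])
  also have "\<dots> = (\<Sum>d<k. of_real (b (circ_index k d) / sqrt (real k)) * unity_root k (m * d)) * unity_root k (m * r)"
    unfolding sum_distrib_right by (intro sum.cong refl) (simp add: f_def distrib_left unity_root_add)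
  finally show ?thesis unfolding circ_eigenvalue_complex[OF k] .
qed

lemma sum_div_mod:
  fixes f :: "nat \<Rightarrow> nat \<Rightarrow> 'a :: comm_monoid_add"
  assumes "k > 0"
  shows "(\<Sum>u<k * n. f (u div k) (u mod k)) = (\<Sum>l<n. \<Sum>t<k. f l t)"
proof -
  have "(\<Sum>u<k * n. f (u div k) (u mod k)) = (\<Sum>(l, t)\<in>{..<n} \<times> {..<k}. f l t)"
  proof (rule sum.reindex_bij_witness[where i = "\<lambda>(l, t). l * k + t" and j = "\<lambda>u. (u div k, u mod k)"])
    fix p assume p: "p \<in> {..<n} \<times> {..<k}"
    obtain l t where lt: "p = (l, t)" "l < n" "t < k" using p by auto
    have "l * k + t < Suc l * k" using lt by simp
    also have "\<dots> \<le> n * k" using lt by (intro mult_le_mono1) simp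
    finally show "(case p of (l, t) \<Rightarrow> l * k + t) \<in> {..<k * n}" using lt by (simp add: mult.commute)
    show "((case p of (l, t) \<Rightarrow> l * k + t) div k, (case p of (l, t) \<Rightarrow> l * k + t) mod k) = p"
      using lt by simp
  next
    fix u assume "u \<in> {..<k * n}"
    then show "(u div k, u mod k) \<in> {..<n} \<times> {..<k}"
      using assms by (simp add: less_mult_imp_div_less mult.commute)
  qed auto
  then show ?thesis by (simp add: sum.cartesian_product)
qed

text \<open>The Fourier transform in the block coordinate diagonalises all circulant blocks simultaneously,
  so the resolvent of the block matrix is assembled from those of the \<open>k\<close> Wigner matrices of
  circulant eigenvalues.\<close>

lemma resolvent_trace_block_circulant:
  fixes a :: "nat \<Rightarrow> nat \<Rightarrow> nat \<Rightarrow> real" and n k :: nat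
  defines "H \<equiv> \<lambda>r s. block_circulant n k a $$ (r, s)"
    and "W \<equiv> \<lambda>m. wigner n (\<lambda>p. circ_eigenvalue k m (\<lambda>l. a l (Suc (fst p)) (Suc (snd p))))"
  assumes sym: "\<And>l i j. a l j i = a l i j" and k: "k > 0" and z: "Im z > 0"
  shows "resolvent_trace (k * n) H z = (\<Sum>m<k. resolvent_trace n (W m) z)"
proof -
  have symH: "sym_below (k * n) H"
    unfolding sym_below_def H_def using block_circulant_sym[of a, OF sym] by blast
  have symW: "sym_below n (W m)" for m unfolding W_def by (rule sym_below_wigner)
  define g where "g = (\<lambda>m. resolvent n (W m) z)"
  \<comment> \<open>The candidate for the resolvent: the family \<open>g\<close> transformed back
    from frequencies to positions inside the blocks, with the factor 1/k of the inverse
    transform.\<close>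
  define R where "R = (\<lambda>r s. (\<Sum>m<k. g m (r div k) (s div k) *
    (unity_root k (m * (r mod k)) * cnj (unity_root k (m * (s mod k))))) / of_nat k)"
  have H: "H r u = sym_circulant k (\<lambda>l. a l (Suc (r div k)) (Suc (u div k))) $$ (r mod k, u mod k) / sqrt (real n)"
    if "r < k * n" "u < k * n" for r u
    using that k unfolding H_def block_circulant_def block_matrix_def by simp
  \<comment> \<open>\<open>wigner\<close> reads its entry at (min, max); the symmetry of
    \<open>a\<close> makes this the entry (i, l).\<close>
  have W: "W m i l = circ_eigenvalue k m (\<lambda>x. a x (Suc i) (Suc l)) / sqrt (real n)" for m i l
    using sym by (cases "i \<le> l") (auto simp: W_def wigner_def min_def max_def)
  have eq: "(\<Sum>u<k * n. of_real (H r u) * R u s) - z * R r s = (if r = s then 1 else 0)"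
    if rs: "r < k * n" "s < k * n" for r s
  proof -
    define i \<rho> j \<sigma> where "i = r div k" and "\<rho> = r mod k" and "j = s div k" and "\<sigma> = s mod k"
    have bounds: "i < n" "j < n" "\<rho> < k" "\<sigma> < k"
      using rs k by (auto simp: i_def j_def \<rho>_def \<sigma>_def less_mult_imp_div_less mult.commute)
    define C where "C = (\<lambda>l t. complex_of_real (sym_circulant k (\<lambda>x. a x (Suc i) (Suc l)) $$ (\<rho>, t)))"
    have "(\<Sum>u<k * n. of_real (H r u) * R u s) =
        (\<Sum>u<k * n. C (u div k) (u mod k) / of_real (sqrt (real n)) *
          ((\<Sum>m<k. g m (u div k) j * (unity_root k (m * (u mod k)) * cnj (unity_root k (m * \<sigma>)))) / of_nat k))"
      using rs by (intro sum.cong refl) (simp add: H C_def R_def i_def j_def \<rho>_def \<sigma>_def)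
    also have "\<dots> = (\<Sum>l<n. \<Sum>t<k. C l t / of_real (sqrt (real n)) *
          ((\<Sum>m<k. g m l j * (unity_root k (m * t) * cnj (unity_root k (m * \<sigma>)))) / of_nat k))"
      by (rule sum_div_mod[OF k])
    also have "\<dots> = (\<Sum>l<n. \<Sum>t<k. \<Sum>m<k. (g m l j * cnj (unity_root k (m * \<sigma>)) / of_real (sqrt (real n)) / of_nat k) *
          (C l t * unity_root k (m * t)))"
      by (intro sum.cong refl) (simp add: sum_distrib_left sum_divide_distrib mult_ac)
    also have "\<dots> = (\<Sum>l<n. \<Sum>m<k. \<Sum>t<k. (g m l j * cnj (unity_root k (m * \<sigma>)) / of_real (sqrt (real n)) / of_nat k) *
          (C l t * unity_root k (m * t)))"
      by (intro sum.cong refl sum.swap)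
    also have "\<dots> = (\<Sum>l<n. \<Sum>m<k. (g m l j * cnj (unity_root k (m * \<sigma>)) / of_real (sqrt (real n)) / of_nat k) *
          (of_real (circ_eigenvalue k m (\<lambda>x. a x (Suc i) (Suc l))) * unity_root k (m * \<rho>)))"
      unfolding C_def sum_distrib_left[symmetric] sym_circulant_eigenvector[OF bounds(3)] ..
    also have "\<dots> = (\<Sum>l<n. \<Sum>m<k. (unity_root k (m * \<rho>) * cnj (unity_root k (m * \<sigma>)) / of_nat k) *
          (of_real (W m i l) * g m l j))"
      unfolding W by (intro sum.cong refl) (simp add: mult_ac)
    also have "\<dots> = (\<Sum>m<k. \<Sum>l<n. (unity_root k (m * \<rho>) * cnj (unity_root k (m * \<sigma>)) / of_nat k) *
          (of_real (W m i l) * g m l j))"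
      by (rule sum.swap)
    also have "\<dots> = (\<Sum>m<k. (unity_root k (m * \<rho>) * cnj (unity_root k (m * \<sigma>)) / of_nat k) *
          (z * g m i j + (if i = j then 1 else 0)))"
    proof (intro sum.cong refl)
      fix m
      have "(\<Sum>l<n. of_real (W m i l) * g m l j) = z * g m i j + (if i = j then 1 else 0)"
        using resolvent_equation[OF symW z bounds(1,2), of m] unfolding g_def by (simp only: diff_eq_eq add.commute)
      then show "(\<Sum>l<n. (unity_root k (m * \<rho>) * cnj (unity_root k (m * \<sigma>)) / of_nat k) * (of_real (W m i l) * g m l j)) =
          (unity_root k (m * \<rho>) * cnj (unity_root k (m * \<sigma>)) / of_nat k) * (z * g m i j + (if i = j then 1 else 0))"
        by (simp only: sum_distrib_left[symmetric])
    qed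
    also have "\<dots> = z * R r s + (if i = j then 1 else 0) *
        ((\<Sum>m<k. unity_root k (m * \<rho>) * cnj (unity_root k (m * \<sigma>))) / of_nat k)"
      by (simp add: R_def i_def j_def \<rho>_def \<sigma>_def distrib_left sum.distrib sum_distrib_left sum_divide_distrib mult_ac)
    also have "(if i = j then 1 else 0) *
        ((\<Sum>m<k. unity_root k (m * \<rho>) * cnj (unity_root k (m * \<sigma>))) / of_nat k) =
        (if i = j \<and> \<rho> = \<sigma> then 1 else 0)"
      unfolding unity_root_orthogonal[OF bounds(3,4)] using k by simp
    also have "(i = j \<and> \<rho> = \<sigma>) = (r = s)"
      unfolding i_def j_def \<rho>_def \<sigma>_def by (metis div_mult_mod_eq)
    finally show ?thesis by simp
  qed
  have "resolvent_trace (k * n) H z = (\<Sum>r<k * n. R r r)"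
    unfolding resolvent_trace_def using resolvent_unique[OF symH z eq] by (intro sum.cong refl) auto
  also have "\<dots> = (\<Sum>r<k * n. (\<Sum>m<k. g m (r div k) (r div k)) / of_nat k)"
    by (simp add: R_def)
  \<comment> \<open>On the diagonal the phases have cancelled, and the k equal summands over \<rho>
    absorb the factor 1/k.\<close>
  also have "\<dots> = (\<Sum>i<n. \<Sum>\<rho><k. (\<Sum>m<k. g m i i) / of_nat k)"
    by (rule sum_div_mod[OF k])
  also have "\<dots> = (\<Sum>i<n. \<Sum>m<k. g m i i)" using k by simp
  also have "\<dots> = (\<Sum>m<k. \<Sum>i<n. g m i i)" by (rule sum.swap)
  finally show ?thesis by (simp add: g_def resolvent_trace_def)
qed

text \<open>The value is (k - b)/k or (2 k - b)/k, where b = 1 or 2 counts the offsets fixed by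
  reflection. For m < k the larger value belongs to m = 0 and, for even k, to m = k/2, the
  frequencies whose Fourier vector is real.\<close>

definition circ_variance :: "nat \<Rightarrow> nat \<Rightarrow> real" where
  "circ_variance k m = (real k + (if k dvd 2 * m then real k else 0) - (if even k then 2 else 1)) / real k"

text \<open>A variable shared by two offsets has coefficient 2 cos / sqrt k, one at a fixed offset
  has cos / sqrt k with cos^2 = 1. Spread over offsets, the squares contribute 2 cos^2 / k each,
  less 1/k at the fixed ones. Finally 2 cos^2 is 1 plus the cosine of the doubled angle, and the
  latter sums to 0 unless k divides 2 m.\<close>

lemma sum_square_circ_coeff:
  assumes k: "k > 0"
  shows "(\<Sum>l\<in>{1..k div 2 + 1}. (\<Sum>d\<in>{d \<in> {..<k}. circ_index k d = l}.
      cos (2 * pi * real (m * d) / real k) / sqrt (real k))\<^sup>2) = circ_variance k m"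
proof -
  define c where "c = (\<lambda>d. cos (2 * pi * real (m * d) / real k))"
  define F where "F = (\<lambda>l. {d \<in> {..<k}. circ_index k d = l})"
  have c_reflect: "c ((k - d) mod k) = c d" if "d < k" for d
    unfolding c_def Re_unity_root[symmetric] unity_root_reflect[OF k that] by simp
  have "(\<Sum>l\<in>{1..k div 2 + 1}. (\<Sum>d\<in>F l. c d / sqrt (real k))\<^sup>2) =
      (\<Sum>l\<in>{1..k div 2 + 1}. \<Sum>d\<in>F l. c d / sqrt (real k) * (\<Sum>d'\<in>F (circ_index k d). c d' / sqrt (real k)))"
    unfolding power2_eq_square sum_distrib_right by (intro sum.cong refl) (auto simp: F_def)
  also have "\<dots> = (\<Sum>d<k. c d / sqrt (real k) * (\<Sum>d'\<in>F (circ_index k d). c d' / sqrt (real k)))"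
    unfolding F_def using circ_index_range by (intro sum.group) auto
  also have "\<dots> = (\<Sum>d<k. (2 * (c d)\<^sup>2 - (if d = 0 \<or> 2 * d = k then 1 else 0)) / real k)"
  proof (intro sum.cong refl)
    fix d assume d: "d \<in> {..<k}"
    have F: "F (circ_index k d) = {d, (k - d) mod k}"
      using d k circ_index_eq_iff[of d k] by (auto simp: F_def)
    have sq: "c d / sqrt (real k) * (c d / sqrt (real k)) = (c d)\<^sup>2 / real k"
      by (simp add: power2_eq_square)
    show "c d / sqrt (real k) * (\<Sum>d'\<in>F (circ_index k d). c d' / sqrt (real k)) =
        (2 * (c d)\<^sup>2 - (if d = 0 \<or> 2 * d = k then 1 else 0)) / real k"
    proof (cases "d = 0 \<or> 2 * d = k")
      case True
      have "(k - d) mod k = d" using True d by auto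
      then have "c d / sqrt (real k) * (\<Sum>d'\<in>F (circ_index k d). c d' / sqrt (real k)) = (c d)\<^sup>2 / real k"
        unfolding F by (simp add: sq del: times_divide_eq_right times_divide_eq_left)
      moreover have "(c d)\<^sup>2 = 1"
      proof (cases "d = 0")
        case True
        then show ?thesis by (simp add: c_def)
      next
        case False
        then have "real k = 2 * real d" "real d > 0" using True by auto
        then have "2 * pi * real (m * d) / real k = pi * real m" by (simp add: field_simps)
        then show ?thesis
          by (simp add: c_def mult.commute[of pi] power2_eq_square flip: power_mult_distrib)
      qed
      ultimately show ?thesis using True by simp
    next
      case False
      then have "(k - d) mod k \<noteq> d" using d by auto
      then have "c d / sqrt (real k) * (\<Sum>d'\<in>F (circ_index k d). c d' / sqrt (real k)) =
          c d / sqrt (real k) * (c d / sqrt (real k)) + c d / sqrt (real k) * (c d / sqrt (real k))"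
        unfolding F using c_reflect[of d] d by (simp add: distrib_left)
      then show ?thesis using False unfolding sq by simp
    qed
  qed
  also have "\<dots> = ((\<Sum>d<k. 2 * (c d)\<^sup>2) - (\<Sum>d<k. if d = 0 \<or> 2 * d = k then 1 else 0)) / real k"
    by (simp only: sum_divide_distrib sum_subtractf diff_divide_distrib)
  also have "(\<Sum>d<k. if d = 0 \<or> 2 * d = k then 1 else 0 :: real) = (if even k then 2 else 1)"
  proof -
    have "(\<Sum>d<k. if d = 0 \<or> 2 * d = k then 1 else 0 :: real) = real (card {d \<in> {..<k}. d = 0 \<or> 2 * d = k})"
      by (simp add: sum.If_cases Int_def)
    also have "{d \<in> {..<k}. d = 0 \<or> 2 * d = k} = (if even k then {0, k div 2} else {0})"
      using k by auto
    finally show ?thesis using k by (auto elim!: evenE)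
  qed
  also have "(\<Sum>d<k. 2 * (c d)\<^sup>2) = real k + (if k dvd 2 * m then real k else 0)"
  proof -
    have "2 * (c d)\<^sup>2 = 1 + Re (unity_root k (d * ((2 * m) mod k)) * cnj (unity_root k (d * 0)))" for d
    proof -
      have "unity_root k (d * ((2 * m) mod k)) = unity_root k (2 * (m * d))"
        by (rule unity_root_cong[OF k]) (metis mod_mult_right_eq mult.assoc mult.commute)
      moreover have "Re (unity_root k (2 * (m * d))) = 2 * (c d)\<^sup>2 - 1"
        unfolding Re_unity_root c_def by (simp add: cos_double_cos[symmetric] mult_ac)
      ultimately show ?thesis by simp
    qed
    then have "(\<Sum>d<k. 2 * (c d)\<^sup>2) =
        real k + Re (\<Sum>d<k. unity_root k (d * ((2 * m) mod k)) * cnj (unity_root k (d * 0)))"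
      by (simp add: sum.distrib)
    also have "(\<Sum>d<k. unity_root k (d * ((2 * m) mod k)) * cnj (unity_root k (d * 0))) =
        (if (2 * m) mod k = 0 then of_nat k else 0)"
      using k by (intro unity_root_orthogonal) auto
    finally show ?thesis by (auto simp: dvd_eq_mod_eq_0)
  qed
  finally show ?thesis by (simp add: c_def F_def circ_variance_def)
qed

text \<open>The value could vanish only for k = 1 or k = 2 at a frequency with k not dividing 2 m,
  and no such frequency exists.\<close>

lemma circ_variance_pos:
  assumes "k > 0"
  shows "circ_variance k m > 0"
proof (cases "k dvd 2 * m")
  case True
  have "real k + real k - (if even k then 2 else 1) > 0" using assms by (auto elim!: evenE)
  then show ?thesis using True assms by (simp add: circ_variance_def)
next
  case False
  then have "k \<noteq> 1" "k \<noteq> 2" by auto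
  then have "k \<ge> 3" using assms by linarith
  then show ?thesis using False by (simp add: circ_variance_def)
qed

section \<open>The limit law\<close>

lemma poisson_lipschitz:
  assumes z: "Im z > 0" and z': "Im z' > 0"
  shows "\<bar>poisson z x - poisson z' x\<bar> \<le> dist z z' / (Im z * Im z')"
proof -
  have lower: "cmod (of_real x - w) \<ge> Im w" for w
    using abs_Im_le_cmod[of "of_real x - w"] by simp
  have nz: "of_real x - z \<noteq> 0" "of_real x - z' \<noteq> 0" using z z' by (auto simp: complex_eq_iff)
  have "poisson z x - poisson z' x = Im (1 / (of_real x - z) - 1 / (of_real x - z'))"
    by (simp only: poisson_def minus_complex.sel)
  also have "1 / (of_real x - z) - 1 / (of_real x - z') = (z - z') / ((of_real x - z) * (of_real x - z'))"
    using nz by (simp add: field_simps)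
  finally have "\<bar>poisson z x - poisson z' x\<bar> \<le> cmod ((z - z') / ((of_real x - z) * (of_real x - z')))"
    by (simp only: abs_Im_le_cmod)
  also have "\<dots> = dist z z' / (cmod (of_real x - z) * cmod (of_real x - z'))"
    by (simp add: norm_divide norm_mult dist_norm)
  also have "\<dots> \<le> dist z z' / (Im z * Im z')"
    using z z' lower nz by (intro divide_left_mono mult_mono mult_pos_pos) auto
  finally show ?thesis .
qed

lemma poisson_integral_lipschitz:
  assumes "real_distribution \<mu>" and z: "Im z > 0" and z': "Im z' > 0"
  shows "\<bar>(\<integral>x. poisson z x \<partial>\<mu>) - (\<integral>x. poisson z' x \<partial>\<mu>)\<bar> \<le> dist z z' / (Im z * Im z')"
proof -
  interpret real_distribution \<mu> by fact
  have int: "integrable \<mu> (poisson w)" if "Im w > 0" for w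
    using that by (intro integrable_poisson finite_measure_axioms) auto
  have eq: "(\<integral>x. poisson z x \<partial>\<mu>) - (\<integral>x. poisson z' x \<partial>\<mu>) = (\<integral>x. poisson z x - poisson z' x \<partial>\<mu>)"
    using int[OF z] int[OF z'] by simp
  show ?thesis
    unfolding eq
  proof (rule abs_integral_le_const)
    show "(\<lambda>x. poisson z x - poisson z' x) \<in> borel_measurable \<mu>"
      using int[OF z] int[OF z'] by (intro borel_measurable_diff borel_measurable_integrable)
  qed (rule poisson_lipschitz[OF z z'])
qed

text \<open>The Lipschitz bound in z does not depend on the measure, so convergence at a nearby
  point of the dense set transfers to z with three errors of size e/3.\<close>

lemma poisson_integrals_converge_from_dense:
  fixes \<mu> :: "nat \<Rightarrow> real measure" and \<nu> :: "real measure" and Q :: "complex set"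
  assumes \<mu>: "\<And>n. real_distribution (\<mu> n)" and \<nu>: "real_distribution \<nu>"
    and dense: "\<And>U. open U \<Longrightarrow> U \<noteq> {} \<Longrightarrow> \<exists>w\<in>Q. w \<in> U"
    and conv: "\<And>w. w \<in> Q \<Longrightarrow> Im w > 0 \<Longrightarrow> (\<lambda>n. \<integral>x. poisson w x \<partial>\<mu> n) \<longlonglongrightarrow> (\<integral>x. poisson w x \<partial>\<nu>)"
    and z: "Im z > 0"
  shows "(\<lambda>n. \<integral>x. poisson z x \<partial>\<mu> n) \<longlonglongrightarrow> (\<integral>x. poisson z x \<partial>\<nu>)"
proof (rule tendstoI)
  fix e :: real assume e: "e > 0"
  define \<eta> where "\<eta> = Im z"
  have \<eta>: "\<eta> > 0" using z by (simp add: \<eta>_def)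
  \<comment> \<open>Chosen so that moving by less than \<delta>, from height \<eta> to a height
    above \<eta>/2, costs less than e/3.\<close>
  define \<delta> where "\<delta> = e / 3 * (\<eta> * (\<eta> / 2))"
  have \<delta>: "\<delta> > 0" using e \<eta> by (simp add: \<delta>_def)
  have U: "open (ball z \<delta> \<inter> {w. \<eta> / 2 < Im w})"
    by (intro open_Int open_ball open_halfspace_Im_gt)
  have "z \<in> ball z \<delta> \<inter> {w. \<eta> / 2 < Im w}" using \<delta> \<eta> by (simp add: \<eta>_def)
  then have "ball z \<delta> \<inter> {w. \<eta> / 2 < Im w} \<noteq> {}" by blast
  from dense[OF U this] obtain w where w: "w \<in> Q" "dist z w < \<delta>" "\<eta> / 2 < Im w"
    by auto
  have Imw: "Im w > 0" using w \<eta> by linarith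
  have small: "dist z w / (Im z * Im w) < e / 3"
  proof -
    have "dist z w / (Im z * Im w) \<le> dist z w / (\<eta> * (\<eta> / 2))"
      using w \<eta> Imw z by (intro divide_left_mono mult_mono mult_pos_pos) (auto simp: \<eta>_def)
    also have "\<dots> < e / 3" using w(2) \<eta> by (simp add: \<delta>_def pos_divide_less_eq)
    finally show ?thesis .
  qed
  have lip: "\<bar>(\<integral>x. poisson z x \<partial>\<rho>) - (\<integral>x. poisson w x \<partial>\<rho>)\<bar> < e / 3" if "real_distribution \<rho>" for \<rho>
    using poisson_integral_lipschitz[OF that z Imw] small by linarith
  have "\<forall>\<^sub>F n in sequentially. dist (\<integral>x. poisson w x \<partial>\<mu> n) (\<integral>x. poisson w x \<partial>\<nu>) < e / 3"
    using e by (intro tendstoD[OF conv[OF w(1) Imw]]) simp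
  then show "\<forall>\<^sub>F n in sequentially. dist (\<integral>x. poisson z x \<partial>\<mu> n) (\<integral>x. poisson z x \<partial>\<nu>) < e"
  proof eventually_elim
    case (elim n)
    then show ?case using lip[OF \<mu>[of n]] lip[OF \<nu>] unfolding dist_real_def by linarith
  qed
qed

lemma finite_measure_semicircle: "v \<ge> 0 \<Longrightarrow> finite_measure (semicircle 0 v)"
proof (cases "v = 0")
  \<comment> \<open>The first term of the limit law for k = 1 and k = 2: division by the variance
    gives 0, so the measure is zero and still finite.\<close>
  case True
  then show ?thesis
    by (intro finite_measureI) (simp add: semicircle_eq_density semicircle_density_def emeasure_density)
next
  case False
  assume "v \<ge> 0"
  then show ?thesis using False prob_space.finite_measure[OF prob_space_semicircle, of v] by simp
qed

lemma limit_law_weights: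
  assumes "k > 0"
  obtains ws where "limit_law k = measure_lincomb (map (\<lambda>(w, v). (w, semicircle 0 v)) ws)"
    "\<And>w v. (w, v) \<in> set ws \<Longrightarrow> w \<ge> 0 \<and> v \<ge> 0 \<and> (w > 0 \<longrightarrow> v > 0)"
    "\<And>h :: real \<Rightarrow> real. (\<Sum>(w, v)\<leftarrow>ws. w * h v) = (\<Sum>m<k. h (circ_variance k m)) / real k"
proof -
  define A where "A = {m \<in> {..<k}. k dvd 2 * m}"
  \<comment> \<open>The number of frequencies m < k for which k divides 2 m.\<close>
  define b where "b = (if even k then 2 else 1 :: real)"
  have A: "A = (if even k then {0, k div 2} else {0})"
  proof -
    have dvd: "k dvd 2 * m \<longleftrightarrow> m = 0 \<or> 2 * m = k" if "m < k" for m
    proof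
      assume "k dvd 2 * m"
      then obtain c where c: "2 * m = k * c" by (rule dvdE)
      have "c < 2"
      proof (rule ccontr)
        assume "\<not> c < 2"
        then have "k * 2 \<le> k * c" by (intro mult_le_mono2) simp
        then show False using c that by linarith
      qed
      then have "c = 0 \<or> c = 1" by linarith
      then show "m = 0 \<or> 2 * m = k" using c assms by auto
    qed auto
    have "A = {m \<in> {..<k}. m = 0 \<or> 2 * m = k}"
      unfolding A_def by (rule Collect_cong) (use dvd in blast)
    also have "\<dots> = (if even k then {0, k div 2} else {0})" using assms by auto
    finally show ?thesis .
  qed
  have cardA: "real (card A) = b"
    using assms unfolding A b_def by (auto elim!: evenE)
  have AK: "A \<subseteq> {..<k}" by (auto simp: A_def)
  have cardk: "real (card ({..<k} - A)) = real k - b"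
  proof -
    have "card A \<le> k" using card_mono[OF _ AK] by simp
    then show ?thesis
      using AK cardA by (simp add: card_Diff_subset finite_subset[OF AK] of_nat_diff)
  qed
  have b_le: "b \<le> real k" using cardA card_mono[OF _ AK] by simp
  let ?ws = "[((real k - b) / real k, (real k - b) / real k), (b / real k, (2 * real k - b) / real k)]"
  show thesis
  proof (rule that[of ?ws])
    show "limit_law k = measure_lincomb (map (\<lambda>(w, v). (w, semicircle 0 v)) ?ws)"
      by (simp add: limit_law_def b_def)
    show "w \<ge> 0 \<and> v \<ge> 0 \<and> (w > 0 \<longrightarrow> v > 0)" if "(w, v) \<in> set ?ws" for w v
      using that b_le assms by (auto simp: b_def split: if_splits)
    fix h :: "real \<Rightarrow> real"
    have "(\<Sum>m<k. h (circ_variance k m)) =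
        (\<Sum>m<k. if m \<in> A then h ((2 * real k - b) / real k) else h ((real k - b) / real k))"
      by (intro sum.cong refl) (auto simp: A_def circ_variance_def b_def)
    also have "\<dots> = real (card A) * h ((2 * real k - b) / real k) +
        real (card ({..<k} - A)) * h ((real k - b) / real k)"
      using AK by (subst sum.If_cases) (auto simp: Int_absorb1 Diff_eq)
    finally show "(\<Sum>(w, v)\<leftarrow>?ws. w * h v) = (\<Sum>m<k. h (circ_variance k m)) / real k"
      unfolding cardA cardk by (simp add: add_divide_distrib)
  qed
qed

lemma real_distribution_limit_law:
  assumes k: "k > 0"
  shows "real_distribution (limit_law k)"
proof -
  obtain ws where ws: "limit_law k = measure_lincomb (map (\<lambda>(w, v). (w, semicircle 0 v)) ws)"
    "\<And>w v. (w, v) \<in> set ws \<Longrightarrow> w \<ge> 0 \<and> v \<ge> 0 \<and> (w > 0 \<longrightarrow> v > 0)"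
    "\<And>h :: real \<Rightarrow> real. (\<Sum>(w, v)\<leftarrow>ws. w * h v) = (\<Sum>m<k. h (circ_variance k m)) / real k"
    using limit_law_weights[OF k] by metis
  have mass: "ennreal w * emeasure (semicircle 0 v) UNIV = ennreal w" if "(w, v) \<in> set ws" for w v
  proof (cases "w = 0")
    case False
    then have "v > 0" using ws(2)[OF that] by simp
    then have "emeasure (semicircle 0 v) (space (semicircle 0 v)) = 1"
      by (intro prob_space.emeasure_space_1 prob_space_semicircle)
    then show ?thesis by (simp add: semicircle_eq_density)
  qed simp
  have "emeasure (limit_law k) UNIV = (\<Sum>(w, v)\<leftarrow>ws. ennreal w * emeasure (semicircle 0 v) UNIV)"
    unfolding ws(1) by (subst emeasure_measure_lincomb) (auto simp: o_def split_def)
  also have "\<dots> = (\<Sum>p\<leftarrow>ws. ennreal (fst p))"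
    using mass by (intro arg_cong[where f = sum_list] map_cong refl) auto
  also have "\<dots> = ennreal (\<Sum>p\<leftarrow>ws. fst p)"
    using ws(2) by (intro sum_list_ennreal) fastforce
  also have "(\<Sum>p\<leftarrow>ws. fst p) = 1"
    using ws(3)[of "\<lambda>_. 1"] k by (simp add: split_def)
  finally have "prob_space (limit_law k)"
    unfolding ws(1) by (intro prob_spaceI) simp
  then show ?thesis
    unfolding real_distribution_def real_distribution_axioms_def ws(1) by simp
qed

lemma poisson_limit_law:
  assumes k: "k > 0" and z: "Im z > 0"
  shows "(\<integral>x. poisson z x \<partial>limit_law k) =
    (\<Sum>m<k. \<integral>x. poisson z x \<partial>semicircle 0 (circ_variance k m)) / real k"
proof -
  obtain ws where ws: "limit_law k = measure_lincomb (map (\<lambda>(w, v). (w, semicircle 0 v)) ws)"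
    "\<And>w v. (w, v) \<in> set ws \<Longrightarrow> w \<ge> 0 \<and> v \<ge> 0 \<and> (w > 0 \<longrightarrow> v > 0)"
    "\<And>h :: real \<Rightarrow> real. (\<Sum>(w, v)\<leftarrow>ws. w * h v) = (\<Sum>m<k. h (circ_variance k m)) / real k"
    using limit_law_weights[OF k] by metis
  have "(\<integral>x. poisson z x \<partial>limit_law k) =
      (\<Sum>(w, \<mu>)\<leftarrow>map (\<lambda>(w, v). (w, semicircle 0 v)) ws. w * (\<integral>x. poisson z x \<partial>\<mu>))"
    unfolding ws(1)
  proof (rule integral_measure_lincomb)
    fix w \<mu> assume "(w, \<mu>) \<in> set (map (\<lambda>(w, v). (w, semicircle 0 v)) ws)"
    then obtain v where v: "(w, v) \<in> set ws" "\<mu> = semicircle 0 v" by auto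
    show "sets \<mu> = sets borel" "w \<ge> 0" using v ws(2) by auto
    show "integrable \<mu> (poisson z)"
      unfolding v(2) using ws(2)[OF v(1)] z by (intro integrable_poisson finite_measure_semicircle) auto
  qed (use z in \<open>auto simp: borel_measurable_poisson poisson_nonneg\<close>)
  also have "\<dots> = (\<Sum>(w, v)\<leftarrow>ws. w * (\<integral>x. poisson z x \<partial>semicircle 0 v))"
    by (simp add: o_def split_def)
  finally show ?thesis unfolding ws(3) .
qed

section \<open>Second moments and independence of the block eigenvalues\<close>

lemma integrable_mult_square:
  fixes f g :: "'a \<Rightarrow> real"
  assumes [measurable]: "f \<in> borel_measurable M" "g \<in> borel_measurable M"
    and int: "integrable M (\<lambda>x. (f x)\<^sup>2)" "integrable M (\<lambda>x. (g x)\<^sup>2)"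
  shows "integrable M (\<lambda>x. f x * g x)"
proof (rule Bochner_Integration.integrable_bound)
  show "integrable M (\<lambda>x. (f x)\<^sup>2 + (g x)\<^sup>2)" using int by simp
  show "AE x in M. norm (f x * g x) \<le> norm ((f x)\<^sup>2 + (g x)\<^sup>2)"
  proof (rule AE_I2)
    fix x
    have "2 * (\<bar>f x\<bar> * \<bar>g x\<bar>) \<le> (f x)\<^sup>2 + (g x)\<^sup>2"
      using sum_squares_bound[of "\<bar>f x\<bar>" "\<bar>g x\<bar>"] by simp
    moreover have "\<bar>f x\<bar> * \<bar>g x\<bar> \<ge> 0" by simp
    ultimately show "norm (f x * g x) \<le> norm ((f x)\<^sup>2 + (g x)\<^sup>2)"
      unfolding real_norm_def abs_mult by linarith
  qed
qed measurable

lemma (in prob_space) square_integrable_sum: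
  fixes Y :: "'i \<Rightarrow> 'a \<Rightarrow> real"
  assumes "finite I" "\<And>i. i \<in> I \<Longrightarrow> Y i \<in> borel_measurable M" "\<And>i. i \<in> I \<Longrightarrow> integrable M (\<lambda>x. (Y i x)\<^sup>2)"
  shows "integrable M (\<lambda>x. (\<Sum>i\<in>I. c i * Y i x)\<^sup>2)"
proof -
  have "(\<lambda>x. (\<Sum>i\<in>I. c i * Y i x)\<^sup>2) = (\<lambda>x. \<Sum>i\<in>I. \<Sum>j\<in>I. (c i * c j) * (Y i x * Y j x))"
    by (simp add: power2_eq_square sum_product mult_ac)
  moreover have "integrable M (\<lambda>x. \<Sum>i\<in>I. \<Sum>j\<in>I. (c i * c j) * (Y i x * Y j x))"
    using assms by (intro Bochner_Integration.integrable_sum integrable_mult_right integrable_mult_square)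
  ultimately show ?thesis by simp
qed

lemma (in prob_space) variance_sum_indep:
  fixes Y :: "'i \<Rightarrow> 'a \<Rightarrow> real"
  assumes I: "finite I" and indep: "indep_vars (\<lambda>_. borel) Y I"
    and int: "\<And>i. i \<in> I \<Longrightarrow> integrable M (\<lambda>x. (Y i x)\<^sup>2)"
    and var: "\<And>i. i \<in> I \<Longrightarrow> variance (Y i) = 1"
  shows "variance (\<lambda>x. \<Sum>i\<in>I. c i * Y i x) = (\<Sum>i\<in>I. (c i)\<^sup>2)"
proof -
  have rv: "Y i \<in> borel_measurable M" if "i \<in> I" for i
    using indep that unfolding indep_vars_def by auto
  have int1: "integrable M (Y i)" if "i \<in> I" for i
    by (rule square_integrable_imp_integrable[OF rv[OF that] int[OF that]])
  define Z where "Z = (\<lambda>i x. Y i x - expectation (Y i))"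
  have Z_meas: "Z i \<in> borel_measurable M" if "i \<in> I" for i
    using rv[OF that] by (simp add: Z_def)
  have Z_int: "integrable M (Z i)" if "i \<in> I" for i
    using int1[OF that] by (simp add: Z_def)
  have Z_sq: "integrable M (\<lambda>x. (Z i x)\<^sup>2)" if "i \<in> I" for i
  proof -
    have "(\<lambda>x. (Z i x)\<^sup>2) = (\<lambda>x. (Y i x)\<^sup>2 - 2 * expectation (Y i) * Y i x + (expectation (Y i))\<^sup>2)"
      by (auto simp: Z_def power2_eq_square algebra_simps)
    then show ?thesis using int[OF that] int1[OF that] by simp
  qed
  have Z_indep: "indep_vars (\<lambda>_. borel) Z I"
    unfolding Z_def by (rule indep_vars_compose2[OF indep, where Y = "\<lambda>i x. x - expectation (Y i)"]) measurable
  have Z_mean: "expectation (Z i) = 0" if "i \<in> I" for i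
    using int1[OF that] by (simp add: Z_def prob_space)
  have cov: "expectation (\<lambda>x. Z i x * Z j x) = (if i = j then 1 else 0)" if ij: "i \<in> I" "j \<in> I" for i j
  proof (cases "i = j")
    case True
    then show ?thesis using var[OF ij(1)] by (simp add: Z_def power2_eq_square)
  next
    case False
    have "indep_vars (\<lambda>_. borel) Z {i, j}"
      using ij by (intro indep_vars_subset[OF Z_indep]) auto
    then have "expectation (\<lambda>x. \<Prod>i\<in>{i, j}. Z i x) = (\<Prod>i\<in>{i, j}. expectation (Z i))"
      using Z_int ij by (intro indep_vars_lebesgue_integral) auto
    then show ?thesis using False Z_mean ij by simp
  qed
  have mean: "expectation (\<lambda>x. \<Sum>i\<in>I. c i * Y i x) = (\<Sum>i\<in>I. c i * expectation (Y i))"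
    using int1 by (subst Bochner_Integration.integral_sum) auto
  have "variance (\<lambda>x. \<Sum>i\<in>I. c i * Y i x) = expectation (\<lambda>x. (\<Sum>i\<in>I. c i * Z i x)\<^sup>2)"
    unfolding mean by (simp add: Z_def right_diff_distrib sum_subtractf)
  also have "(\<lambda>x. (\<Sum>i\<in>I. c i * Z i x)\<^sup>2) = (\<lambda>x. \<Sum>i\<in>I. \<Sum>j\<in>I. (c i * c j) * (Z i x * Z j x))"
    by (simp add: power2_eq_square sum_product mult_ac)
  also have "expectation \<dots> = (\<Sum>i\<in>I. expectation (\<lambda>x. \<Sum>j\<in>I. (c i * c j) * (Z i x * Z j x)))"
    using Z_meas Z_sq
    by (intro Bochner_Integration.integral_sum Bochner_Integration.integrable_sum integrable_mult_right integrable_mult_square)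
  also have "\<dots> = (\<Sum>i\<in>I. \<Sum>j\<in>I. expectation (\<lambda>x. (c i * c j) * (Z i x * Z j x)))"
    using Z_meas Z_sq
    by (intro sum.cong refl Bochner_Integration.integral_sum integrable_mult_right integrable_mult_square)
  also have "\<dots> = (\<Sum>i\<in>I. \<Sum>j\<in>I. if j = i then (c i)\<^sup>2 else 0)"
    using cov by (intro sum.cong refl) (auto simp: power2_eq_square)
  also have "\<dots> = (\<Sum>i\<in>I. (c i)\<^sup>2)" using I by simp
  finally show ?thesis .
qed

text \<open>Each new variable is a function of the single coordinate \<open>f j\<close>, and
  injectivity makes these singletons disjoint.\<close>

lemma (in prob_space) indep_vars_reindex_inj:
  assumes indep: "indep_vars (\<lambda>_. N) X I" and f: "inj_on f J" "f ` J \<subseteq> I"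
  shows "indep_vars (\<lambda>_. N) (\<lambda>j. X (f j)) J"
proof -
  have "indep_vars (\<lambda>j. PiM {f j} (\<lambda>_. N)) (\<lambda>j \<omega>. restrict (\<lambda>i. X i \<omega>) {f j}) J"
    using f by (intro indep_vars_restrict[OF indep]) (auto simp: disjoint_family_on_def inj_on_def)
  then have "indep_vars (\<lambda>_. N) (\<lambda>j \<omega>. (restrict (\<lambda>i. X i \<omega>) {f j}) (f j)) J"
    by (rule indep_vars_compose2[where Y = "\<lambda>j x. x (f j)"]) (auto intro: measurable_component_singleton)
  then show ?thesis by simp
qed

text \<open>Grouping the offsets by the variable they carry gives a linear combination of distinct,
  hence independent, variables; in the sum over offsets a variable can occur twice.\<close>

lemma circ_eigenvalue_eq_sum:
  "circ_eigenvalue k m b = (\<Sum>l\<in>{1..k div 2 + 1}. (\<Sum>d\<in>{d \<in> {..<k}. circ_index k d = l}.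
     cos (2 * pi * real (m * d) / real k) / sqrt (real k)) * b l)"
proof -
  have "(\<Sum>l\<in>{1..k div 2 + 1}. (\<Sum>d\<in>{d \<in> {..<k}. circ_index k d = l}.
      cos (2 * pi * real (m * d) / real k) / sqrt (real k)) * b l) =
    (\<Sum>l\<in>{1..k div 2 + 1}. \<Sum>d\<in>{d \<in> {..<k}. circ_index k d = l}.
      cos (2 * pi * real (m * d) / real k) / sqrt (real k) * b (circ_index k d))"
    unfolding sum_distrib_right by (intro sum.cong refl) auto
  also have "\<dots> = (\<Sum>d<k. cos (2 * pi * real (m * d) / real k) / sqrt (real k) * b (circ_index k d))"
    using circ_index_range by (intro sum.group) auto
  finally show ?thesis by (simp add: circ_eigenvalue_def)
qed

lemma circ_eigenvalue_cong:
  assumes "\<And>l. 1 \<le> l \<Longrightarrow> l \<le> k div 2 + 1 \<Longrightarrow> b l = b' l"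
  shows "circ_eigenvalue k m b = circ_eigenvalue k m b'"
  unfolding circ_eigenvalue_eq_sum using assms by (intro sum.cong refl) auto

text \<open>At a fixed frequency the entries of the transformed matrix use disjoint sets of
  variables and are images of one product law under one function, hence they are independent and
  identically distributed, and the Wigner result applies.\<close>

theorem block_circulant_stieltjes:
  fixes M :: "'w measure" and k :: nat and a :: "nat \<Rightarrow> nat \<Rightarrow> nat \<Rightarrow> 'w \<Rightarrow> real"
  assumes M: "prob_space M" and k: "k > 0"
    and indep: "prob_space.indep_vars M (\<lambda>_. borel) (\<lambda>(l, i, j). a l i j)
          {(l, i, j). 1 \<le> l \<and> l \<le> k div 2 + 1 \<and> 1 \<le> i \<and> i \<le> j}"
    and ident: "\<And>l i j. 1 \<le> l \<Longrightarrow> l \<le> k div 2 + 1 \<Longrightarrow> 1 \<le> i \<Longrightarrow> i \<le> j \<Longrightarrow>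
          distr M borel (a l i j) = distr M borel (a 1 1 1)"
    and sq_int: "\<And>l i j. 1 \<le> l \<Longrightarrow> l \<le> k div 2 + 1 \<Longrightarrow> 1 \<le> i \<Longrightarrow> i \<le> j \<Longrightarrow>
          integrable M (\<lambda>\<omega>. (a l i j \<omega>)\<^sup>2)"
    and var: "\<And>l i j. 1 \<le> l \<Longrightarrow> l \<le> k div 2 + 1 \<Longrightarrow> 1 \<le> i \<Longrightarrow> i \<le> j \<Longrightarrow>
          prob_space.variance M (a l i j) = 1"
    and z: "Im z > 0" and root: "of_real (circ_variance k m) * r\<^sup>2 + z * r + 1 = 0" "Im r > 0"
  shows "AE \<omega> in M. (\<lambda>n. resolvent_trace n (wigner n (\<lambda>p. circ_eigenvalue k m
      (\<lambda>l. a l (Suc (fst p)) (Suc (snd p)) \<omega>))) z / of_nat n) \<longlonglongrightarrow> r"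
proof -
  interpret M: prob_space M by (rule M)
  define L where "L = {1..k div 2 + 1}"
  have rv: "a l i j \<in> borel_measurable M" if "l \<in> L" "1 \<le> i" "i \<le> j" for l i j
    using indep that unfolding M.indep_vars_def by (auto simp: L_def)
  define X where "X = (\<lambda>p \<omega>. circ_eigenvalue k m (\<lambda>l. a l (Suc (fst p)) (Suc (snd p)) \<omega>))"
  have circ_meas: "(\<lambda>x. circ_eigenvalue k m (\<lambda>l. x (f l))) \<in> borel_measurable (PiM K (\<lambda>_. borel))"
    if "\<And>l. l \<in> L \<Longrightarrow> f l \<in> K" for f :: "nat \<Rightarrow> 'c" and K
    unfolding circ_eigenvalue_eq_sum using that
    by (intro borel_measurable_sum borel_measurable_times borel_measurable_const measurable_component_singleton)
      (auto simp: L_def)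
  have X_indep: "M.indep_vars (\<lambda>_. borel) X {(i, j). i \<le> j}"
  proof -
    \<comment> \<open>The variables of one block: all \<open>l\<close> at the position
      \<open>p\<close>, shifted by 1 because matrix positions count from 0.\<close>
    define K where "K = (\<lambda>p :: nat \<times> nat. {(l, i, j). l \<in> L \<and> i = Suc (fst p) \<and> j = Suc (snd p)})"
    have "M.indep_vars (\<lambda>p. PiM (K p) (\<lambda>_. borel))
        (\<lambda>p \<omega>. restrict (\<lambda>t. (case t of (l, i, j) \<Rightarrow> a l i j) \<omega>) (K p)) {(i, j). i \<le> j}"
      by (intro M.indep_vars_restrict[OF indep]) (auto simp: K_def L_def disjoint_family_on_def)
    then have "M.indep_vars (\<lambda>_. borel) (\<lambda>p \<omega>. circ_eigenvalue k m
        (\<lambda>l. restrict (\<lambda>t. (case t of (l, i, j) \<Rightarrow> a l i j) \<omega>) (K p) (l, Suc (fst p), Suc (snd p)))) {(i, j). i \<le> j}"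
      by (rule M.indep_vars_compose2[where Y = "\<lambda>p x. circ_eigenvalue k m (\<lambda>l. x (l, Suc (fst p), Suc (snd p)))"])
        (intro circ_meas, auto simp: K_def)
    moreover have "circ_eigenvalue k m
        (\<lambda>l. restrict (\<lambda>t. (case t of (l, i, j) \<Rightarrow> a l i j) \<omega>) (K p) (l, Suc (fst p), Suc (snd p))) = X p \<omega>" for p \<omega>
      unfolding X_def by (intro circ_eigenvalue_cong) (auto simp: K_def L_def)
    ultimately show ?thesis by simp
  qed
  have a_indep: "M.indep_vars (\<lambda>_. borel) (\<lambda>l. a l (Suc i) (Suc j)) L" if "i \<le> j" for i j
  proof -
    have "M.indep_vars (\<lambda>_. borel) (\<lambda>l. (case (l, Suc i, Suc j) of (l, i, j) \<Rightarrow> a l i j)) L"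
      using that by (intro M.indep_vars_reindex_inj[OF indep]) (auto simp: inj_on_def L_def)
    then show ?thesis by simp
  qed
  have X_meas: "X (i, j) \<in> borel_measurable M" if "i \<le> j" for i j
    using X_indep that unfolding M.indep_vars_def by auto
  have X_law: "distr M borel (X (i, j)) = distr (PiM L (\<lambda>_. distr M borel (a 1 1 1))) borel (circ_eigenvalue k m)"
    if ij: "i \<le> j" for i j
  proof -
    let ?Y = "\<lambda>\<omega>. \<lambda>l\<in>L. a l (Suc i) (Suc j) \<omega>"
    have L: "L \<noteq> {}" by (simp add: L_def)
    have rvY: "a l (Suc i) (Suc j) \<in> borel_measurable M" if "l \<in> L" for l
      using rv[OF that, of "Suc i" "Suc j"] ij by simp
    have "distr M (PiM L (\<lambda>_. borel)) ?Y = PiM L (\<lambda>l. distr M borel (a l (Suc i) (Suc j)))"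
      using M.indep_vars_iff_distr_eq_PiM'[where M' = "\<lambda>_. borel" and X = "\<lambda>l. a l (Suc i) (Suc j)", OF L rvY]
        a_indep[OF ij] by simp
    also have "\<dots> = PiM L (\<lambda>_. distr M borel (a 1 1 1))"
      using ij by (intro PiM_cong refl ident) (auto simp: L_def)
    finally have law: "distr M (PiM L (\<lambda>_. borel)) ?Y = PiM L (\<lambda>_. distr M borel (a 1 1 1))" .
    have "distr (distr M (PiM L (\<lambda>_. borel)) ?Y) borel (circ_eigenvalue k m) =
        distr M borel (circ_eigenvalue k m \<circ> ?Y)"
      using rvY circ_meas[of "\<lambda>l. l" L] by (intro distr_distr measurable_restrict) auto
    also have "circ_eigenvalue k m \<circ> ?Y = X (i, j)"
      unfolding X_def comp_def by (intro ext circ_eigenvalue_cong) (auto simp: L_def)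
    finally show ?thesis unfolding law by simp
  qed
  define D where "D = distr M borel (X (0, 0))"
  define c where "c = (\<lambda>l. \<Sum>d\<in>{d \<in> {..<k}. circ_index k d = l}. cos (2 * pi * real (m * d) / real k) / sqrt (real k))"
  have X00: "X (0, 0) = (\<lambda>\<omega>. \<Sum>l\<in>L. c l * a l 1 1 \<omega>)"
    by (simp add: X_def circ_eigenvalue_eq_sum c_def L_def)
  have rv1: "a l 1 1 \<in> borel_measurable M" "integrable M (\<lambda>\<omega>. (a l 1 1 \<omega>)\<^sup>2)" "M.variance (a l 1 1) = 1"
    if "l \<in> L" for l
    using that rv[OF that, of 1 1] sq_int[of l 1 1] var[of l 1 1] by (auto simp: L_def)
  have "AE \<omega> in M. (\<lambda>n. resolvent_trace n (wigner n (\<lambda>p. X p \<omega>)) z / of_nat n) \<longlonglongrightarrow> r"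
  proof (rule wigner_stieltjes[OF M X_indep, where D = D])
    show "distr M borel (X (i, j)) = D" if "i \<le> j" for i j
      unfolding D_def X_law[OF that] X_law[OF order_refl] ..
    have "integrable M (\<lambda>\<omega>. (X (0, 0) \<omega>)\<^sup>2)"
      unfolding X00 using rv1 by (intro M.square_integrable_sum) (auto simp: L_def)
    then show "integrable D (\<lambda>x. x\<^sup>2)"
      unfolding D_def using X_meas[of 0 0] by (subst integrable_distr_eq) auto
    have "(\<integral>x. x \<partial>D) = M.expectation (X (0, 0))"
      unfolding D_def by (rule integral_distr[OF X_meas]) auto
    moreover have "(\<integral>x. (x - M.expectation (X (0, 0)))\<^sup>2 \<partial>D) = M.variance (X (0, 0))"
      unfolding D_def by (rule integral_distr[OF X_meas]) auto
    moreover have "M.variance (X (0, 0)) = (\<Sum>l\<in>L. (c l)\<^sup>2)"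
      unfolding X00 using a_indep[of 0 0] rv1 by (intro M.variance_sum_indep) (auto simp: L_def)
    moreover have "(\<Sum>l\<in>L. (c l)\<^sup>2) = circ_variance k m"
      unfolding c_def L_def by (rule sum_square_circ_coeff[OF k])
    ultimately show "(\<integral>x. (x - (\<integral>y. y \<partial>D))\<^sup>2 \<partial>D) = circ_variance k m" by simp
  qed (fact z root)+
  then show ?thesis unfolding X_def .
qed

lemma poisson_spectral_block_circulant:
  fixes a :: "nat \<Rightarrow> nat \<Rightarrow> nat \<Rightarrow> real"
  assumes k: "k > 0" and z: "Im z > 0"
    and sym: "\<And>l i j. 1 \<le> l \<Longrightarrow> l \<le> k div 2 + 1 \<Longrightarrow> 1 \<le> i \<Longrightarrow> i \<le> j \<Longrightarrow> a l j i = a l i j"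
  shows "(\<integral>x. poisson z x \<partial>spectral_measure (map_mat complex_of_real (block_circulant n k a))) =
    (\<Sum>m<k. Im (resolvent_trace n (wigner n (\<lambda>p. circ_eigenvalue k m
      (\<lambda>l. a l (Suc (fst p)) (Suc (snd p))))) z / of_nat n)) / real k"
proof -
  \<comment> \<open>Symmetry of \<open>a\<close> is known only for the indices that occur in the
    matrix; \<open>a'\<close> is symmetric everywhere and agrees with \<open>a\<close> on
    those.\<close>
  define a' where "a' = (\<lambda>l i j. a l (min i j) (max i j))"
  have sym': "a' l j i = a' l i j" for l i j by (simp add: a'_def min.commute max.commute)
  define H where "H = (\<lambda>r s. block_circulant n k a' $$ (r, s))"
  have aa': "a l i j = a' l i j" if "1 \<le> l" "l \<le> k div 2 + 1" "1 \<le> i" "1 \<le> j" for l i j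
    using sym[of l i j] sym[of l j i] that by (cases "i \<le> j") (auto simp: a'_def min_def max_def)
  have "block_circulant n k a $$ (r, s) = H r s" if rs: "r < k * n" "s < k * n" for r s
  proof -
    have "sym_circulant k (\<lambda>l. a l (r div k + 1) (s div k + 1)) $$ (r mod k, s mod k) =
        sym_circulant k (\<lambda>l. a' l (r div k + 1) (s div k + 1)) $$ (r mod k, s mod k)"
      using k by (intro sym_circulant_cong aa') auto
    then show ?thesis using rs by (simp add: H_def block_circulant_def block_matrix_def)
  qed
  moreover have "dim_row (block_circulant n k a) = k * n" "dim_col (block_circulant n k a) = k * n"
    by (rule carrier_matD[OF block_circulant_carrier])+
  ultimately have mat: "map_mat complex_of_real (block_circulant n k a) =
      Matrix.mat (k * n) (k * n) (\<lambda>(i, j). complex_of_real (H i j))"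
    by (intro eq_matI) auto
  have symH: "sym_below (k * n) H"
    unfolding sym_below_def H_def using block_circulant_sym[of a', OF sym'] by blast
  have W: "resolvent_trace n (wigner n (\<lambda>p. circ_eigenvalue k m (\<lambda>l. a' l (Suc (fst p)) (Suc (snd p))))) z =
      resolvent_trace n (wigner n (\<lambda>p. circ_eigenvalue k m (\<lambda>l. a l (Suc (fst p)) (Suc (snd p))))) z" for m
    by (intro resolvent_trace_cong wigner_cong circ_eigenvalue_cong aa'[symmetric]) auto
  have "(\<integral>x. poisson z x \<partial>spectral_measure (map_mat complex_of_real (block_circulant n k a))) =
      Im (resolvent_trace (k * n) H z) / real (k * n)"
    unfolding mat by (rule poisson_spectral_measure[OF symH z])
  also have "resolvent_trace (k * n) H z = (\<Sum>m<k. resolvent_trace n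
      (wigner n (\<lambda>p. circ_eigenvalue k m (\<lambda>l. a' l (Suc (fst p)) (Suc (snd p))))) z)"
    unfolding H_def by (rule resolvent_trace_block_circulant[OF sym' k z])
  finally show ?thesis unfolding W by (simp add: sum_divide_distrib Im_divide_of_nat mult.commute)
qed

theorem corollary1:
  fixes M :: "'w measure"
    and k q :: nat
    and a :: "nat \<Rightarrow> nat \<Rightarrow> nat \<Rightarrow> 'w \<Rightarrow> real"
  assumes "prob_space M"
    and "k \<ge> 1"
    and "q = k div 2 + 1"
    and indep: "prob_space.indep_vars M (\<lambda>_. borel) (\<lambda>(l, i, j). a l i j)
          {(l, i, j). 1 \<le> l \<and> l \<le> q \<and> 1 \<le> i \<and> i \<le> j}"
    and ident: "\<And>l i j. 1 \<le> l \<Longrightarrow> l \<le> q \<Longrightarrow> 1 \<le> i \<Longrightarrow> i \<le> j \<Longrightarrow>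
          distr M borel (a l i j) = distr M borel (a 1 1 1)"
    and sq_int: "\<And>l i j. 1 \<le> l \<Longrightarrow> l \<le> q \<Longrightarrow> 1 \<le> i \<Longrightarrow> i \<le> j \<Longrightarrow>
          integrable M (\<lambda>\<omega>. (a l i j \<omega>)\<^sup>2)"
    and var: "\<And>l i j. 1 \<le> l \<Longrightarrow> l \<le> q \<Longrightarrow> 1 \<le> i \<Longrightarrow> i \<le> j \<Longrightarrow>
          prob_space.variance M (a l i j) = 1"
    and sym: "\<And>l i j \<omega>. 1 \<le> l \<Longrightarrow> l \<le> q \<Longrightarrow> 1 \<le> i \<Longrightarrow> i \<le> j \<Longrightarrow> \<omega> \<in> space M \<Longrightarrow>
          a l j i \<omega> = a l i j \<omega>"
  shows "AE \<omega> in M. weak_conv_m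
           (\<lambda>n. spectral_measure
                  (map_mat complex_of_real (block_circulant n k (\<lambda>l i j. a l i j \<omega>))))
           (limit_law k)"
proof -
  note q = \<open>q = k div 2 + 1\<close>
  have k: "k > 0" using \<open>k \<ge> 1\<close> by simp
  define \<mu> where "\<mu> = (\<lambda>\<omega> n. spectral_measure
    (map_mat complex_of_real (block_circulant n k (\<lambda>l i j. a l i j \<omega>))))"
  have conv: "AE \<omega> in M. (\<lambda>n. \<integral>x. poisson z x \<partial>\<mu> \<omega> n) \<longlonglongrightarrow> (\<integral>x. poisson z x \<partial>limit_law k)"
    if z: "Im z > 0" for z
  proof -
    have "\<exists>r. of_real (circ_variance k m) * r\<^sup>2 + z * r + 1 = 0 \<and> Im r > 0" for m
      using semicircle_equation_root_exists[OF circ_variance_pos[OF k] z] by metis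
    then obtain r where r: "\<And>m. of_real (circ_variance k m) * (r m)\<^sup>2 + z * r m + 1 = 0" "\<And>m. Im (r m) > 0"
      by metis
    define t where "t = (\<lambda>\<omega> m n. resolvent_trace n (wigner n (\<lambda>p. circ_eigenvalue k m
      (\<lambda>l. a l (Suc (fst p)) (Suc (snd p)) \<omega>))) z / of_nat n)"
    have "AE \<omega> in M. t \<omega> m \<longlonglongrightarrow> r m" for m
      unfolding t_def
      by (rule block_circulant_stieltjes[OF \<open>prob_space M\<close> k indep[unfolded q] ident[unfolded q]
            sq_int[unfolded q] var[unfolded q] z r])
    then have "AE \<omega> in M. \<forall>m. t \<omega> m \<longlonglongrightarrow> r m" by (simp add: AE_all_countable)
    moreover have "AE \<omega> in M. \<omega> \<in> space M" by (rule AE_space)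
    ultimately show ?thesis
    proof eventually_elim
      case (elim \<omega>)
      have "(\<lambda>n. (\<Sum>m<k. Im (t \<omega> m n)) / real k) \<longlonglongrightarrow> (\<Sum>m<k. Im (r m)) / real k"
        using elim k by (intro tendsto_divide tendsto_sum tendsto_Im tendsto_const) auto
      moreover have "(\<integral>x. poisson z x \<partial>\<mu> \<omega> n) = (\<Sum>m<k. Im (t \<omega> m n)) / real k" for n
        unfolding \<mu>_def t_def using elim sym[unfolded q]
        by (intro poisson_spectral_block_circulant[OF k z]) auto
      moreover have "(\<integral>x. poisson z x \<partial>limit_law k) = (\<Sum>m<k. Im (r m)) / real k"
        unfolding poisson_limit_law[OF k z] poisson_semicircle[OF circ_variance_pos[OF k] z r] ..
      ultimately show ?case by simp
    qed
  qed
  obtain Q :: "complex set" where Q: "countable Q" "\<And>U. open U \<Longrightarrow> U \<noteq> {} \<Longrightarrow> \<exists>w\<in>Q. w \<in> U"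
    using countable_dense_exists by metis
  have "AE \<omega> in M. \<forall>z\<in>Q \<inter> {z. Im z > 0}.
      (\<lambda>n. \<integral>x. poisson z x \<partial>\<mu> \<omega> n) \<longlonglongrightarrow> (\<integral>x. poisson z x \<partial>limit_law k)"
    using conv Q(1) by (subst AE_ball_countable) auto
  then show ?thesis
  proof eventually_elim
    case (elim \<omega>)
    \<comment> \<open>For n = 0 the matrix is empty and its spectral measure is zero, so the
      sequence is shifted by one here and shifted back at the end.\<close>
    have dist: "real_distribution (\<mu> \<omega> (Suc n))" for n
    proof -
      have "prob_space (\<mu> \<omega> (Suc n))"
        unfolding \<mu>_def using k by (intro prob_space_spectral_measure[of _ "k * Suc n"])
          (simp_all del: mult_Suc_right)
      then show ?thesis
        unfolding real_distribution_def real_distribution_axioms_def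
        by (simp add: \<mu>_def spectral_measure_def)
    qed
    have "weak_conv_m (\<lambda>n. \<mu> \<omega> (Suc n)) (limit_law k)"
    proof (rule weak_conv_m_if_poisson_integrals_converge[OF dist real_distribution_limit_law[OF k]])
      fix z :: complex assume z: "Im z > 0"
      show "(\<lambda>n. \<integral>x. poisson z x \<partial>\<mu> \<omega> (Suc n)) \<longlonglongrightarrow> (\<integral>x. poisson z x \<partial>limit_law k)"
      proof (rule poisson_integrals_converge_from_dense[OF dist real_distribution_limit_law[OF k] Q(2) _ z])
        fix w assume "w \<in> Q" "Im w > 0"
        then have "(\<lambda>n. \<integral>x. poisson w x \<partial>\<mu> \<omega> n) \<longlonglongrightarrow> (\<integral>x. poisson w x \<partial>limit_law k)"
          using elim by simp
        then show "(\<lambda>n. \<integral>x. poisson w x \<partial>\<mu> \<omega> (Suc n)) \<longlonglongrightarrow> (\<integral>x. poisson w x \<partial>limit_law k)"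
          by (rule LIMSEQ_Suc)
      qed
    qed
    then have "weak_conv_m (\<mu> \<omega>) (limit_law k)"
      unfolding weak_conv_m_def weak_conv_def by (simp add: filterlim_sequentially_Suc[of "\<lambda>n. cdf (\<mu> \<omega> n) _"])
    then show ?case unfolding \<mu>_def .
  qed
qed

end
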